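(* Let $R$ be a left Harada algebra with arrangement $\{e_{ij}\}_{1\le i\le m,\,1\le j\le n_i}$ of its primitive idempotents, and let $P_{ij}=J^{j-1}(e_{i1}R)$. A complete set of isomorphism classes of indecomposable $R$-modules whose projective dimension is equal to one is given by $$\{P_{ik}/P_{il}\ \mid\ 1\le i\le m,\ 1\le k<l\le n_i\}.$$
   Context: $K$ is an algebraically closed field; an algebra means a finite dimensional associative algebra over $K$; all modules are finitely generated right modules. For a module $M$, $J(M)$ is its Jacobson radical, $J^0(M)=M$ and $J^k(M)=J(J^{k-1}(M))$ is the $k$-th radical; $J(R)$ is the Jacobson radical of the algebra $R$. A basic algebra $R$ is called a left Harada algebra if a complete set of orthogonal primitive idempotents of $R$ can be arranged as $\{e_{ij}\mid 1\le i\le m,\ 1\le j\le n_i\}$ such that (1) $e_{i1}R$ is an injective $R$-module for every $i=1,\dots,m$, and (2) $e_{ij}R\simeq e_{i,j-1}J(R)$ for every $i=1,\dots,m$ and $j=2,\dots,n_i$. For such $R$ fix such an arrangement and put $P_{ij}:=J^{j-1}(e_{i1}R)\simeq e_{ij}R$ for $1\le i\le m$, $1\le j\le n_i$; thus $P_{i1}\supset P_{i2}\supset\cdots\supset P_{in_i}$ is a chain of indecomposable projective $R$-modules. *)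

theory Defs
  imports "HOL-Algebra.Algebra" "HOL-Library.Extended_Nat"
begin

section \<open>Right modules over a ring\<close>

text \<open>
  The record \<open>module\<close> of the library is reused. Its scalar multiplication \<open>r \<odot> x\<close> is read as
  the right action \<open>x r\<close>, whence the order of the factors in \<open>smult_assoc\<close>. As in the library's
  locale \<open>module\<close>, the fields \<open>mult\<close> and \<open>one\<close> of a module play no role.
\<close>

locale right_module = R?: ring R + M?: abelian_group M
  for R :: "('r, 'x) ring_scheme" (structure) and M :: "('r, 'm) module" (structure) +
  assumes smult_closed [simp, intro]:
      "\<lbrakk>r \<in> carrier R; x \<in> carrier M\<rbrakk> \<Longrightarrow> r \<odot>\<^bsub>M\<^esub> x \<in> carrier M"
    and smult_l_distr:
      "\<lbrakk>r \<in> carrier R; s \<in> carrier R; x \<in> carrier M\<rbrakk> \<Longrightarrow>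
       (r \<oplus> s) \<odot>\<^bsub>M\<^esub> x = r \<odot>\<^bsub>M\<^esub> x \<oplus>\<^bsub>M\<^esub> s \<odot>\<^bsub>M\<^esub> x"
    and smult_r_distr:
      "\<lbrakk>r \<in> carrier R; x \<in> carrier M; y \<in> carrier M\<rbrakk> \<Longrightarrow>
       r \<odot>\<^bsub>M\<^esub> (x \<oplus>\<^bsub>M\<^esub> y) = r \<odot>\<^bsub>M\<^esub> x \<oplus>\<^bsub>M\<^esub> r \<odot>\<^bsub>M\<^esub> y"
    and smult_assoc:
      "\<lbrakk>r \<in> carrier R; s \<in> carrier R; x \<in> carrier M\<rbrakk> \<Longrightarrow>
       (r \<otimes> s) \<odot>\<^bsub>M\<^esub> x = s \<odot>\<^bsub>M\<^esub> (r \<odot>\<^bsub>M\<^esub> x)"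
    and smult_one [simp]:
      "x \<in> carrier M \<Longrightarrow> \<one> \<odot>\<^bsub>M\<^esub> x = x"

definition finitely_generated :: "('r, 'x) ring_scheme \<Rightarrow> ('r, 'm) module \<Rightarrow> bool" where
  "finitely_generated R M \<longleftrightarrow>
     (\<exists>B. finite B \<and> B \<subseteq> carrier M \<and>
        (\<forall>x \<in> carrier M. \<exists>c \<in> B \<rightarrow> carrier R. x = (\<Oplus>\<^bsub>M\<^esub> b \<in> B. c b \<odot>\<^bsub>M\<^esub> b)))"

definition fg_module :: "('r, 'x) ring_scheme \<Rightarrow> ('r, 'm) module \<Rightarrow> bool" where
  "fg_module R M \<longleftrightarrow> right_module R M \<and> finitely_generated R M"

definition rmod_hom ::
  "('r, 'x) ring_scheme \<Rightarrow> ('r, 'm) module \<Rightarrow> ('r, 'n) module \<Rightarrow> ('m \<Rightarrow> 'n) set" where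
  "rmod_hom R M N =
     {f \<in> carrier M \<rightarrow> carrier N.
        (\<forall>x \<in> carrier M. \<forall>y \<in> carrier M. f (x \<oplus>\<^bsub>M\<^esub> y) = f x \<oplus>\<^bsub>N\<^esub> f y) \<and>
        (\<forall>r \<in> carrier R. \<forall>x \<in> carrier M. f (r \<odot>\<^bsub>M\<^esub> x) = r \<odot>\<^bsub>N\<^esub> f x)}"

definition rmod_iso :: "('r, 'x) ring_scheme \<Rightarrow> ('r, 'm) module \<Rightarrow> ('r, 'n) module \<Rightarrow> bool" where
  "rmod_iso R M N \<longleftrightarrow> (\<exists>f \<in> rmod_hom R M N. bij_betw f (carrier M) (carrier N))"

definition regular_module :: "('r, 'x) ring_scheme \<Rightarrow> ('r, 'r) module" where
  "regular_module R =
     \<lparr>carrier = carrier R, monoid.mult = monoid.mult R, monoid.one = \<one>\<^bsub>R\<^esub>,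
      ring.zero = \<zero>\<^bsub>R\<^esub>, ring.add = ring.add R,
      smult = (\<lambda>r x. x \<otimes>\<^bsub>R\<^esub> r)\<rparr>"

definition sub_module :: "('r, 'm) module \<Rightarrow> 'm set \<Rightarrow> ('r, 'm) module" where
  "sub_module M N = M\<lparr>carrier := N\<rparr>"

definition quotient_module :: "('r, 'm) module \<Rightarrow> 'm set \<Rightarrow> ('r, 'm set) module" where
  "quotient_module M N =
     \<lparr>carrier = a_rcosets\<^bsub>M\<^esub> N, monoid.mult = undefined, monoid.one = undefined,
      ring.zero = N, ring.add = set_add M,
      smult = (\<lambda>r C. \<Union>x \<in> C. N +>\<^bsub>M\<^esub> (r \<odot>\<^bsub>M\<^esub> x))\<rparr>"

definition indecomposable_module :: "('r, 'x) ring_scheme \<Rightarrow> ('r, 'm) module \<Rightarrow> bool" where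
  "indecomposable_module R M \<longleftrightarrow>
     carrier M \<noteq> {\<zero>\<^bsub>M\<^esub>} \<and>
     (\<forall>A B. submodule A R M \<and> submodule B R M \<and>
            A <+>\<^bsub>M\<^esub> B = carrier M \<and> A \<inter> B = {\<zero>\<^bsub>M\<^esub>} \<longrightarrow>
            A = {\<zero>\<^bsub>M\<^esub>} \<or> B = {\<zero>\<^bsub>M\<^esub>})"

definition maximal_submodule :: "'m set \<Rightarrow> ('r, 'x) ring_scheme \<Rightarrow> ('r, 'm) module \<Rightarrow> bool" where
  "maximal_submodule N R M \<longleftrightarrow>
     submodule N R M \<and> N \<noteq> carrier M \<and>
     (\<forall>L. submodule L R M \<and> N \<subseteq> L \<longrightarrow> L = N \<or> L = carrier M)"

definition module_radical :: "('r, 'x) ring_scheme \<Rightarrow> ('r, 'm) module \<Rightarrow> 'm set" where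
  "module_radical R M = carrier M \<inter> \<Inter>{N. maximal_submodule N R M}"

fun radical_power :: "('r, 'x) ring_scheme \<Rightarrow> ('r, 'm) module \<Rightarrow> nat \<Rightarrow> 'm set" where
  "radical_power R M 0 = carrier M"
| "radical_power R M (Suc k) = module_radical R (sub_module M (radical_power R M k))"

text \<open>The Jacobson radical of a ring, as the intersection of its maximal right ideals.\<close>

definition ring_radical :: "('r, 'x) ring_scheme \<Rightarrow> 'r set" where
  "ring_radical R = module_radical R (regular_module R)"


section \<open>Injectivity, projectivity and projective dimension\<close>

text \<open>
  HOL does not quantify over types inside a definition, so the test modules for injectivity and
  projectivity and the terms of resolutions are taken with carriers in one fixed type. No
  generality is lost: if \<open>g\<^sub>1, \<dots>, g\<^sub>n\<close> generate a module, then sending \<open>x\<close> to the set of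
  coefficient tuples that express \<open>x\<close> in terms of the \<open>g\<^sub>i\<close> is an injection into
  \<open>(nat \<Rightarrow> 'r) set\<close>, along which the module structure can be transported.
\<close>

type_synonym 'r fg_universe = "(nat \<Rightarrow> 'r) set"

definition injective_module :: "('r, 'x) ring_scheme \<Rightarrow> ('r, 'm) module \<Rightarrow> bool" where
  "injective_module R E \<longleftrightarrow>
     fg_module R E \<and>
     (\<forall>(A :: ('r, 'r fg_universe) module) (B :: ('r, 'r fg_universe) module).
        fg_module R A \<and> fg_module R B \<longrightarrow>
        (\<forall>g \<in> rmod_hom R A B. \<forall>f \<in> rmod_hom R A E.
           inj_on g (carrier A) \<longrightarrow>
           (\<exists>h \<in> rmod_hom R B E. \<forall>x \<in> carrier A. h (g x) = f x)))"

definition projective_module :: "('r, 'x) ring_scheme \<Rightarrow> ('r, 'm) module \<Rightarrow> bool" where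
  "projective_module R P \<longleftrightarrow>
     fg_module R P \<and>
     (\<forall>(A :: ('r, 'r fg_universe) module) (B :: ('r, 'r fg_universe) module).
        fg_module R A \<and> fg_module R B \<longrightarrow>
        (\<forall>g \<in> rmod_hom R A B. \<forall>f \<in> rmod_hom R P B.
           g ` carrier A = carrier B \<longrightarrow>
           (\<exists>h \<in> rmod_hom R P A. \<forall>x \<in> carrier P. g (h x) = f x)))"

text \<open>
  An exact sequence \<open>\<dots> \<rightarrow> P 2 \<rightarrow> P 1 \<rightarrow> P 0 \<rightarrow> M \<rightarrow> 0\<close> with projective terms \<open>P i\<close>, zero for
  \<open>i > n\<close>, with augmentation \<open>\<epsilon>\<close> and differentials \<open>d i : P (i + 1) \<rightarrow> P i\<close>.
\<close>

definition projective_resolution ::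
  "('r, 'x) ring_scheme \<Rightarrow> ('r, 'm) module \<Rightarrow> nat \<Rightarrow>
   (nat \<Rightarrow> ('r, 'r fg_universe) module) \<Rightarrow>
   (nat \<Rightarrow> 'r fg_universe \<Rightarrow> 'r fg_universe) \<Rightarrow> ('r fg_universe \<Rightarrow> 'm) \<Rightarrow> bool" where
  "projective_resolution R M n P d \<epsilon> \<longleftrightarrow>
     (\<forall>i. projective_module R (P i)) \<and>
     (\<forall>i > n. carrier (P i) = {\<zero>\<^bsub>P i\<^esub>}) \<and>
     \<epsilon> \<in> rmod_hom R (P 0) M \<and>
     (\<forall>i. d i \<in> rmod_hom R (P (Suc i)) (P i)) \<and>
     \<epsilon> ` carrier (P 0) = carrier M \<and>
     d 0 ` carrier (P 1) = a_kernel (P 0) M \<epsilon> \<and>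
     (\<forall>i. d (Suc i) ` carrier (P (Suc (Suc i))) = a_kernel (P (Suc i)) (P i) (d i))"

text \<open>The value is \<open>\<infinity>\<close> if there is no resolution of finite length.\<close>

definition projective_dimension :: "('r, 'x) ring_scheme \<Rightarrow> ('r, 'm) module \<Rightarrow> enat" where
  "projective_dimension R M = Inf {enat n | n. \<exists>P d \<epsilon>. projective_resolution R M n P d \<epsilon>}"


section \<open>Left Harada algebras\<close>

definition fd_algebra :: "('k, 'x) ring_scheme \<Rightarrow> ('k, 'r) module \<Rightarrow> bool" where
  "fd_algebra K R \<longleftrightarrow>
     algebraically_closed K \<and> ring R \<and> module K R \<and>
     (\<forall>c \<in> carrier K. \<forall>x \<in> carrier R. \<forall>y \<in> carrier R.
        c \<odot>\<^bsub>R\<^esub> (x \<otimes>\<^bsub>R\<^esub> y) = (c \<odot>\<^bsub>R\<^esub> x) \<otimes>\<^bsub>R\<^esub> y \<and>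
        c \<odot>\<^bsub>R\<^esub> (x \<otimes>\<^bsub>R\<^esub> y) = x \<otimes>\<^bsub>R\<^esub> (c \<odot>\<^bsub>R\<^esub> y)) \<and>
     finitely_generated K R"

definition idempotent_elt :: "('r, 'x) ring_scheme \<Rightarrow> 'r \<Rightarrow> bool" where
  "idempotent_elt R e \<longleftrightarrow> e \<in> carrier R \<and> e \<otimes>\<^bsub>R\<^esub> e = e"

definition orthogonal_elts :: "('r, 'x) ring_scheme \<Rightarrow> 'r \<Rightarrow> 'r \<Rightarrow> bool" where
  "orthogonal_elts R e f \<longleftrightarrow> e \<otimes>\<^bsub>R\<^esub> f = \<zero>\<^bsub>R\<^esub> \<and> f \<otimes>\<^bsub>R\<^esub> e = \<zero>\<^bsub>R\<^esub>"

definition primitive_idempotent :: "('r, 'x) ring_scheme \<Rightarrow> 'r \<Rightarrow> bool" where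
  "primitive_idempotent R e \<longleftrightarrow>
     idempotent_elt R e \<and> e \<noteq> \<zero>\<^bsub>R\<^esub> \<and>
     (\<forall>f g. idempotent_elt R f \<and> idempotent_elt R g \<and> orthogonal_elts R f g \<and> e = f \<oplus>\<^bsub>R\<^esub> g \<longrightarrow>
            f = \<zero>\<^bsub>R\<^esub> \<or> g = \<zero>\<^bsub>R\<^esub>)"

definition complete_primitive_idempotents :: "('r, 'x) ring_scheme \<Rightarrow> 'r set \<Rightarrow> bool" where
  "complete_primitive_idempotents R E \<longleftrightarrow>
     finite E \<and> (\<forall>e \<in> E. primitive_idempotent R e) \<and>
     (\<forall>e \<in> E. \<forall>f \<in> E. e \<noteq> f \<longrightarrow> orthogonal_elts R e f) \<and>
     (\<Oplus>\<^bsub>R\<^esub> e \<in> E. e) = \<one>\<^bsub>R\<^esub>"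

text \<open>The right ideal \<open>e R\<close> as a module.\<close>

definition idempotent_module :: "('r, 'x) ring_scheme \<Rightarrow> 'r \<Rightarrow> ('r, 'r) module" where
  "idempotent_module R e = sub_module (regular_module R) (e <#\<^bsub>R\<^esub> carrier R)"

definition basic_algebra :: "('k, 'x) ring_scheme \<Rightarrow> ('k, 'r) module \<Rightarrow> bool" where
  "basic_algebra K R \<longleftrightarrow>
     fd_algebra K R \<and>
     (\<forall>E. complete_primitive_idempotents R E \<longrightarrow>
        (\<forall>e \<in> E. \<forall>f \<in> E.
           e \<noteq> f \<longrightarrow> \<not> rmod_iso R (idempotent_module R e) (idempotent_module R f)))"

definition harada_index :: "nat \<Rightarrow> (nat \<Rightarrow> nat) \<Rightarrow> (nat \<times> nat) set" where
  "harada_index m n = (SIGMA i:{1..m}. {1..n i})"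

definition harada_arrangement ::
  "('r, 'x) ring_scheme \<Rightarrow> nat \<Rightarrow> (nat \<Rightarrow> nat) \<Rightarrow> (nat \<Rightarrow> nat \<Rightarrow> 'r) \<Rightarrow> bool" where
  "harada_arrangement R m n e \<longleftrightarrow>
     (\<forall>i \<in> {1..m}. 1 \<le> n i) \<and>
     inj_on (\<lambda>(i, j). e i j) (harada_index m n) \<and>
     complete_primitive_idempotents R ((\<lambda>(i, j). e i j) ` harada_index m n) \<and>
     (\<forall>i \<in> {1..m}. injective_module R (idempotent_module R (e i 1))) \<and>
     (\<forall>i \<in> {1..m}. \<forall>j \<in> {2..n i}.
        rmod_iso R (idempotent_module R (e i j))
          (sub_module (regular_module R) (e i (j - 1) <#\<^bsub>R\<^esub> ring_radical R)))"

definition left_harada_algebra :: "('k, 'x) ring_scheme \<Rightarrow> ('k, 'r) module \<Rightarrow> bool" where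
  "left_harada_algebra K R \<longleftrightarrow> basic_algebra K R \<and> (\<exists>m n e. harada_arrangement R m n e)"

text \<open>\<open>P\<^sub>i\<^sub>j = J\<^sup>j\<^sup>-\<^sup>1(e\<^sub>i\<^sub>1 R)\<close>, as a subset of \<open>R\<close>, and \<open>P\<^sub>i\<^sub>k / P\<^sub>i\<^sub>l\<close>.\<close>

definition harada_proj ::
  "('r, 'x) ring_scheme \<Rightarrow> (nat \<Rightarrow> nat \<Rightarrow> 'r) \<Rightarrow> nat \<Rightarrow> nat \<Rightarrow> 'r set" where
  "harada_proj R e i j = radical_power R (idempotent_module R (e i 1)) (j - 1)"

definition harada_quotient ::
  "('r, 'x) ring_scheme \<Rightarrow> (nat \<Rightarrow> nat \<Rightarrow> 'r) \<Rightarrow> nat \<Rightarrow> nat \<Rightarrow> nat \<Rightarrow> ('r, 'r set) module" where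
  "harada_quotient R e i k l =
     quotient_module (sub_module (regular_module R) (harada_proj R e i k)) (harada_proj R e i l)"

end

theory Submission
  imports Defs
begin

text \<open>
  Homomorphisms \<open>f R \<rightarrow> e R\<close> between right ideals generated by idempotents are left multiplications
  by elements of \<open>e R f\<close>, so the whole argument is carried out with matrices over \<open>R\<close>. An
  indecomposable module of projective dimension one is the cokernel of an injective map between
  direct sums of modules \<open>e\<^sub>i\<^sub>j R \<cong> P\<^sub>i\<^sub>j\<close>, and by cancelling invertible entries one may assume that no
  entry of the matrix of this map is an isomorphism.

  The Harada condition makes the maps between the \<open>P\<^sub>i\<^sub>j\<close> easy to describe. Each \<open>P\<^sub>i\<^sub>1\<close> is injective
  with a local endomorphism ring, hence uniform, and a map \<open>r : P\<^sub>i\<^sub>l \<rightarrow> P\<^sub>q\<^sub>j\<close> lifts to \<open>c : P\<^sub>i\<^sub>1 \<rightarrow> P\<^sub>q\<^sub>1\<close>. If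
  \<open>r\<close> is injective then so is \<open>c\<close>, whence \<open>q = i\<close> and \<open>c\<close> is an automorphism; automorphisms of \<open>P\<^sub>i\<^sub>1\<close>
  preserve its radical layers, so up to an automorphism \<open>r\<close> is the inclusion of \<open>P\<^sub>i\<^sub>l\<close> in \<open>P\<^sub>i\<^sub>j\<close>
  (\<open>monic_classification\<close>). If \<open>r\<close> is not injective then the image of \<open>c\<close> lies in the smallest layer
  \<open>P\<^sub>q\<^sub>,\<^sub>n\<^sub>q\<close> (\<open>lift_not_monic\<close>): otherwise it would be one of the projective layers, and \<open>c\<close> would
  split.

  Because the \<open>P\<^sub>i\<^sub>l\<close> are uniform and the map is injective, every column of the matrix has an injective
  entry. Take a column that belongs to a \<open>P\<^sub>i\<^sub>l\<close> with \<open>l\<close> minimal, and in it an injective entry whose row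
  belongs to a \<open>P\<^sub>i\<^sub>k\<close> with \<open>k\<close> maximal. By the description of the maps, the other entries of this
  column factor through the chosen entry on one side (\<open>factor_left\<close>), and the other entries of its
  row on the other side (\<open>factor_right\<close>). Row and column operations then clear the column and the
  row, so that \<open>P\<^sub>i\<^sub>k / P\<^sub>i\<^sub>l\<close> splits off. It is nonzero because the entry is not an isomorphism, so it
  is the whole indecomposable module (\<open>minimal_presentation_cyclic\<close>).

  Conversely, \<open>P\<^sub>i\<^sub>k / P\<^sub>i\<^sub>l\<close> is generated by every element outside its unique maximal submodule, hence
  indecomposable, and it has the resolution \<open>0 \<rightarrow> P\<^sub>i\<^sub>l \<rightarrow> P\<^sub>i\<^sub>k\<close>; it is not projective, since a section
  of the projection of \<open>P\<^sub>i\<^sub>k\<close> would make the kernel \<open>P\<^sub>i\<^sub>l\<close> vanish. An isomorphism between two such quotients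
  is induced by an isomorphism of their projective covers, which are pairwise not isomorphic as \<open>R\<close>
  is basic, and this isomorphism comes from an automorphism of \<open>P\<^sub>i\<^sub>1\<close>, so that also \<open>l\<close> is
  determined (\<open>quotient_iso_unique\<close>).
\<close>

section \<open>Right ideals and idempotents\<close>

definition right_ideal :: "('a, 'b) ring_scheme \<Rightarrow> 'a set \<Rightarrow> bool" where
  "right_ideal R I \<longleftrightarrow>
     I \<subseteq> carrier R \<and> \<zero>\<^bsub>R\<^esub> \<in> I \<and> (\<forall>x \<in> I. \<forall>y \<in> I. x \<oplus>\<^bsub>R\<^esub> y \<in> I) \<and>
     (\<forall>x \<in> I. \<forall>r \<in> carrier R. x \<otimes>\<^bsub>R\<^esub> r \<in> I)"

text \<open>
  The set \<open>e R f\<close>. For idempotents \<open>e\<close> and \<open>f\<close> left multiplication identifies it with the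
  homomorphisms from \<open>f R\<close> to \<open>e R\<close>, composition being the product of \<open>R\<close>.
\<close>

definition corner :: "('a, 'b) ring_scheme \<Rightarrow> 'a \<Rightarrow> 'a \<Rightarrow> 'a set" where
  "corner R e f = {x \<in> carrier R. e \<otimes>\<^bsub>R\<^esub> x = x \<and> x \<otimes>\<^bsub>R\<^esub> f = x}"

lemma mem_l_coset_iff: "y \<in> x <#\<^bsub>R\<^esub> H \<longleftrightarrow> (\<exists>h \<in> H. y = x \<otimes>\<^bsub>R\<^esub> h)"
  by (auto simp: l_coset_def)

lemma cornerD:
  assumes "x \<in> corner R e f"
  shows "x \<in> carrier R" "e \<otimes>\<^bsub>R\<^esub> x = x" "x \<otimes>\<^bsub>R\<^esub> f = x"
  using assms by (auto simp: corner_def)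

lemma cornerI:
  "\<lbrakk>x \<in> carrier R; e \<otimes>\<^bsub>R\<^esub> x = x; x \<otimes>\<^bsub>R\<^esub> f = x\<rbrakk> \<Longrightarrow> x \<in> corner R e f"
  by (auto simp: corner_def)

lemma right_idealD:
  assumes "right_ideal R I"
  shows "I \<subseteq> carrier R" "\<zero>\<^bsub>R\<^esub> \<in> I" "\<And>x y. \<lbrakk>x \<in> I; y \<in> I\<rbrakk> \<Longrightarrow> x \<oplus>\<^bsub>R\<^esub> y \<in> I"
    "\<And>x r. \<lbrakk>x \<in> I; r \<in> carrier R\<rbrakk> \<Longrightarrow> x \<otimes>\<^bsub>R\<^esub> r \<in> I"
  using assms by (auto simp: right_ideal_def)

context ring
begin

lemma add_diff_cancel: "\<lbrakk>x \<in> carrier R; y \<in> carrier R\<rbrakk> \<Longrightarrow> (x \<oplus> y) \<ominus> x = y"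
  using a_comm[of x y] by (simp add: minus_eq a_assoc r_neg)

lemma corner_mult:
  assumes "x \<in> corner R e f" "y \<in> corner R f g" "e \<in> carrier R" "g \<in> carrier R"
  shows "x \<otimes> y \<in> corner R e g"
  using assms by (auto simp: corner_def m_assoc[symmetric]) (simp add: m_assoc)

lemma corner_sandwich:
  assumes "x \<in> carrier R" "idempotent_elt R e" "idempotent_elt R f"
  shows "e \<otimes> x \<otimes> f \<in> corner R e f"
proof -
  have "e \<otimes> (e \<otimes> x \<otimes> f) = (e \<otimes> e) \<otimes> x \<otimes> f"
    using assms unfolding idempotent_elt_def by (metis m_assoc m_closed)
  moreover have "e \<otimes> x \<otimes> f \<otimes> f = e \<otimes> x \<otimes> (f \<otimes> f)"
    using assms unfolding idempotent_elt_def by (metis m_assoc m_closed)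
  ultimately show ?thesis using assms by (auto simp: corner_def idempotent_elt_def)
qed

lemma right_ideal_minus:
  assumes "right_ideal R I" "x \<in> I"
  shows "\<ominus> x \<in> I"
proof -
  have "x \<otimes> (\<ominus> \<one>) \<in> I" using assms by (auto simp: right_ideal_def)
  moreover have "x \<in> carrier R" using assms by (auto simp: right_ideal_def)
  ultimately show ?thesis by (simp add: r_minus)
qed

lemma right_ideal_iff_submodule: "right_ideal R I \<longleftrightarrow> submodule I R (regular_module R)"
proof
  assume I: "right_ideal R I"
  show "submodule I R (regular_module R)"
  proof (intro submodule.intro subgroup.intro submodule_axioms.intro)
    fix x assume x: "x \<in> I"
    then have xR: "x \<in> carrier R" using I by (auto simp: right_ideal_def)
    have "inv\<^bsub>add_monoid (regular_module R)\<^esub> x = \<ominus> x"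
      by (simp add: regular_module_def a_inv_def m_inv_def)
    then show "inv\<^bsub>add_monoid (regular_module R)\<^esub> x \<in> I"
      using right_ideal_minus[OF I x] by simp
  qed (use I in \<open>auto simp: right_ideal_def regular_module_def\<close>)
next
  assume "submodule I R (regular_module R)"
  then interpret submodule I R "regular_module R" .
  show "right_ideal R I"
    using subset one_closed m_closed smult_closed
    by (auto simp: right_ideal_def regular_module_def)
qed

lemma right_ideal_carrier: "right_ideal R (carrier R)"
  by (auto simp: right_ideal_def)

lemma right_ideal_one: "\<lbrakk>right_ideal R I; \<one> \<in> I\<rbrakk> \<Longrightarrow> I = carrier R"
  unfolding right_ideal_def using l_one by fastforce

lemma right_ideal_principal:
  assumes "x \<in> carrier R"
  shows "right_ideal R (x <# carrier R)"
  unfolding right_ideal_def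
proof (intro conjI ballI)
  show "x <# carrier R \<subseteq> carrier R" using assms by (auto simp: mem_l_coset_iff)
  show "\<zero> \<in> x <# carrier R" using assms by (auto simp: mem_l_coset_iff intro!: bexI[of _ \<zero>])
  show "y \<oplus> z \<in> x <# carrier R" if yz: "y \<in> x <# carrier R" "z \<in> x <# carrier R" for y z
  proof -
    obtain r s where "r \<in> carrier R" "s \<in> carrier R" "y = x \<otimes> r" "z = x \<otimes> s"
      using yz by (auto simp: mem_l_coset_iff)
    then show ?thesis using assms by (auto simp: mem_l_coset_iff r_distr intro!: bexI[of _ "r \<oplus> s"])
  qed
  show "y \<otimes> r \<in> x <# carrier R" if yr: "y \<in> x <# carrier R" "r \<in> carrier R" for y r
  proof -
    obtain s where "s \<in> carrier R" "y = x \<otimes> s" using yr by (auto simp: mem_l_coset_iff)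
    then show ?thesis using assms yr by (auto simp: mem_l_coset_iff m_assoc intro!: bexI[of _ "s \<otimes> r"])
  qed
qed

lemma principal_self: "x \<in> carrier R \<Longrightarrow> x \<in> x <# carrier R"
  by (auto simp: mem_l_coset_iff intro!: bexI[of _ \<one>])

lemma principal_subset_right_ideal: "\<lbrakk>right_ideal R I; x \<in> I\<rbrakk> \<Longrightarrow> x <# carrier R \<subseteq> I"
  by (auto simp: right_ideal_def mem_l_coset_iff)

lemma mem_idempotent_right_ideal_iff:
  "idempotent_elt R e \<Longrightarrow> x \<in> e <# carrier R \<longleftrightarrow> x \<in> carrier R \<and> e \<otimes> x = x"
  by (auto simp: mem_l_coset_iff idempotent_elt_def m_assoc[symmetric]) metis

lemma right_ideal_kernel:
  assumes "c \<in> carrier R"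
  shows "right_ideal R {u \<in> carrier R. c \<otimes> u = \<zero>}"
  using assms by (auto simp: right_ideal_def r_distr m_assoc[symmetric])

lemma right_ideal_sum:
  assumes I: "right_ideal R I" and J: "right_ideal R J"
  shows "right_ideal R {x \<oplus> y |x y. x \<in> I \<and> y \<in> J}"
  unfolding right_ideal_def
proof (intro conjI ballI)
  have c: "I \<subseteq> carrier R" "J \<subseteq> carrier R" using I J by (auto simp: right_ideal_def)
  show "{x \<oplus> y |x y. x \<in> I \<and> y \<in> J} \<subseteq> carrier R" using c by auto
  have "\<zero> \<in> I" "\<zero> \<in> J" "\<zero> = \<zero> \<oplus> \<zero>" using I J by (auto simp: right_ideal_def)
  then show "\<zero> \<in> {x \<oplus> y |x y. x \<in> I \<and> y \<in> J}" by blast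
  show "p \<oplus> q \<in> {x \<oplus> y |x y. x \<in> I \<and> y \<in> J}"
    if pq: "p \<in> {x \<oplus> y |x y. x \<in> I \<and> y \<in> J}" "q \<in> {x \<oplus> y |x y. x \<in> I \<and> y \<in> J}" for p q
  proof -
    obtain x y x' y' where *: "p = x \<oplus> y" "q = x' \<oplus> y'" "x \<in> I" "x' \<in> I" "y \<in> J" "y' \<in> J"
      using pq by blast
    have "x \<in> carrier R" "x' \<in> carrier R" "y \<in> carrier R" "y' \<in> carrier R" using * c by auto
    then have "p \<oplus> q = (x \<oplus> x') \<oplus> (y \<oplus> y')" using * by (simp add: a_ac)
    moreover have "x \<oplus> x' \<in> I" "y \<oplus> y' \<in> J" using I J * by (auto simp: right_ideal_def)
    ultimately show ?thesis by blast
  qed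
  show "p \<otimes> r \<in> {x \<oplus> y |x y. x \<in> I \<and> y \<in> J}"
    if pr: "p \<in> {x \<oplus> y |x y. x \<in> I \<and> y \<in> J}" "r \<in> carrier R" for p r
  proof -
    obtain x y where *: "p = x \<oplus> y" "x \<in> I" "y \<in> J" using pr by blast
    then have "p \<otimes> r = x \<otimes> r \<oplus> y \<otimes> r" using c pr by (simp add: l_distr subset_eq)
    moreover have "x \<otimes> r \<in> I" "y \<otimes> r \<in> J" using I J * pr by (auto simp: right_ideal_def)
    ultimately show ?thesis by blast
  qed
qed

text \<open>
  Such an \<open>f\<close> would split \<open>e\<close> into the orthogonal idempotents \<open>f\<close> and \<open>e - f\<close>.
\<close>

lemma primitive_idempotent_corner:
  assumes e: "primitive_idempotent R e" and f: "f \<in> corner R e e" "f \<otimes> f = f"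
  shows "f = \<zero> \<or> f = e"
proof -
  have eR: "e \<in> carrier R" "e \<otimes> e = e" using e by (auto simp: primitive_idempotent_def idempotent_elt_def)
  have fR: "f \<in> carrier R" "e \<otimes> f = f" "f \<otimes> e = f" using f by (auto simp: corner_def)
  let ?g = "e \<ominus> f"
  have fg: "f \<otimes> ?g = \<zero>" "?g \<otimes> f = \<zero>"
    using eR fR f(2) by (simp_all add: minus_eq r_distr l_distr r_minus l_minus r_neg)
  moreover have "?g \<otimes> ?g = ?g"
  proof -
    have "?g \<otimes> ?g = e \<otimes> ?g \<ominus> f \<otimes> ?g"
      using eR fR by (simp add: minus_eq l_distr l_minus del: fg)
    also have "\<dots> = ?g"
      using eR fR fg by (simp add: minus_eq r_distr r_minus)
    finally show ?thesis .
  qed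
  moreover have "e = f \<oplus> ?g" using eR fR by (simp add: minus_eq a_ac r_neg2 r_neg) 
  moreover have "?g \<in> carrier R" using eR fR by simp
  ultimately have "f = \<zero> \<or> ?g = \<zero>"
    using e fR f(2) unfolding primitive_idempotent_def idempotent_elt_def orthogonal_elts_def by blast
  then show ?thesis using eR fR by auto
qed

text \<open>
  The product \<open>y x\<close> is an idempotent of \<open>f R f\<close>, and it is not zero because \<open>x (y x) y = e\<close>. In terms
  of modules: a split monomorphism from \<open>e R\<close> into the indecomposable \<open>f R\<close> is an isomorphism.
\<close>

lemma retract_of_primitive:
  assumes e: "idempotent_elt R e" "e \<noteq> \<zero>" and f: "primitive_idempotent R f"
    and x: "x \<in> corner R e f" and y: "y \<in> corner R f e" and xy: "x \<otimes> y = e"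
  shows "y \<otimes> x = f"
proof -
  have fR: "f \<in> carrier R" using f by (auto simp: primitive_idempotent_def idempotent_elt_def)
  have eR: "e \<in> carrier R" using e by (auto simp: idempotent_elt_def)
  note c = cornerD[OF x] cornerD[OF y]
  have "(y \<otimes> x) \<otimes> (y \<otimes> x) = y \<otimes> (x \<otimes> y) \<otimes> x" using c by (simp add: m_assoc)
  then have "(y \<otimes> x) \<otimes> (y \<otimes> x) = y \<otimes> x" using xy c by simp
  moreover have "y \<otimes> x \<in> corner R f f" using corner_mult[OF y x fR fR] .
  ultimately have "y \<otimes> x = \<zero> \<or> y \<otimes> x = f" using primitive_idempotent_corner[OF f] by blast
  moreover have "y \<otimes> x \<noteq> \<zero>"
  proof
    assume 0: "y \<otimes> x = \<zero>"
    have "e = e \<otimes> e" using e by (simp add: idempotent_elt_def)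
    also have "\<dots> = x \<otimes> (y \<otimes> x) \<otimes> y" unfolding xy[symmetric] using c by (simp add: m_assoc del: c)
    also have "\<dots> = \<zero>" using 0 c by simp
    finally show False using e by simp
  qed
  ultimately show ?thesis by blast
qed

end

section \<open>Rings of finite length\<close>

text \<open>
  Finite dimensionality enters the module theory by bounding chains of right ideals. A natural number attached to each right ideal, strictly increasing along proper
  inclusions, expresses this without composition series.
\<close>

locale finite_length_ring = ring R for R (structure) +
  assumes length_function:
    "\<exists>len :: 'a set \<Rightarrow> nat. \<forall>I J. right_ideal R I \<and> right_ideal R J \<and> I \<subset> J \<longrightarrow> len I < len J"
begin

lemma descending_chain_stops:
  assumes I: "\<And>k. right_ideal R (I k)" and dec: "\<And>k l. k \<le> l \<Longrightarrow> I l \<subseteq> I (k :: nat)"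
  shows "\<exists>N. \<forall>k \<ge> N. I k = I N"
proof -
  obtain len :: "'a set \<Rightarrow> nat" where
    len: "\<And>I J. right_ideal R I \<Longrightarrow> right_ideal R J \<Longrightarrow> I \<subset> J \<Longrightarrow> len I < len J"
    using length_function by blast
  obtain N where N: "\<And>k. len (I N) \<le> len (I k)"
    using ex_has_least_nat[of "\<lambda>k. True" 0 "\<lambda>k. len (I k)"] by auto
  have "I k = I N" if "k \<ge> N" for k
  proof (rule ccontr)
    assume "I k \<noteq> I N"
    then have "I k \<subset> I N" using dec[OF that] by blast
    then show False using len[OF I I, of k N] N[of k] by linarith
  qed
  then show ?thesis by blast
qed

lemma ascending_family_has_maximal:
  assumes F: "F \<noteq> {}" "\<And>I. I \<in> F \<Longrightarrow> right_ideal R I"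
  shows "\<exists>N \<in> F. \<forall>I \<in> F. N \<subseteq> I \<longrightarrow> I = N"
proof -
  obtain len :: "'a set \<Rightarrow> nat" where
    len: "\<And>I J. right_ideal R I \<Longrightarrow> right_ideal R J \<Longrightarrow> I \<subset> J \<Longrightarrow> len I < len J"
    using length_function by blast
  have bound: "len I \<le> len (carrier R)" if "I \<in> F" for I
    using len[OF F(2)[OF that] right_ideal_carrier] right_idealD(1)[OF F(2)[OF that]]
    by (metis less_imp_le order_refl psubsetI)
  obtain I0 where "I0 \<in> F" using F by blast
  then obtain N where N: "N \<in> F" "\<And>I. I \<in> F \<Longrightarrow> len (carrier R) - len N \<le> len (carrier R) - len I"
    using ex_has_least_nat[of "\<lambda>I. I \<in> F" I0 "\<lambda>I. len (carrier R) - len I"] by auto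
  have "I = N" if I: "I \<in> F" "N \<subseteq> I" for I
  proof (rule ccontr)
    assume "I \<noteq> N"
    then have "len N < len I" using len[OF F(2)[OF N(1)] F(2)[OF I(1)]] I(2) by blast
    then show False using N(2)[OF I(1)] bound[OF I(1)] bound[OF N(1)] by linarith
  qed
  then show ?thesis using N(1) by blast
qed

text \<open>
  Fitting's lemma. For large \<open>k\<close> the power \<open>p\<close> of \<open>c\<close> has \<open>p R = p\<^sup>2 R\<close> and its kernel meets \<open>p R\<close>
  trivially, so the projection onto \<open>p R\<close> along the kernel is given by an idempotent of \<open>e R e\<close>, which
  can only be \<open>0\<close> or \<open>e\<close>.
\<close>

lemma fitting:
  assumes e: "primitive_idempotent R e" and c: "c \<in> corner R e e"
  shows "(\<exists>k. c [^] Suc k = \<zero>) \<or> (\<exists>d \<in> corner R e e. c \<otimes> d = e \<and> d \<otimes> c = e)"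
proof -
  have id: "idempotent_elt R e" and e0: "e \<noteq> \<zero>" using e by (auto simp: primitive_idempotent_def)
  then have eR: "e \<in> carrier R" "e \<otimes> e = e" by (auto simp: idempotent_elt_def)
  note cR = cornerD[OF c]
  let ?im = "\<lambda>k :: nat. (c [^] k) <# carrier R" and ?ker = "\<lambda>k :: nat. {u \<in> carrier R. c [^] k \<otimes> u = \<zero>}"
  have im_dec: "?im l \<subseteq> ?im k" if "k \<le> l" for k l :: nat
  proof -
    have "c [^] l = c [^] k \<otimes> c [^] (l - k)" using cR that by (simp add: nat_pow_mult)
    then have "c [^] l \<in> ?im k" using cR by (auto simp: mem_l_coset_iff)
    then show ?thesis using principal_subset_right_ideal[OF right_ideal_principal] cR by simp
  qed
  have "\<exists>N. \<forall>k \<ge> N. ?im k = ?im N"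
    by (rule descending_chain_stops[where I = ?im])
      (use cR im_dec in \<open>auto intro: right_ideal_principal\<close>)
  then obtain N1 where N1: "\<And>k. k \<ge> N1 \<Longrightarrow> ?im k = ?im N1" by blast
  have ker_inc: "?ker k \<subseteq> ?ker l" if "k \<le> l" for k l :: nat
  proof -
    have "c [^] l = c [^] (l - k) \<otimes> c [^] k" using cR that by (simp add: nat_pow_mult)
    then show ?thesis using cR by (auto simp: m_assoc)
  qed
  have "\<exists>N \<in> range ?ker. \<forall>I \<in> range ?ker. N \<subseteq> I \<longrightarrow> I = N"
    by (rule ascending_family_has_maximal) (use cR in \<open>auto intro: right_ideal_kernel\<close>)
  then obtain N2 where "\<forall>I \<in> range ?ker. ?ker N2 \<subseteq> I \<longrightarrow> I = ?ker N2" by (elim bexE rangeE) simp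
  then have N2: "?ker k = ?ker N2" if "k \<ge> N2" for k
    using ker_inc[OF that] bspec[OF _ rangeI, of ?ker _ k] by simp
  define k where "k = N1 + N2"
  define p where "p = c [^] Suc k"
  have pR: "p \<in> carrier R" using cR by (simp add: p_def)
  have pp: "p \<otimes> p = c [^] (Suc k + Suc k)" using cR by (simp only: p_def nat_pow_mult)
  have im: "p <# carrier R = (p \<otimes> p) <# carrier R"
    unfolding pp unfolding p_def using N1[of "Suc k"] N1[of "Suc k + Suc k"] by (simp add: k_def)
  have ker: "p \<otimes> u = \<zero>" if "u \<in> carrier R" "p \<otimes> (p \<otimes> u) = \<zero>" for u
  proof -
    have "u \<in> ?ker (Suc k + Suc k)" using that pR pp by (simp add: m_assoc[symmetric])
    moreover have "?ker (Suc k + Suc k) = ?ker (Suc k)"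
      using N2[of "Suc k"] N2[of "Suc k + Suc k"] by (simp add: k_def del: nat_pow_Suc)
    ultimately have "u \<in> ?ker (Suc k)" by blast
    then show ?thesis by (simp add: p_def)
  qed
  have ep: "e \<otimes> p = p" and pe: "p \<otimes> e = p"
  proof -
    have "p = c \<otimes> c [^] k" unfolding p_def using cR nat_pow_Suc2 by blast
    then show "e \<otimes> p = p" using cR eR by (simp add: m_assoc[symmetric])
    show "p \<otimes> e = p" using cR eR by (simp add: p_def m_assoc)
  qed
  have "p \<in> (p \<otimes> p) <# carrier R" using principal_self[OF pR] im by simp
  then obtain w where w: "w \<in> carrier R" "p = p \<otimes> p \<otimes> w" by (auto simp: mem_l_coset_iff)
  \<comment> \<open>\<open>f\<close> is the projection: \<open>p f = p\<close>, and \<open>f - f\<^sup>2\<close> is in \<open>p R\<close> and in the kernel of \<open>p\<close>\<close>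
  define f where "f = p \<otimes> w \<otimes> e"
  have fR: "f \<in> carrier R" using pR w eR by (simp add: f_def)
  have ef: "e \<otimes> f = f" "f \<otimes> e = f"
    using pR w(1) eR ep by (simp_all add: f_def m_assoc) (simp add: m_assoc[symmetric])
  have pf: "p \<otimes> f = p"
  proof -
    have "p \<otimes> f = (p \<otimes> p \<otimes> w) \<otimes> e" using pR w(1) eR by (simp add: f_def m_assoc)
    then show ?thesis using w(2) pe by simp
  qed
  have "f \<ominus> f \<otimes> f = p \<otimes> (w \<otimes> e \<ominus> w \<otimes> e \<otimes> f)"
    using pR w(1) eR fR by (simp add: f_def minus_eq r_distr r_minus m_assoc)
  moreover have "p \<otimes> (f \<ominus> f \<otimes> f) = \<zero>"
    using pR fR pf by (simp add: minus_eq r_distr r_minus m_assoc[symmetric] r_neg)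
  ultimately have "f \<ominus> f \<otimes> f = \<zero>" using ker[of "w \<otimes> e \<ominus> w \<otimes> e \<otimes> f"] pR w(1) eR fR by simp
  then have "f \<otimes> f = f" using fR by simp
  then have "f = \<zero> \<or> f = e"
    using primitive_idempotent_corner[OF e] ef fR by (auto simp: corner_def)
  then show ?thesis
  proof
    assume "f = \<zero>"
    then have "p = \<zero>" using pf pR by simp
    then show ?thesis by (auto simp: p_def)
  next
    assume fe: "f = e"
    define d where "d = e \<otimes> (c [^] k \<otimes> w) \<otimes> e"
    have d: "d \<in> corner R e e" unfolding d_def by (rule corner_sandwich) (use cR w id in auto)
    have "c \<otimes> d = (c \<otimes> e) \<otimes> c [^] k \<otimes> w \<otimes> e" using cR(1) w(1) eR by (simp add: d_def m_assoc)
    also have "\<dots> = c \<otimes> c [^] k \<otimes> w \<otimes> e" using cR by simp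
    also have "\<dots> = f" using nat_pow_Suc2[OF cR(1), of k] by (simp add: f_def p_def)
    finally have cd: "c \<otimes> d = e" using fe by simp
    then have "d \<otimes> c = e" using retract_of_primitive[OF id e0 e c d] by simp
    then show ?thesis using cd d by blast
  qed
qed

section \<open>The Jacobson radical\<close>

lemma right_ideal_radical: "right_ideal R (ring_radical R)"
  and radical_subset_maximal: "maximal_submodule N R (regular_module R) \<Longrightarrow> ring_radical R \<subseteq> N"
proof -
  have c: "carrier (regular_module R) = carrier R" by (simp add: regular_module_def)
  show "maximal_submodule N R (regular_module R) \<Longrightarrow> ring_radical R \<subseteq> N"
    by (auto simp: ring_radical_def module_radical_def)
  have "right_ideal R N" if "maximal_submodule N R (regular_module R)" for N
    using that by (simp add: maximal_submodule_def right_ideal_iff_submodule)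
  then show "right_ideal R (ring_radical R)"
    unfolding right_ideal_def ring_radical_def module_radical_def c by fastforce
qed

lemma proper_right_ideal_in_maximal:
  assumes "right_ideal R I" "\<one> \<notin> I"
  shows "\<exists>N. maximal_submodule N R (regular_module R) \<and> I \<subseteq> N"
proof -
  let ?F = "{L. right_ideal R L \<and> I \<subseteq> L \<and> \<one> \<notin> L}"
  have "\<exists>N \<in> ?F. \<forall>L \<in> ?F. N \<subseteq> L \<longrightarrow> L = N"
    by (rule ascending_family_has_maximal) (use assms in auto)
  then obtain N where NF: "N \<in> ?F" and max: "\<forall>L \<in> ?F. N \<subseteq> L \<longrightarrow> L = N" by (elim bexE)
  have N: "right_ideal R N" "I \<subseteq> N" "\<one> \<notin> N" using NF by auto
  have N': "L = N" if "right_ideal R L" "\<one> \<notin> L" "N \<subseteq> L" for L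
    using bspec[OF max, of L] that N(2) by simp
  then have "maximal_submodule N R (regular_module R)"
    using N N' right_ideal_one unfolding maximal_submodule_def right_ideal_iff_submodule[symmetric]
    by (auto simp: regular_module_def)
  then show ?thesis using N(2) by blast
qed

lemma radical_right_inverse:
  assumes j: "j \<in> ring_radical R"
  shows "\<exists>w \<in> carrier R. (\<one> \<ominus> j) \<otimes> w = \<one>"
proof (rule ccontr)
  assume no: "\<not> ?thesis"
  have jR: "j \<in> carrier R" using j right_idealD(1)[OF right_ideal_radical] by blast
  let ?I = "(\<one> \<ominus> j) <# carrier R"
  have "\<one> \<notin> ?I" using no by (metis mem_l_coset_iff)
  then obtain N where N: "maximal_submodule N R (regular_module R)" "?I \<subseteq> N"
    using proper_right_ideal_in_maximal[OF right_ideal_principal] jR by blast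
  have Nr: "right_ideal R N" and NR: "N \<noteq> carrier R"
    using N(1) by (auto simp: maximal_submodule_def right_ideal_iff_submodule regular_module_def)
  have "\<one> \<ominus> j \<in> N" using principal_self[of "\<one> \<ominus> j"] jR N(2) by auto
  moreover have "j \<in> N" using radical_subset_maximal[OF N(1)] j by blast
  ultimately have "(\<one> \<ominus> j) \<oplus> j \<in> N" using right_idealD(3)[OF Nr] by blast
  then have "\<one> \<in> N" using jR by (simp add: minus_eq a_assoc l_neg)
  then show False using NR right_ideal_one[OF Nr] by blast
qed

text \<open>
  The usual description by quasi-regularity: if a maximal right ideal \<open>N\<close> misses \<open>x\<close> then
  \<open>x R + N = R\<close>, which puts some \<open>1 - x s\<close> into \<open>N\<close>.
\<close>

lemma radical_iff:
  "x \<in> ring_radical R \<longleftrightarrow> x \<in> carrier R \<and> (\<forall>s \<in> carrier R. \<exists>w \<in> carrier R. (\<one> \<ominus> x \<otimes> s) \<otimes> w = \<one>)"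
proof
  assume "x \<in> ring_radical R"
  then show "x \<in> carrier R \<and> (\<forall>s \<in> carrier R. \<exists>w \<in> carrier R. (\<one> \<ominus> x \<otimes> s) \<otimes> w = \<one>)"
    using radical_right_inverse right_idealD(1,4)[OF right_ideal_radical] by (meson subsetD)
next
  assume x: "x \<in> carrier R \<and> (\<forall>s \<in> carrier R. \<exists>w \<in> carrier R. (\<one> \<ominus> x \<otimes> s) \<otimes> w = \<one>)"
  have "x \<in> N" if N: "maximal_submodule N R (regular_module R)" for N
  proof (rule ccontr)
    assume xN: "x \<notin> N"
    have Nr: "right_ideal R N" and NR: "N \<noteq> carrier R"
      and Nmax: "\<And>L. right_ideal R L \<Longrightarrow> N \<subseteq> L \<Longrightarrow> L = N \<or> L = carrier R"
      using N by (auto simp: maximal_submodule_def right_ideal_iff_submodule regular_module_def)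
    let ?L = "{a \<oplus> b |a b. a \<in> x <# carrier R \<and> b \<in> N}"
    have xi: "right_ideal R (x <# carrier R)" using x right_ideal_principal by blast
    have L: "right_ideal R ?L" by (rule right_ideal_sum[OF xi Nr])
    have "N \<subseteq> ?L"
    proof
      fix b assume b: "b \<in> N"
      then have "b = \<zero> \<oplus> b" using right_idealD(1)[OF Nr] by auto
      then show "b \<in> ?L" using b right_idealD(2)[OF xi] by blast
    qed
    moreover have "x \<in> ?L"
    proof -
      have "x = x \<oplus> \<zero>" using x by auto
      then show ?thesis using x principal_self[of x] right_idealD(2)[OF Nr] by blast
    qed
    ultimately have "?L = carrier R" using Nmax[OF L] xN by blast
    then have "\<one> \<in> ?L" by simp
    then obtain s b where sb: "s \<in> carrier R" "b \<in> N" "\<one> = x \<otimes> s \<oplus> b" by (auto simp: mem_l_coset_iff)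
    have bR: "b \<in> carrier R" using sb right_idealD(1)[OF Nr] by blast
    have "b = \<one> \<ominus> x \<otimes> s"
      unfolding sb(3) using sb(1) x bR by (simp add: minus_eq a_ac r_neg r_neg1)
    then obtain w where "w \<in> carrier R" "b \<otimes> w = \<one>" using x sb by blast
    then have "\<one> \<in> N" using right_idealD(4)[OF Nr sb(2)] by metis
    then show False using NR right_ideal_one[OF Nr] by blast
  qed
  then show "x \<in> ring_radical R"
    using x by (auto simp: ring_radical_def module_radical_def regular_module_def)
qed

lemma radical_inverse:
  assumes j: "j \<in> ring_radical R"
  shows "\<exists>w \<in> carrier R. (\<one> \<ominus> j) \<otimes> w = \<one> \<and> w \<otimes> (\<one> \<ominus> j) = \<one>"
proof -
  have jR: "j \<in> carrier R" using j right_idealD(1)[OF right_ideal_radical] by blast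
  obtain w where w: "w \<in> carrier R" "(\<one> \<ominus> j) \<otimes> w = \<one>" using radical_right_inverse[OF j] by blast
  \<comment> \<open>\<open>w = 1 + j w\<close> is again of the form \<open>1 - j'\<close>, so it is right invertible too\<close>
  have "\<one> \<ominus> (\<ominus> (j \<otimes> w)) = w"
  proof -
    have "w = (\<one> \<ominus> j) \<otimes> w \<oplus> j \<otimes> w" using jR w(1) by (simp add: minus_eq l_distr l_minus a_assoc l_neg)
    then show ?thesis using w jR by (simp add: minus_eq)
  qed
  moreover have "\<ominus> (j \<otimes> w) \<in> ring_radical R"
    using j w right_idealD(4)[OF right_ideal_radical] right_ideal_minus[OF right_ideal_radical] by blast
  ultimately obtain v where v: "v \<in> carrier R" "w \<otimes> v = \<one>" using radical_right_inverse by metis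
  have "v = (\<one> \<ominus> j) \<otimes> w \<otimes> v" using w v by simp
  also have "\<dots> = \<one> \<ominus> j" using v w(1) jR by (simp add: m_assoc)
  finally show ?thesis using v w by blast
qed

text \<open>
  If \<open>w\<close> inverts \<open>1 - y r\<close> then \<open>1 + r w y\<close> inverts \<open>1 - r y\<close>; here \<open>y = x s\<close>.
\<close>

lemma radical_left_ideal:
  assumes x: "x \<in> ring_radical R" and r: "r \<in> carrier R"
  shows "r \<otimes> x \<in> ring_radical R"
  unfolding radical_iff
proof (intro conjI ballI)
  have xR: "x \<in> carrier R" using x by (simp add: radical_iff)
  then show "r \<otimes> x \<in> carrier R" using r by simp
  fix s assume s: "s \<in> carrier R"
  define y where "y = x \<otimes> s"
  have yR: "y \<in> carrier R" using xR s by (simp add: y_def)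
  have "y \<otimes> r \<in> ring_radical R"
    unfolding y_def using x s r right_idealD(4)[OF right_ideal_radical] by blast
  then obtain w where w: "w \<in> carrier R" "(\<one> \<ominus> y \<otimes> r) \<otimes> w = \<one>" using radical_inverse by blast
  have w1: "w = \<one> \<oplus> y \<otimes> r \<otimes> w"
  proof -
    have "w = (\<one> \<ominus> y \<otimes> r) \<otimes> w \<oplus> y \<otimes> r \<otimes> w"
      using yR r w(1) by (simp add: minus_eq l_distr l_minus a_assoc l_neg)
    then show ?thesis using w by simp
  qed
  have a: "r \<otimes> w \<otimes> y = r \<otimes> y \<oplus> r \<otimes> y \<otimes> (r \<otimes> w \<otimes> y)"
  proof -
    have "r \<otimes> w \<otimes> y = r \<otimes> (\<one> \<oplus> y \<otimes> r \<otimes> w) \<otimes> y" using w1 by simp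
    then show ?thesis using yR r w(1) by (simp add: l_distr r_distr m_assoc)
  qed
  have "(\<one> \<ominus> r \<otimes> y) \<otimes> (\<one> \<oplus> r \<otimes> w \<otimes> y)
      = \<one> \<oplus> r \<otimes> w \<otimes> y \<ominus> (r \<otimes> y \<oplus> r \<otimes> y \<otimes> (r \<otimes> w \<otimes> y))"
    using yR r w(1) by (simp add: minus_eq l_distr r_distr l_minus minus_add a_ac)
  also have "\<dots> = \<one>" unfolding a[symmetric] using yR r w(1) by (simp add: minus_eq a_assoc r_neg)
  finally have "(\<one> \<ominus> r \<otimes> x \<otimes> s) \<otimes> (\<one> \<oplus> r \<otimes> w \<otimes> y) = \<one>"
    using xR r s by (simp add: y_def m_assoc)
  then show "\<exists>w \<in> carrier R. (\<one> \<ominus> r \<otimes> x \<otimes> s) \<otimes> w = \<one>" using yR r w(1) by blast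
qed

lemma radical_idempotent_zero:
  assumes "f \<in> ring_radical R" "f \<otimes> f = f"
  shows "f = \<zero>"
proof -
  have fR: "f \<in> carrier R" using assms by (simp add: radical_iff)
  obtain w where w: "w \<in> carrier R" "(\<one> \<ominus> f) \<otimes> w = \<one>" using radical_right_inverse[OF assms(1)] by blast
  have "f = f \<otimes> ((\<one> \<ominus> f) \<otimes> w)" using w fR by simp
  also have "\<dots> = (f \<otimes> (\<one> \<ominus> f)) \<otimes> w" using w fR by (simp add: m_assoc)
  also have "f \<otimes> (\<one> \<ominus> f) = \<zero>" using fR assms by (simp add: minus_eq r_distr r_minus r_neg)
  finally show ?thesis using w by simp
qed

lemma nilpotent_right_inverse:
  assumes "x \<in> carrier R" "x [^] (k :: nat) = \<zero>"
  shows "\<exists>w \<in> carrier R. (\<one> \<ominus> x) \<otimes> w = \<one>"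
proof -
  have "\<exists>w \<in> carrier R. (\<one> \<ominus> x) \<otimes> w = \<one> \<ominus> x [^] l" for l :: nat
  proof (induction l)
    case 0
    show ?case using assms by (intro bexI[of _ \<zero>]) (auto simp: minus_eq r_neg)
  next
    case (Suc l)
    then obtain w where w: "w \<in> carrier R" "(\<one> \<ominus> x) \<otimes> w = \<one> \<ominus> x [^] l" by blast
    have sw: "x \<otimes> x [^] l = x [^] Suc l" using nat_pow_Suc2[OF assms(1), of l] by simp
    have "(\<one> \<ominus> x) \<otimes> (w \<oplus> x [^] l) = (\<one> \<ominus> x [^] l) \<oplus> (x [^] l \<ominus> x [^] Suc l)"
      using assms(1) w by (simp add: r_distr del: nat_pow_Suc) (simp add: minus_eq l_distr l_minus sw del: nat_pow_Suc)
    also have "\<dots> = \<one> \<ominus> x [^] Suc l"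
      using assms(1) by (simp add: minus_eq a_ac r_neg1 r_neg2 del: nat_pow_Suc)
    finally show ?case using w assms(1) by blast
  qed
  from this[of k] show ?thesis using assms by (simp add: minus_eq)
qed

text \<open>
  The right ideal \<open>e R\<close> is local: its elements outside the radical are exactly its generators. If \<open>u\<close>
  does not generate \<open>e R\<close> then no \<open>u s e\<close> is invertible in \<open>e R e\<close>, so by Fitting's lemma \<open>u s\<close> is
  nilpotent and \<open>1 - u s\<close> is invertible.
\<close>

lemma radical_primitive_iff:
  assumes e: "primitive_idempotent R e" and u: "u \<in> carrier R" "e \<otimes> u = u"
  shows "u \<in> ring_radical R \<longleftrightarrow> \<not> (\<exists>v \<in> carrier R. u \<otimes> v = e)"
proof
  have id: "idempotent_elt R e" and e0: "e \<noteq> \<zero>" using e by (auto simp: primitive_idempotent_def)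
  then have eR: "e \<in> carrier R" "e \<otimes> e = e" by (auto simp: idempotent_elt_def)
  show "\<not> (\<exists>v \<in> carrier R. u \<otimes> v = e)" if "u \<in> ring_radical R"
    using that right_idealD(4)[OF right_ideal_radical that] radical_idempotent_zero[of e] eR e0 by blast
  assume no: "\<not> (\<exists>v \<in> carrier R. u \<otimes> v = e)"
  show "u \<in> ring_radical R"
    unfolding radical_iff
  proof (intro conjI ballI u)
    fix s assume s: "s \<in> carrier R"
    define y where "y = u \<otimes> s"
    have yR: "y \<in> carrier R" using u s by (simp add: y_def)
    have ey: "e \<otimes> y = y" using u s eR by (simp add: y_def m_assoc[symmetric])
    have c: "y \<otimes> e \<in> corner R e e" using yR ey eR by (auto simp: corner_def m_assoc) (simp add: m_assoc[symmetric])
    have "\<not> (\<exists>d \<in> corner R e e. (y \<otimes> e) \<otimes> d = e)"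
    proof
      assume "\<exists>d \<in> corner R e e. (y \<otimes> e) \<otimes> d = e"
      then obtain d where "d \<in> carrier R" "(y \<otimes> e) \<otimes> d = e" by (auto simp: corner_def)
      then have "u \<otimes> (s \<otimes> e \<otimes> d) = e" using u s eR by (simp add: y_def m_assoc)
      then show False using no \<open>d \<in> carrier R\<close> s eR by blast
    qed
    then obtain k where k: "(y \<otimes> e) [^] Suc k = \<zero>" using fitting[OF e c] by blast
    have pw: "y [^] Suc l = (y \<otimes> e) [^] l \<otimes> y" for l :: nat
    proof (induction l)
      case 0
      then show ?case using yR by simp
    next
      case (Suc l)
      have "y [^] Suc (Suc l) = (y \<otimes> e) [^] l \<otimes> y \<otimes> y" using Suc by simp
      also have "\<dots> = (y \<otimes> e) [^] l \<otimes> y \<otimes> (e \<otimes> y)" using ey by simp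
      also have "\<dots> = (y \<otimes> e) [^] Suc l \<otimes> y" using yR eR by (simp add: m_assoc)
      finally show ?case .
    qed
    have "y [^] Suc (Suc k) = \<zero>" unfolding pw[of "Suc k"] k using yR by simp
    then show "\<exists>w \<in> carrier R. (\<one> \<ominus> u \<otimes> s) \<otimes> w = \<one>"
      using nilpotent_right_inverse[OF yR] unfolding y_def by blast
  qed
qed

end

section \<open>Families of elements fixed by idempotents\<close>

text \<open>
  The families with \<open>c t \<in> E t R\<close>. For finite \<open>T\<close> they are the elements of the direct sum of the
  right ideals \<open>E t R\<close>, up to the values outside \<open>T\<close>.
\<close>

definition coefs :: "('r, 'x) ring_scheme \<Rightarrow> ('i \<Rightarrow> 'r) \<Rightarrow> 'i set \<Rightarrow> ('i \<Rightarrow> 'r) set" where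
  "coefs R E T = {c. \<forall>t \<in> T. c t \<in> carrier R \<and> E t \<otimes>\<^bsub>R\<^esub> c t = c t}"

lemma coefsD: "c \<in> coefs R E T \<Longrightarrow> t \<in> T \<Longrightarrow> c t \<in> carrier R"
  "c \<in> coefs R E T \<Longrightarrow> t \<in> T \<Longrightarrow> E t \<otimes>\<^bsub>R\<^esub> c t = c t"
  by (auto simp: coefs_def)

lemma coefs_Pi: "c \<in> coefs R E T \<Longrightarrow> c \<in> T \<rightarrow> carrier R"
  by (auto simp: coefs_def)

definition lincomb :: "('r, 'm) module \<Rightarrow> 'i set \<Rightarrow> ('i \<Rightarrow> 'r) \<Rightarrow> ('i \<Rightarrow> 'm) \<Rightarrow> 'm" where
  "lincomb M T c x = (\<Oplus>\<^bsub>M\<^esub> t \<in> T. c t \<odot>\<^bsub>M\<^esub> x t)"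

context right_module
begin

lemma smult_l_null [simp]: "x \<in> carrier M \<Longrightarrow> \<zero> \<odot>\<^bsub>M\<^esub> x = \<zero>\<^bsub>M\<^esub>"
  using smult_l_distr[of "\<zero>" "\<zero>" x] by (metis M.add.r_cancel_one' R.l_zero R.zero_closed smult_closed)

lemma smult_r_null [simp]: "r \<in> carrier R \<Longrightarrow> r \<odot>\<^bsub>M\<^esub> \<zero>\<^bsub>M\<^esub> = \<zero>\<^bsub>M\<^esub>"
  using smult_r_distr[of r "\<zero>\<^bsub>M\<^esub>" "\<zero>\<^bsub>M\<^esub>"] by (metis M.add.r_cancel_one' M.l_zero M.zero_closed smult_closed)

lemma smult_l_minus:
  assumes "r \<in> carrier R" "x \<in> carrier M"
  shows "(\<ominus> r) \<odot>\<^bsub>M\<^esub> x = \<ominus>\<^bsub>M\<^esub> (r \<odot>\<^bsub>M\<^esub> x)"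
proof (rule M.minus_equality[symmetric])
  show "(\<ominus> r) \<odot>\<^bsub>M\<^esub> x \<oplus>\<^bsub>M\<^esub> r \<odot>\<^bsub>M\<^esub> x = \<zero>\<^bsub>M\<^esub>"
    using assms smult_l_distr[of "\<ominus> r" r x] by (simp add: R.l_neg)
qed (use assms in auto)

lemma submodule_iff:
  "submodule N R M \<longleftrightarrow>
     N \<subseteq> carrier M \<and> \<zero>\<^bsub>M\<^esub> \<in> N \<and> (\<forall>x \<in> N. \<forall>y \<in> N. x \<oplus>\<^bsub>M\<^esub> y \<in> N) \<and>
     (\<forall>r \<in> carrier R. \<forall>x \<in> N. r \<odot>\<^bsub>M\<^esub> x \<in> N)"
proof
  assume "submodule N R M"
  then interpret submodule N R M .
  show "N \<subseteq> carrier M \<and> \<zero>\<^bsub>M\<^esub> \<in> N \<and> (\<forall>x \<in> N. \<forall>y \<in> N. x \<oplus>\<^bsub>M\<^esub> y \<in> N) \<and>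
     (\<forall>r \<in> carrier R. \<forall>x \<in> N. r \<odot>\<^bsub>M\<^esub> x \<in> N)"
    using subset one_closed m_closed smult_closed by auto
next
  assume N: "N \<subseteq> carrier M \<and> \<zero>\<^bsub>M\<^esub> \<in> N \<and> (\<forall>x \<in> N. \<forall>y \<in> N. x \<oplus>\<^bsub>M\<^esub> y \<in> N) \<and>
     (\<forall>r \<in> carrier R. \<forall>x \<in> N. r \<odot>\<^bsub>M\<^esub> x \<in> N)"
  show "submodule N R M"
  proof (intro submodule.intro subgroup.intro submodule_axioms.intro)
    fix x assume x: "x \<in> N"
    then have "(\<ominus> \<one>) \<odot>\<^bsub>M\<^esub> x \<in> N" using N by blast
    moreover have "(\<ominus> \<one>) \<odot>\<^bsub>M\<^esub> x = \<ominus>\<^bsub>M\<^esub> x"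
      using x N smult_l_minus[of "\<one>" x] by (auto simp: subset_iff)
    ultimately have "\<ominus>\<^bsub>M\<^esub> x \<in> N" by simp
    then show "inv\<^bsub>add_monoid M\<^esub> x \<in> N" by (simp add: a_inv_def)
  qed (use N in auto)
qed

lemma submoduleD:
  assumes "submodule N R M"
  shows "N \<subseteq> carrier M" "\<zero>\<^bsub>M\<^esub> \<in> N" "\<And>x y. x \<in> N \<Longrightarrow> y \<in> N \<Longrightarrow> x \<oplus>\<^bsub>M\<^esub> y \<in> N"
    "\<And>r x. r \<in> carrier R \<Longrightarrow> x \<in> N \<Longrightarrow> r \<odot>\<^bsub>M\<^esub> x \<in> N" "\<And>x. x \<in> N \<Longrightarrow> \<ominus>\<^bsub>M\<^esub> x \<in> N"
proof -
  note N = assms[unfolded submodule_iff]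
  show "N \<subseteq> carrier M" "\<zero>\<^bsub>M\<^esub> \<in> N" "\<And>x y. x \<in> N \<Longrightarrow> y \<in> N \<Longrightarrow> x \<oplus>\<^bsub>M\<^esub> y \<in> N"
    and s: "\<And>r x. r \<in> carrier R \<Longrightarrow> x \<in> N \<Longrightarrow> r \<odot>\<^bsub>M\<^esub> x \<in> N" using N by auto
  show "\<ominus>\<^bsub>M\<^esub> x \<in> N" if "x \<in> N" for x
  proof -
    have "(\<ominus> \<one>) \<odot>\<^bsub>M\<^esub> x \<in> N" by (rule s[OF _ that]) simp
    moreover have "(\<ominus> \<one>) \<odot>\<^bsub>M\<^esub> x = \<ominus>\<^bsub>M\<^esub> x"
      using that N smult_l_minus[of "\<one>" x] by (auto simp: subset_iff)
    ultimately show ?thesis by simp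
  qed
qed

lemma sub_module_right_module:
  assumes N: "submodule N R M"
  shows "right_module R (sub_module M N)"
proof -
  note c = subsetD[OF submoduleD(1)[OF N]]
  have "abelian_group (sub_module M N)"
  proof (rule abelian_groupI)
    show "\<exists>y \<in> carrier (sub_module M N). y \<oplus>\<^bsub>sub_module M N\<^esub> x = \<zero>\<^bsub>sub_module M N\<^esub>"
      if "x \<in> carrier (sub_module M N)" for x
      using that submoduleD(5)[OF N] c M.l_neg by (auto simp: sub_module_def)
  qed (use submoduleD[OF N] c in \<open>auto simp: sub_module_def M.a_ac\<close>)
  then show ?thesis
    unfolding right_module_def right_module_axioms_def
    using R.ring_axioms submoduleD[OF N] c
    by (auto simp: sub_module_def smult_l_distr smult_r_distr smult_assoc)
qed

lemma submodule_sub_module_iff: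
  assumes N: "submodule N R M"
  shows "submodule L R (sub_module M N) \<longleftrightarrow> submodule L R M \<and> L \<subseteq> N"
  unfolding right_module.submodule_iff[OF sub_module_right_module[OF N]] submodule_iff
  using submoduleD(1)[OF N] by (auto simp: sub_module_def)

lemma lincomb_closed [simp, intro]:
  "\<lbrakk>c \<in> T \<rightarrow> carrier R; x \<in> T \<rightarrow> carrier M\<rbrakk> \<Longrightarrow> lincomb M T c x \<in> carrier M"
  unfolding lincomb_def by (rule M.finsum_closed) auto

lemma lincomb_cong:
  assumes "\<And>t. t \<in> T \<Longrightarrow> c t \<odot>\<^bsub>M\<^esub> x t = d t \<odot>\<^bsub>M\<^esub> y t" "d \<in> T \<rightarrow> carrier R" "y \<in> T \<rightarrow> carrier M"
  shows "lincomb M T c x = lincomb M T d y"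
  unfolding lincomb_def by (rule M.finsum_cong') (use assms in auto)

lemma lincomb_zero: "(\<And>t. t \<in> T \<Longrightarrow> c t \<odot>\<^bsub>M\<^esub> x t = \<zero>\<^bsub>M\<^esub>) \<Longrightarrow> lincomb M T c x = \<zero>\<^bsub>M\<^esub>"
  unfolding lincomb_def using M.finsum_cong'[of T T "\<lambda>t. \<zero>\<^bsub>M\<^esub>"] by simp

lemma lincomb_add:
  assumes "c \<in> T \<rightarrow> carrier R" "d \<in> T \<rightarrow> carrier R" "x \<in> T \<rightarrow> carrier M"
  shows "lincomb M T (\<lambda>t. c t \<oplus> d t) x = lincomb M T c x \<oplus>\<^bsub>M\<^esub> lincomb M T d x"
proof -
  have "lincomb M T (\<lambda>t. c t \<oplus> d t) x = (\<Oplus>\<^bsub>M\<^esub> t \<in> T. c t \<odot>\<^bsub>M\<^esub> x t \<oplus>\<^bsub>M\<^esub> d t \<odot>\<^bsub>M\<^esub> x t)"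
    unfolding lincomb_def by (rule M.finsum_cong') (use assms in \<open>auto simp: Pi_iff smult_l_distr\<close>)
  then show ?thesis unfolding lincomb_def using assms by (subst M.finsum_addf[symmetric]) auto
qed

lemma lincomb_add_right:
  assumes "c \<in> T \<rightarrow> carrier R" "x \<in> T \<rightarrow> carrier M" "y \<in> T \<rightarrow> carrier M"
  shows "lincomb M T c (\<lambda>t. x t \<oplus>\<^bsub>M\<^esub> y t) = lincomb M T c x \<oplus>\<^bsub>M\<^esub> lincomb M T c y"
proof -
  have "lincomb M T c (\<lambda>t. x t \<oplus>\<^bsub>M\<^esub> y t) = (\<Oplus>\<^bsub>M\<^esub> t \<in> T. c t \<odot>\<^bsub>M\<^esub> x t \<oplus>\<^bsub>M\<^esub> c t \<odot>\<^bsub>M\<^esub> y t)"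
    unfolding lincomb_def by (rule M.finsum_cong') (use assms in \<open>auto simp: Pi_iff smult_r_distr\<close>)
  then show ?thesis unfolding lincomb_def using assms by (subst M.finsum_addf[symmetric]) auto
qed

lemma lincomb_insert:
  assumes "finite T" "b \<notin> T" "c \<in> insert b T \<rightarrow> carrier R" "x \<in> insert b T \<rightarrow> carrier M"
  shows "lincomb M (insert b T) c x = c b \<odot>\<^bsub>M\<^esub> x b \<oplus>\<^bsub>M\<^esub> lincomb M T c x"
  unfolding lincomb_def by (rule M.finsum_insert) (use assms in auto)

lemma lincomb_remove:
  assumes "finite T" "b \<in> T" "c \<in> T \<rightarrow> carrier R" "x \<in> T \<rightarrow> carrier M"
  shows "lincomb M T c x = c b \<odot>\<^bsub>M\<^esub> x b \<oplus>\<^bsub>M\<^esub> lincomb M (T - {b}) c x"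
  using lincomb_insert[of "T - {b}" b c x] assms by (simp add: insert_absorb)

lemma lincomb_single:
  assumes "finite T" "b \<in> T" "x \<in> T \<rightarrow> carrier M" "u \<in> carrier R"
  shows "lincomb M T (\<lambda>t. if b = t then u else \<zero>) x = u \<odot>\<^bsub>M\<^esub> x b"
proof -
  have "lincomb M (T - {b}) (\<lambda>t. if b = t then u else \<zero>) x = \<zero>\<^bsub>M\<^esub>"
    by (rule lincomb_zero) (use assms in \<open>auto simp: Pi_iff\<close>)
  then show ?thesis using assms by (subst lincomb_remove[of _ b]) (auto simp: Pi_iff)
qed

lemma lincomb_empty [simp]: "lincomb M {} c x = \<zero>\<^bsub>M\<^esub>"
  by (simp add: lincomb_def)

lemma lincomb_in_submodule:
  assumes N: "submodule N R M" and T: "finite T" "c \<in> T \<rightarrow> carrier R" "\<And>t. t \<in> T \<Longrightarrow> x t \<in> N"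
  shows "lincomb M T c x \<in> N"
  using T
proof (induction T rule: finite_induct)
  case (insert b T)
  have "x \<in> insert b T \<rightarrow> carrier M" using insert.prems(2) submoduleD(1)[OF N] by blast
  then have "lincomb M (insert b T) c x = c b \<odot>\<^bsub>M\<^esub> x b \<oplus>\<^bsub>M\<^esub> lincomb M T c x"
    using insert by (intro lincomb_insert) auto
  then show ?case using insert submoduleD(3,4)[OF N] by auto
qed (use submoduleD(2)[OF N] in simp)

lemma smult_lincomb:
  assumes "c \<in> T \<rightarrow> carrier R" "x \<in> T \<rightarrow> carrier M" "finite T" "r \<in> carrier R"
  shows "r \<odot>\<^bsub>M\<^esub> lincomb M T c x = lincomb M T (\<lambda>t. c t \<otimes> r) x"
  using assms(3,1,2)
proof (induction T rule: finite_induct)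
  case (insert b T)
  have "lincomb M T c x \<in> carrier M" by (rule lincomb_closed) (use insert.prems in auto)
  moreover have "lincomb M (insert b T) (\<lambda>t. c t \<otimes> r) x = (c b \<otimes> r) \<odot>\<^bsub>M\<^esub> x b \<oplus>\<^bsub>M\<^esub> lincomb M T (\<lambda>t. c t \<otimes> r) x"
    by (rule lincomb_insert) (use insert assms(4) in auto)
  ultimately show ?case using insert assms(4) by (simp add: lincomb_insert smult_r_distr smult_assoc Pi_iff)
qed (use assms(4) in simp)

lemma spanned_submodule:
  assumes T: "finite T" and E: "\<And>t. t \<in> T \<Longrightarrow> idempotent_elt R (E t)"
    and x: "x \<in> T \<rightarrow> carrier M" "\<And>t. t \<in> T \<Longrightarrow> E t \<odot>\<^bsub>M\<^esub> x t = x t"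
  shows "submodule {lincomb M T c x |c. c \<in> coefs R E T} R M" (is "submodule ?S R M")
    and "t \<in> T \<Longrightarrow> x t \<in> {lincomb M T c x |c. c \<in> coefs R E T}"
proof -
  have ER: "E t \<in> carrier R" "E t \<otimes> E t = E t" if "t \<in> T" for t
    using E[OF that] by (auto simp: idempotent_elt_def)
  show "submodule ?S R M"
    unfolding submodule_iff
  proof (intro conjI ballI)
    show "?S \<subseteq> carrier M" using lincomb_closed[OF coefs_Pi x(1)] by blast
    show "\<zero>\<^bsub>M\<^esub> \<in> ?S"
      using lincomb_zero[of T "\<lambda>_. \<zero>" x] x(1) ER
      by (intro CollectI exI[of _ "\<lambda>_. \<zero>"]) (auto simp: coefs_def Pi_iff)
  next
    fix y z assume "y \<in> ?S" "z \<in> ?S"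
    then obtain c d where "c \<in> coefs R E T" "y = lincomb M T c x" "d \<in> coefs R E T" "z = lincomb M T d x" by blast
    then show "y \<oplus>\<^bsub>M\<^esub> z \<in> ?S"
      using x(1) ER lincomb_add[of c T d x]
      by (intro CollectI exI[of _ "\<lambda>t. c t \<oplus> d t"]) (auto simp: coefs_def R.r_distr Pi_iff)
  next
    fix r y assume r: "r \<in> carrier R" and "y \<in> ?S"
    then obtain c where "c \<in> coefs R E T" "y = lincomb M T c x" by blast
    then show "r \<odot>\<^bsub>M\<^esub> y \<in> ?S"
      using x(1) ER r smult_lincomb[of c T x r] T
      by (intro CollectI exI[of _ "\<lambda>t. c t \<otimes> r"]) (auto simp: coefs_def R.m_assoc[symmetric] Pi_iff)
  qed
  show "x t \<in> ?S" if t: "t \<in> T" for t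
    using lincomb_single[OF T t x(1) ER(1)[OF t]] x(2)[OF t] ER
    by (intro CollectI exI[of _ "\<lambda>s. if t = s then E t else \<zero>"]) (auto simp: coefs_def)
qed

text \<open>
  An element \<open>x t\<close> with \<open>x t \<cdot> E t = x t\<close> is the same as a homomorphism from \<open>E t R\<close> to \<open>M\<close>. The
  predicate says that together they give an epimorphism onto \<open>M\<close> from the direct sum of the
  \<open>E t R\<close>, and \<open>projective_basis\<close> that this epimorphism is an isomorphism.
\<close>

definition (in -) spans ::
  "('r, 'x) ring_scheme \<Rightarrow> ('r, 'm) module \<Rightarrow> ('i \<Rightarrow> 'r) \<Rightarrow> 'i set \<Rightarrow> ('i \<Rightarrow> 'm) \<Rightarrow> bool" where
  "spans R M E T x \<longleftrightarrow>
     finite T \<and> (\<forall>t \<in> T. x t \<in> carrier M \<and> E t \<odot>\<^bsub>M\<^esub> x t = x t) \<and>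
     (\<forall>y \<in> carrier M. \<exists>c \<in> coefs R E T. y = lincomb M T c x)"

definition (in -) projective_basis ::
  "('r, 'x) ring_scheme \<Rightarrow> ('r, 'm) module \<Rightarrow> ('i \<Rightarrow> 'r) \<Rightarrow> 'i set \<Rightarrow> ('i \<Rightarrow> 'm) \<Rightarrow> bool" where
  "projective_basis R M E T x \<longleftrightarrow>
     spans R M E T x \<and> (\<forall>c \<in> coefs R E T. lincomb M T c x = \<zero>\<^bsub>M\<^esub> \<longrightarrow> (\<forall>t \<in> T. c t = \<zero>\<^bsub>R\<^esub>))"

lemma (in -) spansD:
  assumes "spans R M E T x"
  shows "finite T" "x \<in> T \<rightarrow> carrier M" "\<And>t. t \<in> T \<Longrightarrow> E t \<odot>\<^bsub>M\<^esub> x t = x t"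
    "\<And>y. y \<in> carrier M \<Longrightarrow> \<exists>c \<in> coefs R E T. y = lincomb M T c x"
  using assms by (auto simp: spans_def)

lemma spans_iff:
  assumes T: "finite T" and E: "\<And>t. t \<in> T \<Longrightarrow> idempotent_elt R (E t)"
    and x: "x \<in> T \<rightarrow> carrier M" "\<And>t. t \<in> T \<Longrightarrow> E t \<odot>\<^bsub>M\<^esub> x t = x t"
  shows "spans R M E T x \<longleftrightarrow> (\<forall>N. submodule N R M \<and> x ` T \<subseteq> N \<longrightarrow> N = carrier M)"
proof
  assume sp: "spans R M E T x"
  show "\<forall>N. submodule N R M \<and> x ` T \<subseteq> N \<longrightarrow> N = carrier M"
  proof (intro allI impI, elim conjE)
    fix N assume N: "submodule N R M" "x ` T \<subseteq> N"
    have "y \<in> N" if "y \<in> carrier M" for y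
      using spansD(4)[OF sp that] lincomb_in_submodule[OF N(1) T coefs_Pi] N(2) by blast
    then show "N = carrier M" using submoduleD(1)[OF N(1)] by blast
  qed
next
  assume N: "\<forall>N. submodule N R M \<and> x ` T \<subseteq> N \<longrightarrow> N = carrier M"
  define S where "S = {lincomb M T c x |c. c \<in> coefs R E T}"
  have "submodule S R M" "x ` T \<subseteq> S"
    unfolding S_def using spanned_submodule[OF T E x] by auto
  then have "S = carrier M" using N by simp
  then show "spans R M E T x" unfolding spans_def S_def using T x by blast
qed

lemma finitely_generated_iff:
  "finitely_generated R M \<longleftrightarrow>
     (\<exists>B. finite B \<and> B \<subseteq> carrier M \<and> (\<forall>N. submodule N R M \<and> B \<subseteq> N \<longrightarrow> N = carrier M))"
proof -
  have "(\<forall>x \<in> carrier M. \<exists>c \<in> B \<rightarrow> carrier R. x = (\<Oplus>\<^bsub>M\<^esub> b \<in> B. c b \<odot>\<^bsub>M\<^esub> b)) \<longleftrightarrow>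
      (\<forall>N. submodule N R M \<and> B \<subseteq> N \<longrightarrow> N = carrier M)" if B: "finite B" "B \<subseteq> carrier M" for B
  proof -
    have "spans R M (\<lambda>_. \<one>) B (\<lambda>b. b) \<longleftrightarrow> (\<forall>N. submodule N R M \<and> B \<subseteq> N \<longrightarrow> N = carrier M)"
      using spans_iff[of B "\<lambda>_. \<one>" "\<lambda>b. b"] B by (auto simp: idempotent_elt_def subset_iff)
    moreover have "coefs R (\<lambda>_. \<one>) B = B \<rightarrow> carrier R" by (auto simp: coefs_def Pi_iff)
    ultimately show ?thesis using B by (auto simp: spans_def lincomb_def subset_iff)
  qed
  then show ?thesis unfolding finitely_generated_def by (simp cong: conj_cong)
qed

end

section \<open>Homomorphisms and transport of structure\<close>

lemma rmod_homD:
  assumes "f \<in> rmod_hom R M N"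
  shows "\<And>x. x \<in> carrier M \<Longrightarrow> f x \<in> carrier N"
    "\<And>x y. x \<in> carrier M \<Longrightarrow> y \<in> carrier M \<Longrightarrow> f (x \<oplus>\<^bsub>M\<^esub> y) = f x \<oplus>\<^bsub>N\<^esub> f y"
    "\<And>r x. r \<in> carrier R \<Longrightarrow> x \<in> carrier M \<Longrightarrow> f (r \<odot>\<^bsub>M\<^esub> x) = r \<odot>\<^bsub>N\<^esub> f x"
  using assms by (auto simp: rmod_hom_def)

lemma rmod_homI:
  assumes "\<And>x. x \<in> carrier M \<Longrightarrow> f x \<in> carrier N"
    "\<And>x y. x \<in> carrier M \<Longrightarrow> y \<in> carrier M \<Longrightarrow> f (x \<oplus>\<^bsub>M\<^esub> y) = f x \<oplus>\<^bsub>N\<^esub> f y"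
    "\<And>r x. r \<in> carrier R \<Longrightarrow> x \<in> carrier M \<Longrightarrow> f (r \<odot>\<^bsub>M\<^esub> x) = r \<odot>\<^bsub>N\<^esub> f x"
  shows "f \<in> rmod_hom R M N"
  using assms by (auto simp: rmod_hom_def)

lemma rmod_hom_comp:
  "\<lbrakk>f \<in> rmod_hom R L M; g \<in> rmod_hom R M N\<rbrakk> \<Longrightarrow> (\<lambda>x. g (f x)) \<in> rmod_hom R L N"
  by (auto simp: rmod_hom_def Pi_iff)

lemma rmod_hom_zero:
  assumes "right_module R M" "right_module R N" "f \<in> rmod_hom R M N"
  shows "f \<zero>\<^bsub>M\<^esub> = \<zero>\<^bsub>N\<^esub>"
proof -
  interpret M: right_module R M by fact
  interpret N: right_module R N by fact
  have "f (\<zero>\<^bsub>R\<^esub> \<odot>\<^bsub>M\<^esub> \<zero>\<^bsub>M\<^esub>) = \<zero>\<^bsub>R\<^esub> \<odot>\<^bsub>N\<^esub> f \<zero>\<^bsub>M\<^esub>"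
    by (rule rmod_homD(3)[OF assms(3)]) auto
  then show ?thesis using rmod_homD(1)[OF assms(3)] by simp
qed

lemma lincomb_hom:
  assumes M: "right_module R M" and N: "right_module R N" and h: "h \<in> rmod_hom R M N"
    and T: "finite T" "c \<in> T \<rightarrow> carrier R" "x \<in> T \<rightarrow> carrier M"
  shows "h (lincomb M T c x) = lincomb N T c (\<lambda>t. h (x t))"
proof -
  interpret M: right_module R M by fact
  interpret N: right_module R N by fact
  show ?thesis
    using T
  proof (induction T rule: finite_induct)
    case empty
    show ?case using rmod_hom_zero[OF M N h] by simp
  next
    case (insert b T)
    have "h (c b \<odot>\<^bsub>M\<^esub> x b) = c b \<odot>\<^bsub>N\<^esub> h (x b)" by (rule rmod_homD(3)[OF h]) (use insert.prems in auto)
    moreover have "lincomb N (insert b T) c (\<lambda>t. h (x t)) = c b \<odot>\<^bsub>N\<^esub> h (x b) \<oplus>\<^bsub>N\<^esub> lincomb N T c (\<lambda>t. h (x t))"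
      by (rule N.lincomb_insert) (use insert rmod_homD(1)[OF h] in auto)
    moreover have "lincomb M T c x \<in> carrier M" by (rule M.lincomb_closed) (use insert.prems in auto)
    ultimately show ?case
      using insert rmod_homD(2)[OF h, of "c b \<odot>\<^bsub>M\<^esub> x b" "lincomb M T c x"] by (simp add: M.lincomb_insert Pi_iff)
  qed
qed

lemma rmod_hom_eq_iff:
  assumes "right_module R M" "right_module R N" "f \<in> rmod_hom R M N" and x: "x \<in> carrier M" "y \<in> carrier M"
  shows "f x = f y \<longleftrightarrow> f (x \<ominus>\<^bsub>M\<^esub> y) = \<zero>\<^bsub>N\<^esub>"
proof -
  interpret M: right_module R M by fact
  interpret N: right_module R N by fact
  have "f (\<ominus>\<^bsub>M\<^esub> y) = f ((\<ominus>\<^bsub>R\<^esub> \<one>\<^bsub>R\<^esub>) \<odot>\<^bsub>M\<^esub> y)" using x M.smult_l_minus[of "\<one>\<^bsub>R\<^esub>" y] by simp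
  also have "\<dots> = \<ominus>\<^bsub>N\<^esub> f y"
    using rmod_homD(3)[OF assms(3) _ x(2), of "\<ominus>\<^bsub>R\<^esub> \<one>\<^bsub>R\<^esub>"] rmod_homD(1)[OF assms(3) x(2)]
      N.smult_l_minus[of "\<one>\<^bsub>R\<^esub>" "f y"] by simp
  finally have "f (x \<ominus>\<^bsub>M\<^esub> y) = f x \<ominus>\<^bsub>N\<^esub> f y"
    using rmod_homD(2)[OF assms(3) x(1), of "\<ominus>\<^bsub>M\<^esub> y"] x by (simp add: M.M.minus_eq N.M.minus_eq)
  moreover have diff: "u = v \<longleftrightarrow> u \<ominus>\<^bsub>N\<^esub> v = \<zero>\<^bsub>N\<^esub>" if uv: "u \<in> carrier N" "v \<in> carrier N" for u v
  proof
    assume "u \<ominus>\<^bsub>N\<^esub> v = \<zero>\<^bsub>N\<^esub>"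
    then have "\<ominus>\<^bsub>N\<^esub> (\<ominus>\<^bsub>N\<^esub> v) = u" using uv by (intro N.M.minus_equality) (auto simp: N.M.minus_eq)
    then show "u = v" using uv by simp
  qed (use uv in \<open>simp add: N.M.minus_eq N.M.r_neg\<close>)
  ultimately show ?thesis using diff[OF rmod_homD(1)[OF assms(3) x(1)] rmod_homD(1)[OF assms(3) x(2)]] by argo
qed

text \<open>
  Quotients, and copies along an injection, are modules for this reason; no module axiom has to be
  verified on their representatives again.
\<close>

lemma right_module_image:
  fixes U :: "('r, 'm) module" and Y :: "('r, 'n) module"
  assumes U: "right_module R U" and q: "q ` carrier U = carrier Y"
    and add: "\<And>x y. \<lbrakk>x \<in> carrier U; y \<in> carrier U\<rbrakk> \<Longrightarrow> q (x \<oplus>\<^bsub>U\<^esub> y) = q x \<oplus>\<^bsub>Y\<^esub> q y"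
    and smult: "\<And>r x. \<lbrakk>r \<in> carrier R; x \<in> carrier U\<rbrakk> \<Longrightarrow> q (r \<odot>\<^bsub>U\<^esub> x) = r \<odot>\<^bsub>Y\<^esub> q x"
    and zero: "q \<zero>\<^bsub>U\<^esub> = \<zero>\<^bsub>Y\<^esub>"
  shows "right_module R Y"
proof -
  interpret U: right_module R U by fact
  note add' = add[symmetric] and smult' = smult[symmetric] and zero' = zero[symmetric]
  have pre: "\<exists>x \<in> carrier U. y = q x" if "y \<in> carrier Y" for y using that q by blast
  have im: "q x \<in> carrier Y" if "x \<in> carrier U" for x using that q by blast
  have "abelian_group Y"
  proof (rule abelian_groupI)
    fix x y z assume "x \<in> carrier Y" "y \<in> carrier Y" "z \<in> carrier Y"
    then obtain a b c where abc: "a \<in> carrier U" "x = q a" "b \<in> carrier U" "y = q b" "c \<in> carrier U" "z = q c"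
      using pre by meson
    show "x \<oplus>\<^bsub>Y\<^esub> y \<oplus>\<^bsub>Y\<^esub> z = x \<oplus>\<^bsub>Y\<^esub> (y \<oplus>\<^bsub>Y\<^esub> z)" using abc by (simp add: add' U.M.a_assoc)
  next
    fix x y assume "x \<in> carrier Y" "y \<in> carrier Y"
    then obtain a b where ab: "a \<in> carrier U" "x = q a" "b \<in> carrier U" "y = q b" using pre by meson
    show "x \<oplus>\<^bsub>Y\<^esub> y \<in> carrier Y" using ab by (simp add: add' im)
    show "x \<oplus>\<^bsub>Y\<^esub> y = y \<oplus>\<^bsub>Y\<^esub> x" using ab by (simp add: add' U.M.a_comm)
  next
    show "\<zero>\<^bsub>Y\<^esub> \<in> carrier Y" by (simp add: zero' im)
    fix x assume "x \<in> carrier Y"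
    then obtain a where a: "a \<in> carrier U" "x = q a" using pre by meson
    show "\<zero>\<^bsub>Y\<^esub> \<oplus>\<^bsub>Y\<^esub> x = x" using a by (simp add: add' zero')
    show "\<exists>y \<in> carrier Y. y \<oplus>\<^bsub>Y\<^esub> x = \<zero>\<^bsub>Y\<^esub>"
      by (rule bexI[of _ "q (\<ominus>\<^bsub>U\<^esub> a)"]) (use a in \<open>auto simp: add' zero' im U.M.l_neg\<close>)
  qed
  moreover have "right_module_axioms R Y"
  proof
    fix r s x y assume "x \<in> carrier Y" "y \<in> carrier Y" and rs: "r \<in> carrier R" "s \<in> carrier R"
    then obtain a b where ab: "a \<in> carrier U" "x = q a" "b \<in> carrier U" "y = q b" using pre by meson
    show "r \<odot>\<^bsub>Y\<^esub> (x \<oplus>\<^bsub>Y\<^esub> y) = r \<odot>\<^bsub>Y\<^esub> x \<oplus>\<^bsub>Y\<^esub> r \<odot>\<^bsub>Y\<^esub> y"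
      using ab rs by (simp add: add' smult' U.smult_r_distr)
  next
    fix r s x assume "x \<in> carrier Y" and rs: "r \<in> carrier R" "s \<in> carrier R"
    then obtain a where a: "a \<in> carrier U" "x = q a" using pre by meson
    show "(r \<oplus>\<^bsub>R\<^esub> s) \<odot>\<^bsub>Y\<^esub> x = r \<odot>\<^bsub>Y\<^esub> x \<oplus>\<^bsub>Y\<^esub> s \<odot>\<^bsub>Y\<^esub> x"
      using a rs by (simp add: add' smult' U.smult_l_distr)
    show "(r \<otimes>\<^bsub>R\<^esub> s) \<odot>\<^bsub>Y\<^esub> x = s \<odot>\<^bsub>Y\<^esub> (r \<odot>\<^bsub>Y\<^esub> x)"
      using a rs by (simp add: smult' U.smult_assoc)
  next
    fix x assume "x \<in> carrier Y"
    then obtain a where a: "a \<in> carrier U" "x = q a" using pre by meson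
    show "\<one>\<^bsub>R\<^esub> \<odot>\<^bsub>Y\<^esub> x = x" using a by (simp add: smult')
    show "r \<odot>\<^bsub>Y\<^esub> x \<in> carrier Y" if "r \<in> carrier R" for r using that a by (simp add: smult' im)
  qed
  ultimately show ?thesis using U.R.ring_axioms by (simp add: right_module_def)
qed

lemma submodule_preimage:
  assumes "right_module R U" "right_module R Y" "q \<in> rmod_hom R U Y" "submodule N R Y"
  shows "submodule {x \<in> carrier U. q x \<in> N} R U"
proof -
  interpret U: right_module R U by fact
  interpret Y: right_module R Y by fact
  show ?thesis
    unfolding U.submodule_iff
    using rmod_homD[OF assms(3)] Y.submoduleD[OF assms(4)] rmod_hom_zero[OF assms(1-3)] by auto
qed

lemma finitely_generated_image:
  fixes U :: "('r, 'm) module" and Y :: "('r, 'n) module"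
  assumes U: "right_module R U" and Y: "right_module R Y" and q: "q \<in> rmod_hom R U Y"
    and surj: "q ` carrier U = carrier Y" and fg: "finitely_generated R U"
  shows "finitely_generated R Y"
proof -
  interpret U: right_module R U by fact
  interpret Y: right_module R Y by fact
  obtain B where B: "finite B" "B \<subseteq> carrier U"
    "\<And>N. submodule N R U \<Longrightarrow> B \<subseteq> N \<Longrightarrow> N = carrier U"
    using fg unfolding U.finitely_generated_iff by blast
  have "N = carrier Y" if N: "submodule N R Y" "q ` B \<subseteq> N" for N
  proof -
    have "{x \<in> carrier U. q x \<in> N} = carrier U"
      by (rule B(3)[OF submodule_preimage[OF U Y q N(1)]]) (use B(2) N(2) in auto)
    then have "carrier Y \<subseteq> N" unfolding surj[symmetric] by blast
    then show ?thesis using Y.submoduleD(1)[OF N(1)] by blast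
  qed
  moreover have "q ` B \<subseteq> carrier Y" using B(2) rmod_homD(1)[OF q] by blast
  ultimately show ?thesis unfolding Y.finitely_generated_iff using B(1) by (intro exI[of _ "q ` B"]) auto
qed

text \<open>
  The test modules for injectivity and projectivity and the terms of resolutions have carriers in
  \<open>fg_universe\<close>. Right ideals and direct sums of right ideals reach that type by transport along an
  injection.
\<close>

definition copy_module :: "('m \<Rightarrow> 'n) \<Rightarrow> ('r, 'm) module \<Rightarrow> ('r, 'n) module" where
  "copy_module \<phi> U =
     \<lparr>carrier = \<phi> ` carrier U, monoid.mult = undefined, monoid.one = undefined,
      ring.zero = \<phi> \<zero>\<^bsub>U\<^esub>,
      ring.add = (\<lambda>u v. \<phi> (inv_into (carrier U) \<phi> u \<oplus>\<^bsub>U\<^esub> inv_into (carrier U) \<phi> v)),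
      smult = (\<lambda>r u. \<phi> (r \<odot>\<^bsub>U\<^esub> inv_into (carrier U) \<phi> u))\<rparr>"

lemma copy_module:
  assumes U: "right_module R U" and inj: "inj_on \<phi> (carrier U)"
  shows "right_module R (copy_module \<phi> U)" "\<phi> \<in> rmod_hom R U (copy_module \<phi> U)"
    "inv_into (carrier U) \<phi> \<in> rmod_hom R (copy_module \<phi> U) U"
    "carrier (copy_module \<phi> U) = \<phi> ` carrier U"
proof -
  interpret U: right_module R U by fact
  have inv: "inv_into (carrier U) \<phi> (\<phi> x) = x" if "x \<in> carrier U" for x
    using inv_into_f_f[OF inj that] .
  show "carrier (copy_module \<phi> U) = \<phi> ` carrier U" by (simp add: copy_module_def)
  show "right_module R (copy_module \<phi> U)"
    by (rule right_module_image[OF U, of \<phi>]) (auto simp: copy_module_def inv)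
  show "\<phi> \<in> rmod_hom R U (copy_module \<phi> U)"
    by (rule rmod_homI) (auto simp: copy_module_def inv)
  show "inv_into (carrier U) \<phi> \<in> rmod_hom R (copy_module \<phi> U) U"
    by (rule rmod_homI) (auto simp: copy_module_def inv)
qed

lemma copy_module_fg:
  assumes U: "fg_module R U" and inj: "inj_on \<phi> (carrier U)"
  shows "fg_module R (copy_module \<phi> U)"
proof -
  have r: "right_module R U" and f: "finitely_generated R U" using U by (auto simp: fg_module_def)
  note c = copy_module[OF r inj]
  show ?thesis
    unfolding fg_module_def using c(1) finitely_generated_image[OF r c(1,2) c(4)[symmetric] f] by blast
qed

section \<open>Right ideals as modules\<close>

lemma regular_module_simps:
  "carrier (regular_module R) = carrier R" "\<zero>\<^bsub>regular_module R\<^esub> = \<zero>\<^bsub>R\<^esub>"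
  "x \<oplus>\<^bsub>regular_module R\<^esub> y = x \<oplus>\<^bsub>R\<^esub> y" "r \<odot>\<^bsub>regular_module R\<^esub> x = x \<otimes>\<^bsub>R\<^esub> r"
  by (simp_all add: regular_module_def)

lemma sub_module_simps:
  "carrier (sub_module M N) = N" "\<zero>\<^bsub>sub_module M N\<^esub> = \<zero>\<^bsub>M\<^esub>"
  "x \<oplus>\<^bsub>sub_module M N\<^esub> y = x \<oplus>\<^bsub>M\<^esub> y" "r \<odot>\<^bsub>sub_module M N\<^esub> x = r \<odot>\<^bsub>M\<^esub> x"
  by (simp_all add: sub_module_def)

abbreviation ideal_module :: "('r, 'x) ring_scheme \<Rightarrow> 'r set \<Rightarrow> ('r, 'r) module" where
  "ideal_module R I \<equiv> sub_module (regular_module R) I"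

lemma (in ring) regular_right_module: "right_module R (regular_module R)"
proof -
  have "abelian_group (regular_module R)"
    by (rule abelian_groupI) (auto simp: regular_module_simps a_ac intro!: bexI[of _ "\<ominus> _"] l_neg)
  then show ?thesis
    unfolding right_module_def right_module_axioms_def
    using ring_axioms by (auto simp: regular_module_simps l_distr r_distr m_assoc)
qed

context right_module
begin

sublocale regular: right_module R "regular_module R"
  by (rule R.regular_right_module)

lemma action_hom: "x \<in> carrier M \<Longrightarrow> (\<lambda>r. r \<odot>\<^bsub>M\<^esub> x) \<in> rmod_hom R (regular_module R) M"
  by (rule rmod_homI) (simp_all add: regular_module_simps smult_l_distr smult_assoc)

lemma lincomb_lincomb:
  assumes "finite S" "finite T" "d \<in> S \<rightarrow> carrier R" "\<And>t s. t \<in> T \<Longrightarrow> s \<in> S \<Longrightarrow> r t s \<in> carrier R"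
    and "x \<in> T \<rightarrow> carrier M"
  shows "lincomb M T (\<lambda>t. lincomb (regular_module R) S d (r t)) x = lincomb M S d (\<lambda>s. lincomb M T (\<lambda>t. r t s) x)"
  using assms(1,3,4)
proof (induction S rule: finite_induct)
  case empty
  show ?case using assms(5) by (auto intro!: lincomb_zero simp: regular_module_simps Pi_iff)
next
  case (insert b S)
  have c: "(\<lambda>t. lincomb (regular_module R) S d (r t)) \<in> T \<rightarrow> carrier R"
    using regular.lincomb_closed[of d S "r _"] insert.prems by (auto simp: regular_module_simps)
  have "lincomb M T (\<lambda>t. lincomb (regular_module R) (insert b S) d (r t)) x
      = lincomb M T (\<lambda>t. r t b \<otimes> d b \<oplus> lincomb (regular_module R) S d (r t)) x"
    using insert c assms(5)
    by (intro lincomb_cong arg_cong2[where f = "smult M"] refl)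
      (auto simp: regular.lincomb_insert regular_module_simps Pi_iff)
  also have "\<dots> = lincomb M T (\<lambda>t. r t b \<otimes> d b) x \<oplus>\<^bsub>M\<^esub> lincomb M T (\<lambda>t. lincomb (regular_module R) S d (r t)) x"
    by (rule lincomb_add) (use insert.prems c assms(5) in auto)
  also have "lincomb M T (\<lambda>t. r t b \<otimes> d b) x = d b \<odot>\<^bsub>M\<^esub> lincomb M T (\<lambda>t. r t b) x"
    by (rule smult_lincomb[symmetric]) (use insert.prems assms(2,5) in auto)
  also have "lincomb M T (\<lambda>t. lincomb (regular_module R) S d (r t)) x = lincomb M S d (\<lambda>s. lincomb M T (\<lambda>t. r t s) x)"
    using insert by (auto simp: Pi_iff)
  also have "d b \<odot>\<^bsub>M\<^esub> lincomb M T (\<lambda>t. r t b) x \<oplus>\<^bsub>M\<^esub> \<dots> = lincomb M (insert b S) d (\<lambda>s. lincomb M T (\<lambda>t. r t s) x)"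
    by (rule lincomb_insert[symmetric]) (use insert assms(5) in \<open>auto intro!: lincomb_closed\<close>)
  finally show ?case .
qed

end

text \<open>
  A cyclic module is the regular module modulo the annihilator of its generator, so the image \<open>a\<close> of
  the generator can be any element annihilated by at least as much.
\<close>

lemma cyclic_hom:
  assumes P: "right_module R P" and A: "right_module R A" and p: "p \<in> carrier P" and a: "a \<in> carrier A"
    and gen: "\<And>x. x \<in> carrier P \<Longrightarrow> \<exists>r \<in> carrier R. x = r \<odot>\<^bsub>P\<^esub> p"
    and ann: "\<And>r. \<lbrakk>r \<in> carrier R; r \<odot>\<^bsub>P\<^esub> p = \<zero>\<^bsub>P\<^esub>\<rbrakk> \<Longrightarrow> r \<odot>\<^bsub>A\<^esub> a = \<zero>\<^bsub>A\<^esub>"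
  shows "\<exists>h \<in> rmod_hom R P A. \<forall>r \<in> carrier R. h (r \<odot>\<^bsub>P\<^esub> p) = r \<odot>\<^bsub>A\<^esub> a"
proof -
  interpret P: right_module R P by fact
  interpret A: right_module R A by fact
  \<comment> \<open>the coefficient of \<open>x\<close> is not unique, but its effect on \<open>a\<close> is\<close>
  define h where "h x = (SOME r. r \<in> carrier R \<and> x = r \<odot>\<^bsub>P\<^esub> p) \<odot>\<^bsub>A\<^esub> a" for x
  have h: "h (r \<odot>\<^bsub>P\<^esub> p) = r \<odot>\<^bsub>A\<^esub> a" if r: "r \<in> carrier R" for r
  proof -
    let ?s = "SOME s. s \<in> carrier R \<and> r \<odot>\<^bsub>P\<^esub> p = s \<odot>\<^bsub>P\<^esub> p"
    have s: "?s \<in> carrier R" "r \<odot>\<^bsub>P\<^esub> p = ?s \<odot>\<^bsub>P\<^esub> p"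
      using someI[of "\<lambda>s. s \<in> carrier R \<and> r \<odot>\<^bsub>P\<^esub> p = s \<odot>\<^bsub>P\<^esub> p" r] r by auto
    have "?s \<ominus>\<^bsub>regular_module R\<^esub> r \<in> carrier R"
      using s r P.regular.M.minus_closed by (simp add: regular_module_simps)
    then show ?thesis
      using rmod_hom_eq_iff[OF P.R.regular_right_module P P.action_hom[OF p], of ?s r] s r ann
        rmod_hom_eq_iff[OF P.R.regular_right_module A A.action_hom[OF a], of ?s r]
      by (simp add: regular_module_simps h_def)
  qed
  have "h \<in> rmod_hom R P A"
  proof (rule rmod_homI)
    fix x assume "x \<in> carrier P"
    then obtain r where r: "r \<in> carrier R" "x = r \<odot>\<^bsub>P\<^esub> p" using gen by blast
    show "h x \<in> carrier A" using h r a by simp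
    show "h (x \<oplus>\<^bsub>P\<^esub> y) = h x \<oplus>\<^bsub>A\<^esub> h y" if "y \<in> carrier P" for y
    proof -
      obtain s where s: "s \<in> carrier R" "y = s \<odot>\<^bsub>P\<^esub> p" using gen \<open>y \<in> carrier P\<close> by blast
      show ?thesis using h[of "r \<oplus>\<^bsub>R\<^esub> s"] h r s p a by (simp add: P.smult_l_distr A.smult_l_distr)
    qed
    show "h (s \<odot>\<^bsub>P\<^esub> x) = s \<odot>\<^bsub>A\<^esub> h x" if "s \<in> carrier R" for s
      using h[of "r \<otimes>\<^bsub>R\<^esub> s"] h r that p a by (simp add: P.smult_assoc A.smult_assoc)
  qed
  then show ?thesis using h by blast
qed

context ring
begin

lemma ideal_module_right_module: "right_ideal R I \<Longrightarrow> right_module R (ideal_module R I)"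
  using right_module.sub_module_right_module[OF regular_right_module] right_ideal_iff_submodule by blast

lemma submodule_ideal_module_iff:
  "right_ideal R I \<Longrightarrow> submodule L R (ideal_module R I) \<longleftrightarrow> right_ideal R L \<and> L \<subseteq> I"
  using right_module.submodule_sub_module_iff[OF regular_right_module] right_ideal_iff_submodule by blast

lemma ideal_module_fg:
  assumes I: "right_ideal R I" and B: "finite B" "B \<subseteq> I"
    "\<And>L. right_ideal R L \<Longrightarrow> B \<subseteq> L \<Longrightarrow> I \<subseteq> L"
  shows "fg_module R (ideal_module R I)"
  unfolding fg_module_def
proof
  show r: "right_module R (ideal_module R I)" by (rule ideal_module_right_module[OF I])
  show "finitely_generated R (ideal_module R I)"
    unfolding right_module.finitely_generated_iff[OF r] submodule_ideal_module_iff[OF I]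
    using B by (intro exI[of _ B]) (auto simp: sub_module_simps)
qed

lemma sub_regular_carrier: "ideal_module R (carrier R) = regular_module R"
  by (simp add: sub_module_def regular_module_def)

lemma regular_module_fg: "fg_module R (regular_module R)"
proof -
  have "fg_module R (ideal_module R (carrier R))"
    by (rule ideal_module_fg[OF right_ideal_carrier, of "{\<one>}"]) (use right_ideal_one in auto)
  then show ?thesis by (simp add: sub_regular_carrier)
qed

lemma principal_module_fg: "x \<in> carrier R \<Longrightarrow> fg_module R (ideal_module R (x <# carrier R))"
  by (rule ideal_module_fg[OF right_ideal_principal, of _ "{x}"])
    (use principal_self principal_subset_right_ideal in auto)

text \<open>
  Baer's form of injectivity: a homomorphism from a finitely generated right ideal into an injective
  module is multiplication with one element \<open>y\<close>, namely with the image of \<open>1\<close> under an extension to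
  the regular module. The ideal and the regular module are copied into \<open>fg_universe\<close> in order
  to be admissible test modules.
\<close>

lemma injective_extension:
  assumes inj: "injective_module R E" and I: "right_ideal R I"
    and B: "finite B" "B \<subseteq> I" "\<And>L. right_ideal R L \<Longrightarrow> B \<subseteq> L \<Longrightarrow> I \<subseteq> L"
    and f: "f \<in> rmod_hom R (ideal_module R I) E"
  shows "\<exists>y \<in> carrier E. \<forall>x \<in> I. f x = x \<odot>\<^bsub>E\<^esub> y"
proof -
  let ?\<iota> = "\<lambda>x :: 'a. {\<lambda>_ :: nat. x}"
  have \<iota>: "inj_on ?\<iota> U" for U by (rule inj_onI) (simp add: fun_eq_iff)
  let ?A = "copy_module ?\<iota> (ideal_module R I)" and ?B = "copy_module ?\<iota> (regular_module R)"
  have rI: "right_module R (ideal_module R I)" by (rule ideal_module_right_module[OF I])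
  have IR: "I \<subseteq> carrier R" by (rule right_idealD(1)[OF I])
  note A = copy_module[OF rI \<iota>] and Bc = copy_module[OF regular_right_module \<iota>]
  let ?dec = "inv_into (carrier (ideal_module R I)) ?\<iota>"
  have incl: "(\<lambda>x. x) \<in> rmod_hom R (ideal_module R I) (regular_module R)"
    by (rule rmod_homI) (use IR in \<open>auto simp: sub_module_simps regular_module_simps\<close>)
  have g: "(\<lambda>u. ?\<iota> (?dec u)) \<in> rmod_hom R ?A ?B"
    by (rule rmod_hom_comp[OF A(3) rmod_hom_comp[OF incl Bc(2)]])
  have dec: "?dec (?\<iota> x) = x" if "x \<in> I" for x
    by (rule inv_into_f_f[OF \<iota>]) (use that in \<open>simp add: sub_module_simps\<close>)
  have "inj_on (\<lambda>u. ?\<iota> (?dec u)) (carrier ?A)"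
    by (rule inj_onI) (auto simp: A(4) sub_module_simps dec[simplified sub_module_simps] fun_eq_iff)
  moreover have "fg_module R ?A" by (rule copy_module_fg[OF ideal_module_fg[OF I B] \<iota>])
  moreover have "fg_module R ?B" by (rule copy_module_fg[OF regular_module_fg \<iota>])
  moreover have "(\<lambda>u. f (?dec u)) \<in> rmod_hom R ?A E" by (rule rmod_hom_comp[OF A(3) f])
  ultimately obtain h where h: "h \<in> rmod_hom R ?B E" "\<forall>u \<in> carrier ?A. h (?\<iota> (?dec u)) = f (?dec u)"
    using inj g unfolding injective_module_def by meson
  have h': "(\<lambda>x. h (?\<iota> x)) \<in> rmod_hom R (regular_module R) E" by (rule rmod_hom_comp[OF Bc(2) h(1)])
  show ?thesis
  proof (intro bexI ballI)
    show "h (?\<iota> \<one>) \<in> carrier E" using rmod_homD(1)[OF h'] by (simp add: regular_module_simps)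
    fix x assume x: "x \<in> I"
    then have xR: "x \<in> carrier R" using IR by blast
    have "f x = h (?\<iota> x)" using bspec[OF h(2), of "?\<iota> x"] x
      by (simp add: A(4) sub_module_simps dec[simplified sub_module_simps])
    also have "\<dots> = h (?\<iota> (x \<odot>\<^bsub>regular_module R\<^esub> \<one>))" using xR by (simp add: regular_module_simps)
    also have "\<dots> = x \<odot>\<^bsub>E\<^esub> h (?\<iota> \<one>)"
      using rmod_homD(3)[OF h', of x \<one>] xR by (simp add: regular_module_simps)
    finally show "f x = x \<odot>\<^bsub>E\<^esub> h (?\<iota> \<one>)" .
  qed
qed

end

text \<open>
  The hypotheses make \<open>u \<mapsto> p u\<close> an isomorphism from \<open>e R\<close> to \<open>P\<close>. A homomorphism \<open>f\<close> to \<open>B\<close> is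
  lifted along \<open>g\<close> by sending \<open>p\<close> to \<open>a e\<close> for any preimage \<open>a\<close> of \<open>f p\<close>.
\<close>

lemma cyclic_projective:
  assumes P: "right_module R P" and e: "idempotent_elt R e"
    and p: "p \<in> carrier P" "e \<odot>\<^bsub>P\<^esub> p = p"
    and gen: "\<And>x. x \<in> carrier P \<Longrightarrow> \<exists>r \<in> carrier R. x = r \<odot>\<^bsub>P\<^esub> p"
    and free: "\<And>u. \<lbrakk>u \<in> carrier R; e \<otimes>\<^bsub>R\<^esub> u = u; u \<odot>\<^bsub>P\<^esub> p = \<zero>\<^bsub>P\<^esub>\<rbrakk> \<Longrightarrow> u = \<zero>\<^bsub>R\<^esub>"
  shows "projective_module R P"
  unfolding projective_module_def
proof (intro conjI allI impI ballI)
  interpret P: right_module R P by fact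
  have eR: "e \<in> carrier R" "e \<otimes>\<^bsub>R\<^esub> e = e" using e by (auto simp: idempotent_elt_def)
  have "N = carrier P" if N: "submodule N R P" "{p} \<subseteq> N" for N
    using gen P.submoduleD(1,4)[OF N(1)] N(2) by fastforce
  then show "fg_module R P"
    unfolding fg_module_def P.finitely_generated_iff using P p by (auto intro!: exI[of _ "{p}"])
  fix A B :: "('a, 'a fg_universe) module" and g f
  assume AB: "fg_module R A \<and> fg_module R B" and g: "g \<in> rmod_hom R A B" and f: "f \<in> rmod_hom R P B"
    and surj: "g ` carrier A = carrier B"
  interpret A: right_module R A using AB by (simp add: fg_module_def)
  have "f p \<in> g ` carrier A" using surj rmod_homD(1)[OF f p(1)] by simp
  then obtain a where a: "a \<in> carrier A" "f p = g a" by blast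
  have ann: "r \<odot>\<^bsub>A\<^esub> (e \<odot>\<^bsub>A\<^esub> a) = \<zero>\<^bsub>A\<^esub>" if r: "r \<in> carrier R" "r \<odot>\<^bsub>P\<^esub> p = \<zero>\<^bsub>P\<^esub>" for r
  proof -
    have "(e \<otimes>\<^bsub>R\<^esub> r) \<odot>\<^bsub>P\<^esub> p = \<zero>\<^bsub>P\<^esub>" using r p eR by (simp add: P.smult_assoc)
    then have "e \<otimes>\<^bsub>R\<^esub> r = \<zero>\<^bsub>R\<^esub>" using free[of "e \<otimes>\<^bsub>R\<^esub> r"] r eR by (simp add: P.R.m_assoc[symmetric])
    then show ?thesis using r a eR by (simp add: A.smult_assoc[symmetric])
  qed
  obtain h where h: "h \<in> rmod_hom R P A" "\<And>r. r \<in> carrier R \<Longrightarrow> h (r \<odot>\<^bsub>P\<^esub> p) = r \<odot>\<^bsub>A\<^esub> (e \<odot>\<^bsub>A\<^esub> a)"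
    using cyclic_hom[OF P A.right_module_axioms p(1) A.smult_closed[OF eR(1) a(1)] gen ann] by blast
  have "g (h x) = f x" if x: "x \<in> carrier P" for x
  proof -
    obtain r where r: "r \<in> carrier R" "x = r \<odot>\<^bsub>P\<^esub> p" using gen[OF x] by blast
    have "g (e \<odot>\<^bsub>A\<^esub> a) = f p" using rmod_homD(3)[OF g eR(1) a(1)] rmod_homD(3)[OF f eR(1) p(1)] a p by simp
    then show ?thesis using h(2)[OF r(1)] r rmod_homD(3)[OF g r(1), of "e \<odot>\<^bsub>A\<^esub> a"] rmod_homD(3)[OF f r(1) p(1)] eR a by simp
  qed
  then show "\<exists>h \<in> rmod_hom R P A. \<forall>x \<in> carrier P. g (h x) = f x" using h(1) by blast
qed

section \<open>Projective modules are direct sums of indecomposable right ideals\<close>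

text \<open>
  The direct sum of the right ideals \<open>E t R\<close>, which is free on generators with prescribed fixing
  idempotents. Families vanish outside \<open>T\<close> so that they are determined by their coordinates.
\<close>

definition free_module :: "('r, 'x) ring_scheme \<Rightarrow> (nat \<Rightarrow> 'r) \<Rightarrow> nat set \<Rightarrow> ('r, nat \<Rightarrow> 'r) module" where
  "free_module R E T =
     \<lparr>carrier = {c \<in> coefs R E T. \<forall>t. t \<notin> T \<longrightarrow> c t = \<zero>\<^bsub>R\<^esub>}, monoid.mult = undefined,
      monoid.one = undefined, ring.zero = (\<lambda>_. \<zero>\<^bsub>R\<^esub>), ring.add = (\<lambda>c d t. c t \<oplus>\<^bsub>R\<^esub> d t),
      smult = (\<lambda>r c t. c t \<otimes>\<^bsub>R\<^esub> r)\<rparr>"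

lemma free_module_simps:
  "c \<in> carrier (free_module R E T) \<longleftrightarrow> c \<in> coefs R E T \<and> (\<forall>t. t \<notin> T \<longrightarrow> c t = \<zero>\<^bsub>R\<^esub>)"
  "\<zero>\<^bsub>free_module R E T\<^esub> = (\<lambda>_. \<zero>\<^bsub>R\<^esub>)"
  "c \<oplus>\<^bsub>free_module R E T\<^esub> d = (\<lambda>t. c t \<oplus>\<^bsub>R\<^esub> d t)"
  "r \<odot>\<^bsub>free_module R E T\<^esub> c = (\<lambda>t. c t \<otimes>\<^bsub>R\<^esub> r)"
  by (simp_all add: free_module_def)

context ring
begin

lemma free_module_coordinate:
  assumes "c \<in> carrier (free_module R E T)"
  shows "c t \<in> carrier R" "t \<in> T \<Longrightarrow> E t \<otimes> c t = c t"
  using assms by (cases "t \<in> T"; simp add: free_module_simps coefs_def)+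

lemma coordinate_hom:
  "(\<lambda>c. c t) \<in> rmod_hom R (free_module R E T) (regular_module R)"
  by (rule rmod_homI) (auto simp: free_module_simps(2-) regular_module_simps intro: free_module_coordinate(1))

lemma free_module_fg:
  assumes T: "finite T" and E: "\<And>t. t \<in> T \<Longrightarrow> idempotent_elt R (E t)"
  shows "fg_module R (free_module R E T)"
proof -
  let ?F = "free_module R E T"
  have ER: "E t \<in> carrier R" "E t \<otimes> E t = E t" if "t \<in> T" for t
    using E[OF that] by (auto simp: idempotent_elt_def)
  have in_F: "c \<in> carrier ?F"
    if "\<And>t. t \<in> T \<Longrightarrow> c t \<in> carrier R" "\<And>t. t \<in> T \<Longrightarrow> E t \<otimes> c t = c t" "\<And>t. t \<notin> T \<Longrightarrow> c t = \<zero>" for c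
    using that by (auto simp: free_module_simps coefs_def)
  note cF = free_module_coordinate[of _ E T]
  have cl: "c \<oplus>\<^bsub>?F\<^esub> d \<in> carrier ?F" if "c \<in> carrier ?F" "d \<in> carrier ?F" for c d
    using cF[OF that(1)] cF[OF that(2)] that ER
    by (intro in_F) (auto simp: free_module_simps r_distr)
  have sm: "r \<odot>\<^bsub>?F\<^esub> c \<in> carrier ?F" if "r \<in> carrier R" "c \<in> carrier ?F" for c r
    using cF[OF that(2)] that ER
    by (intro in_F) (auto simp: free_module_simps m_assoc[symmetric])
  have ze: "\<zero>\<^bsub>?F\<^esub> \<in> carrier ?F" using ER by (intro in_F) (auto simp: free_module_simps)
  have "abelian_group ?F"
  proof (rule abelian_groupI)
    fix c assume c: "c \<in> carrier ?F"
    have "(\<ominus> \<one>) \<odot>\<^bsub>?F\<^esub> c \<oplus>\<^bsub>?F\<^esub> c = \<zero>\<^bsub>?F\<^esub>"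
      using cF(1)[OF c] by (auto simp: free_module_simps(2-) r_minus l_neg)
    then show "\<exists>d \<in> carrier ?F. d \<oplus>\<^bsub>?F\<^esub> c = \<zero>\<^bsub>?F\<^esub>" using sm[OF _ c, of "\<ominus> \<one>"] by blast
  qed (use cl ze cF(1) in \<open>auto simp: free_module_simps(2-) a_ac\<close>)
  then have r: "right_module R ?F"
    unfolding right_module_def right_module_axioms_def
    using ring_axioms sm cF(1) by (auto simp: free_module_simps(2-) l_distr r_distr m_assoc)
  define unit where "unit t = (\<lambda>s. if s = t then E t else \<zero>)" for t
  have unit: "unit t \<in> carrier ?F" if "t \<in> T" for t
    using ER[OF that] ER that by (intro in_F) (auto simp: unit_def)
  have "N = carrier ?F" if N: "submodule N R ?F" and B: "unit ` T \<subseteq> N" for N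
  proof
    note NF = right_module.submoduleD[OF r N]
    show "N \<subseteq> carrier ?F" by (rule NF(1))
    show "carrier ?F \<subseteq> N"
    proof
      fix c assume c: "c \<in> carrier ?F"
      \<comment> \<open>truncate \<open>c\<close> to a growing set of coordinates\<close>
      have "(\<lambda>t. if t \<in> S then c t else \<zero>) \<in> N" if "S \<subseteq> T" for S
        using finite_subset[OF that T] that
      proof (induction S rule: finite_induct)
        case empty
        show ?case using NF(2) by (simp add: free_module_simps)
      next
        case (insert a S)
        have "c a \<odot>\<^bsub>?F\<^esub> unit a \<in> N" using insert.prems B NF(4) cF(1)[OF c] by blast
        then have "(\<lambda>t. if t \<in> S then c t else \<zero>) \<oplus>\<^bsub>?F\<^esub> c a \<odot>\<^bsub>?F\<^esub> unit a \<in> N"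
          using insert NF(3) by blast
        also have "(\<lambda>t. if t \<in> S then c t else \<zero>) \<oplus>\<^bsub>?F\<^esub> c a \<odot>\<^bsub>?F\<^esub> unit a = (\<lambda>t. if t \<in> insert a S then c t else \<zero>)"
          using insert cF[OF c] by (auto simp: free_module_simps(2-) unit_def)
        finally show ?case .
      qed
      from this[of T] have "(\<lambda>t. if t \<in> T then c t else \<zero>) \<in> N" by simp
      moreover have "(\<lambda>t. if t \<in> T then c t else \<zero>) = c" using c by (auto simp: free_module_simps)
      ultimately show "c \<in> N" by simp
    qed
  qed
  then show ?thesis
    unfolding fg_module_def right_module.finitely_generated_iff[OF r]
    using r T unit by (auto intro!: exI[of _ "unit ` T"])
qed

text \<open>
  Each generator \<open>b\<close> is the sum of the elements \<open>b f\<close> over the complete set of idempotents \<open>f\<close>.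
\<close>

lemma fg_module_spans:
  assumes E0: "complete_primitive_idempotents R E0" and M: "fg_module R M"
  shows "\<exists>T E x. E \<in> T \<rightarrow> E0 \<and> spans R M E (T :: nat set) x"
proof -
  interpret M: right_module R M using M by (simp add: fg_module_def)
  have E0R: "finite E0" "\<And>f. f \<in> E0 \<Longrightarrow> idempotent_elt R f" "(\<Oplus>f \<in> E0. f) = \<one>"
    using E0 by (auto simp: complete_primitive_idempotents_def primitive_idempotent_def)
  obtain B where B: "finite B" "B \<subseteq> carrier M"
    "\<And>N. submodule N R M \<Longrightarrow> B \<subseteq> N \<Longrightarrow> N = carrier M"
    using M unfolding fg_module_def M.finitely_generated_iff by blast
  obtain h where h: "bij_betw h {0..<card (B \<times> E0)} (B \<times> E0)"
    using ex_bij_betw_nat_finite[of "B \<times> E0"] B(1) E0R(1) by blast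
  define T where "T = {0..<card (B \<times> E0)}"
  define E where "E t = snd (h t)" for t
  define x where "x t = E t \<odot>\<^bsub>M\<^esub> fst (h t)" for t
  have hT: "h t \<in> B \<times> E0" if "t \<in> T" for t using h that unfolding T_def bij_betw_def by blast
  have E: "E t \<in> E0" "idempotent_elt R (E t)" if "t \<in> T" for t
    using hT[OF that] E0R(2) by (auto simp: E_def mem_Times_iff)
  have x: "x t \<in> carrier M" "E t \<odot>\<^bsub>M\<^esub> x t = x t" if "t \<in> T" for t
    using hT[OF that] E(2)[OF that] B(2)
    by (auto simp: x_def mem_Times_iff idempotent_elt_def subset_iff M.smult_assoc[symmetric])
  have "N = carrier M" if N: "submodule N R M" "x ` T \<subseteq> N" for N
  proof (rule B(3)[OF N(1)], rule subsetI)
    fix b assume b: "b \<in> B"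
    then have bM: "b \<in> carrier M" using B by blast
    have fb: "f \<odot>\<^bsub>M\<^esub> b \<in> N" if f: "f \<in> E0" for f
    proof -
      obtain t where t: "t \<in> T" "h t = (b, f)" using h b f unfolding T_def by (metis SigmaI bij_betw_imp_surj_on imageE)
      then show ?thesis using N(2) by (auto simp: x_def E_def image_subset_iff)
    qed
    let ?s = "lincomb (regular_module R) E0 (\<lambda>_. \<one>) (\<lambda>f. f)"
    have "?s = (\<Oplus>f \<in> E0. \<one> \<odot>\<^bsub>regular_module R\<^esub> f)"
      by (simp add: lincomb_def finsum_def finprod_def regular_module_def)
    also have "\<dots> = (\<Oplus>f \<in> E0. f)"
      by (rule finsum_cong') (use E0R(2) in \<open>auto simp: regular_module_simps idempotent_elt_def\<close>)
    finally have "b = ?s \<odot>\<^bsub>M\<^esub> b" using E0R(3) bM by simp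
    also have "\<dots> = lincomb M E0 (\<lambda>_. \<one>) (\<lambda>f. f \<odot>\<^bsub>M\<^esub> b)"
      by (rule lincomb_hom[OF regular_right_module M.right_module_axioms M.action_hom[OF bM] E0R(1)])
        (use E0R(2) in \<open>auto simp: regular_module_simps idempotent_elt_def\<close>)
    also have "\<dots> \<in> N" by (rule M.lincomb_in_submodule[OF N(1) E0R(1)]) (use fb in auto)
    finally show "b \<in> N" .
  qed
  then have "spans R M E T x" by (subst M.spans_iff) (use E x in \<open>auto simp: T_def\<close>)
  then show ?thesis using E(1) by blast
qed

lemma left_mult_hom: "r \<in> carrier R \<Longrightarrow> (\<lambda>u. r \<otimes> u) \<in> rmod_hom R (regular_module R) (regular_module R)"
  by (rule rmod_homI) (simp_all add: regular_module_simps r_distr m_assoc)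

end

context finite_length_ring
begin

text \<open>
  This is Nakayama's lemma for one vector: \<open>v = g v\<close> says \<open>(1 - g) v = 0\<close>, and \<open>1 - g\<close> is invertible
  when \<open>g\<close> has entries in the radical. The proof is Gaussian elimination, since \<open>1 - g a a\<close> is a unit
  and eliminating \<open>v a\<close> changes the other entries of \<open>g\<close> only by elements of the radical.
\<close>

lemma radical_system_trivial:
  assumes "finite T" "\<And>t s. t \<in> T \<Longrightarrow> s \<in> T \<Longrightarrow> g t s \<in> ring_radical R"
    "v \<in> T \<rightarrow> carrier R" "\<And>t. t \<in> T \<Longrightarrow> v t = lincomb (regular_module R) T v (g t)"
  shows "\<forall>t \<in> T. v t = \<zero>"
  using assms
proof (induction T arbitrary: g rule: finite_induct)
  case empty
  show ?case by simp
next
  case (insert a T)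
  interpret Rg: right_module R "regular_module R" by (rule regular_right_module)
  note [simp] = regular_module_simps
  have gR: "g t s \<in> carrier R" if "t \<in> insert a T" "s \<in> insert a T" for t s
    using insert.prems(1)[OF that] by (simp add: radical_iff)
  have vR: "v t \<in> carrier R" if "t \<in> insert a T" for t using insert.prems(2) that by blast
  let ?S = "\<lambda>t. lincomb (regular_module R) T v (g t)"
  have SR: "?S t \<in> carrier R" if "t \<in> insert a T" for t
    using Rg.lincomb_closed[of v T "g t"] gR[OF that] vR by simp
  have row: "v t = g t a \<otimes> v a \<oplus> ?S t" if t: "t \<in> insert a T" for t
    using insert.prems(3)[OF t] Rg.lincomb_insert[OF insert.hyps, of v "g t"] gR[OF t] vR by auto
  obtain h where h: "h \<in> carrier R" "h \<otimes> (\<one> \<ominus> g a a) = \<one>"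
    using radical_inverse insert.prems(1)[of a a] by blast
  have "(\<one> \<ominus> g a a) \<otimes> v a = v a \<ominus> g a a \<otimes> v a" using gR vR by (simp add: minus_eq l_distr l_minus)
  also have "\<dots> = (g a a \<otimes> v a \<oplus> ?S a) \<ominus> g a a \<otimes> v a" using row[of a] by simp
  also have "\<dots> = ?S a" by (rule add_diff_cancel) (use gR vR SR in auto)
  finally have "h \<otimes> ?S a = (h \<otimes> (\<one> \<ominus> g a a)) \<otimes> v a" using h(1) gR vR by (simp add: m_assoc)
  then have va: "v a = h \<otimes> ?S a" using h vR by simp
  define g' where "g' t s = (g t a \<otimes> h) \<otimes> g a s \<oplus> g t s" for t s
  have v0: "\<forall>t \<in> T. v t = \<zero>"
  proof (rule insert.IH[of g'])
    show "g' t s \<in> ring_radical R" if ts: "t \<in> T" "s \<in> T" for t s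
      using radical_left_ideal[OF insert.prems(1)[of a s], of "g t a \<otimes> h"] ts gR h
        right_idealD(3)[OF right_ideal_radical] insert.prems(1) by (simp add: g'_def)
    show "v \<in> T \<rightarrow> carrier R" using insert.prems(2) by blast
    fix t assume t: "t \<in> T"
    have "lincomb (regular_module R) T v (g' t)
        = lincomb (regular_module R) T v (\<lambda>s. (g t a \<otimes> h) \<otimes> g a s) \<oplus> ?S t"
      unfolding g'_def using Rg.lincomb_add_right[of v T "\<lambda>s. (g t a \<otimes> h) \<otimes> g a s" "g t"] gR h vR t by simp
    also have "lincomb (regular_module R) T v (\<lambda>s. (g t a \<otimes> h) \<otimes> g a s) = (g t a \<otimes> h) \<otimes> ?S a"
      using lincomb_hom[OF regular_right_module regular_right_module left_mult_hom insert.hyps(1), of "g t a \<otimes> h" v "g a"]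
        gR h vR t by simp
    also have "\<dots> = g t a \<otimes> v a" using va t gR h SR by (simp add: m_assoc)
    finally show "v t = lincomb (regular_module R) T v (g' t)" using row[of t] t by simp
  qed
  have "?S a = \<zero>" using Rg.lincomb_zero[of T v "g a"] v0 gR by simp
  then show ?case using va v0 h by simp
qed

text \<open>
  Choose a spanning family of minimal size. Then all relations between its members have coefficients
  in the radical, since an element of \<open>E t R\<close> outside the radical generates \<open>E t R\<close> and would make
  \<open>x t\<close> superfluous. By projectivity the epimorphism \<open>\<pi>\<close> from the direct sum has a section \<open>s\<close>; the
  columns of the matrix \<open>g\<close> of \<open>1 - s \<pi>\<close> are relations, so \<open>g\<close> has entries in the radical. As \<open>g v = v\<close>
  for every relation \<open>v\<close>, there is no relation but \<open>0\<close>.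
\<close>

lemma projective_has_basis:
  fixes P :: "('a, 'a fg_universe) module"
  assumes E0: "complete_primitive_idempotents R E0" and proj: "projective_module R P"
  shows "\<exists>T E x. E \<in> T \<rightarrow> E0 \<and> projective_basis R P E (T :: nat set) x"
proof -
  have fg: "fg_module R P" using proj by (simp add: projective_module_def)
  interpret P: right_module R P using fg by (simp add: fg_module_def)
  have prim: "primitive_idempotent R f" if "f \<in> E0" for f
    using E0 that by (simp add: complete_primitive_idempotents_def)
  define Q where "Q k \<longleftrightarrow> (\<exists>T E x. E \<in> T \<rightarrow> E0 \<and> spans R P E (T :: nat set) x \<and> card T = k)" for k
  have "\<exists>k. Q k" using fg_module_spans[OF E0 fg] by (auto simp: Q_def)
  then obtain k where k: "Q k" "\<And>l. Q l \<Longrightarrow> k \<le> l" using ex_least_nat_le[of Q] by (metis linorder_not_less)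
  then obtain T :: "nat set" and E x where ET: "E \<in> T \<rightarrow> E0" and sp: "spans R P E T x" and card: "card T = k"
    by (auto simp: Q_def)
  note T = spansD(1)[OF sp] and xP = spansD(2)[OF sp] and xE = spansD(3)[OF sp]
  have pE: "primitive_idempotent R (E t)" if "t \<in> T" for t using ET prim that by blast
  then have idE: "idempotent_elt R (E t)" if "t \<in> T" for t using that by (auto simp: primitive_idempotent_def)
  then have ER: "E t \<in> carrier R" "E t \<otimes> E t = E t" if "t \<in> T" for t
    using that by (auto simp: idempotent_elt_def)
  \<comment> \<open>minimality puts the relations into the radical\<close>
  have rad: "c t \<in> ring_radical R"
    if c: "c \<in> coefs R E T" "lincomb P T c x = \<zero>\<^bsub>P\<^esub>" and t: "t \<in> T" for c t
  proof (rule ccontr)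
    note cR = coefs_Pi[OF c(1)]
    assume "c t \<notin> ring_radical R"
    then obtain v where v: "v \<in> carrier R" "c t \<otimes> v = E t"
      using radical_primitive_iff[OF pE[OF t]] coefsD[OF c(1) t] by blast
    have "x t \<in> N" if N: "submodule N R P" "x ` (T - {t}) \<subseteq> N" for N
    proof -
      let ?w = "lincomb P (T - {t}) c x"
      have w: "?w \<in> N" by (rule P.lincomb_in_submodule[OF N(1)]) (use T cR N(2) in auto)
      have ctx: "c t \<odot>\<^bsub>P\<^esub> x t \<in> carrier P" using cR xP t by blast
      have "c t \<odot>\<^bsub>P\<^esub> x t \<oplus>\<^bsub>P\<^esub> ?w = \<zero>\<^bsub>P\<^esub>" using P.lincomb_remove[OF T t cR xP] c(2) by simp
      then have "\<ominus>\<^bsub>P\<^esub> ?w = c t \<odot>\<^bsub>P\<^esub> x t"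
        by (rule P.M.minus_equality) (use P.submoduleD(1)[OF N(1)] w ctx in auto)
      then have "c t \<odot>\<^bsub>P\<^esub> x t \<in> N" using P.submoduleD(5)[OF N(1) w] by simp
      moreover have "x t = v \<odot>\<^bsub>P\<^esub> (c t \<odot>\<^bsub>P\<^esub> x t)"
        using P.smult_assoc[of "c t" v "x t"] v xE[OF t] xP cR t by (auto simp: Pi_iff)
      ultimately show ?thesis using P.submoduleD(4)[OF N(1) v(1)] by metis
    qed
    then have "N = carrier P" if N: "submodule N R P" "x ` (T - {t}) \<subseteq> N" for N
      using sp N P.spans_iff[OF T idE xP xE] by blast
    then have "spans R P E (T - {t}) x"
      by (subst P.spans_iff) (use T idE xP xE in auto)
    moreover have "E \<in> T - {t} \<rightarrow> E0" using ET by blast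
    ultimately have "Q (card (T - {t}))" unfolding Q_def by blast
    then have "k \<le> card (T - {t})" by (rule k(2))
    then show False using card t T by (metis card_Diff1_less linorder_not_less)
  qed
  let ?F = "free_module R E T" and ?\<phi> = "\<lambda>c :: nat \<Rightarrow> 'a. {c}"
  have F: "fg_module R ?F" by (rule free_module_fg[OF T idE])
  interpret F: right_module R ?F using F by (simp add: fg_module_def)
  have \<phi>: "inj_on ?\<phi> (carrier ?F)" by (auto intro: inj_onI)
  note A = copy_module[OF F.right_module_axioms \<phi>]
  define \<pi> where "\<pi> c = lincomb P T c x" for c
  have FR: "c \<in> T \<rightarrow> carrier R" if "c \<in> carrier ?F" for c using free_module_coordinate(1)[OF that] by blast
  have \<pi>: "\<pi> \<in> rmod_hom R ?F P"
    unfolding \<pi>_def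
    by (rule rmod_homI)
      (use FR xP T in \<open>auto simp: free_module_simps(2-) P.lincomb_add P.smult_lincomb\<close>)
  let ?dec = "inv_into (carrier ?F) ?\<phi>"
  have g: "(\<lambda>u. \<pi> (?dec u)) \<in> rmod_hom R (copy_module ?\<phi> ?F) P" by (rule rmod_hom_comp[OF A(3) \<pi>])
  have dec: "?dec {c} = c" if "c \<in> carrier ?F" for c using inv_into_f_f[OF \<phi> that] .
  have "(\<lambda>u. \<pi> (?dec u)) ` carrier (copy_module ?\<phi> ?F) = carrier P"
  proof
    show "(\<lambda>u. \<pi> (?dec u)) ` carrier (copy_module ?\<phi> ?F) \<subseteq> carrier P" using rmod_homD(1)[OF g] by blast
    show "carrier P \<subseteq> (\<lambda>u. \<pi> (?dec u)) ` carrier (copy_module ?\<phi> ?F)"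
    proof
      fix y assume "y \<in> carrier P"
      then obtain c where c: "c \<in> coefs R E T" "y = \<pi> c" using spansD(4)[OF sp] by (auto simp: \<pi>_def)
      define c' where "c' t = (if t \<in> T then c t else \<zero>)" for t
      have c': "c' \<in> carrier ?F" using c(1) by (auto simp: free_module_simps coefs_def c'_def)
      have "\<pi> c' = \<pi> c" unfolding \<pi>_def by (rule P.lincomb_cong) (use coefs_Pi[OF c(1)] xP in \<open>auto simp: c'_def\<close>)
      then have "y = \<pi> (?dec {c'})" using c dec[OF c'] by simp
      moreover have "{c'} \<in> carrier (copy_module ?\<phi> ?F)" using c' A(4) by blast
      ultimately show "y \<in> (\<lambda>u. \<pi> (?dec u)) ` carrier (copy_module ?\<phi> ?F)" by (rule image_eqI)
    qed
  qed
  moreover have "(\<lambda>p. p) \<in> rmod_hom R P P" by (rule rmod_homI) auto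
  moreover have "fg_module R (copy_module ?\<phi> ?F)" by (rule copy_module_fg[OF F \<phi>])
  ultimately obtain h where h: "h \<in> rmod_hom R P (copy_module ?\<phi> ?F)" "\<forall>p \<in> carrier P. \<pi> (?dec (h p)) = p"
    using proj fg g unfolding projective_module_def by meson
  define s where "s p = ?dec (h p)" for p
  have s: "s \<in> rmod_hom R P ?F" unfolding s_def by (rule rmod_hom_comp[OF h(1) A(3)])
  have \<pi>s: "\<pi> (s p) = p" if "p \<in> carrier P" for p using h(2) that by (simp add: s_def)
  define unit where "unit t = (\<lambda>s. if t = s then E t else \<zero>)" for t
  have unit: "unit t \<in> carrier ?F" if "t \<in> T" for t
    using ER that by (auto simp: unit_def free_module_simps coefs_def)
  have \<pi>_unit: "\<pi> (unit t) = x t" if t: "t \<in> T" for t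
    using P.lincomb_single[OF T t xP ER(1)[OF t]] xE[OF t] by (simp add: \<pi>_def unit_def)
  define g where "g t t' = unit t' t \<ominus> s (x t') t" for t t'
  have gJ: "g t t' \<in> ring_radical R" if t: "t \<in> T" "t' \<in> T" for t t'
  proof (rule rad[of "\<lambda>t. g t t'"])
    have xt: "x t' \<in> carrier P" using xP t by blast
    have sx: "s (x t') \<in> carrier ?F" by (rule rmod_homD(1)[OF s xt])
    have neg: "(\<ominus> \<one>) \<odot>\<^bsub>?F\<^esub> s (x t') \<in> carrier ?F" using F.smult_closed[OF _ sx] by simp
    have d: "(\<lambda>t. g t t') = unit t' \<oplus>\<^bsub>?F\<^esub> (\<ominus> \<one>) \<odot>\<^bsub>?F\<^esub> s (x t')"
      using free_module_coordinate(1)[OF sx] by (auto simp: free_module_simps(2-) g_def minus_eq r_minus)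
    have "unit t' \<oplus>\<^bsub>?F\<^esub> (\<ominus> \<one>) \<odot>\<^bsub>?F\<^esub> s (x t') \<in> carrier ?F" using unit[OF t(2)] neg by simp
    then show "(\<lambda>t. g t t') \<in> coefs R E T" unfolding d by (simp add: free_module_simps(1))
    have "\<pi> (unit t' \<oplus>\<^bsub>?F\<^esub> (\<ominus> \<one>) \<odot>\<^bsub>?F\<^esub> s (x t')) = x t' \<oplus>\<^bsub>P\<^esub> (\<ominus> \<one>) \<odot>\<^bsub>P\<^esub> x t'"
      using rmod_homD(2)[OF \<pi> unit[OF t(2)] neg] rmod_homD(3)[OF \<pi> _ sx, of "\<ominus> \<one>"] \<pi>_unit[OF t(2)] \<pi>s[OF xt] by simp
    also have "\<dots> = \<zero>\<^bsub>P\<^esub>" using xt P.smult_l_minus[of \<one> "x t'"] by (simp add: P.M.r_neg)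
    finally have "\<pi> (\<lambda>t. g t t') = \<zero>\<^bsub>P\<^esub>" unfolding d .
    then show "lincomb P T (\<lambda>t. g t t') x = \<zero>\<^bsub>P\<^esub>" by (simp add: \<pi>_def)
  qed (use t in auto)
  have "\<forall>t \<in> T. v t = \<zero>" if v: "v \<in> coefs R E T" "lincomb P T v x = \<zero>\<^bsub>P\<^esub>" for v
  proof (rule radical_system_trivial[OF T gJ])
    note [simp] = regular_module_simps
    note vR = coefs_Pi[OF v(1)]
    show "v \<in> T \<rightarrow> carrier R" by (rule vR)
    fix t assume t: "t \<in> T"
    have \<kappa>: "(\<lambda>p. s p t) \<in> rmod_hom R P (regular_module R)" by (rule rmod_hom_comp[OF s coordinate_hom])
    have \<kappa>R: "(\<lambda>t'. s (x t') t) \<in> T \<rightarrow> carrier R"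
      using rmod_homD(1)[OF \<kappa>] xP by (auto simp: Pi_iff)
    have uR: "(\<lambda>t'. unit t' t) \<in> T \<rightarrow> carrier R" using ER by (auto simp: unit_def)
    have gR: "g t \<in> T \<rightarrow> carrier R" using uR \<kappa>R by (auto simp: g_def Pi_iff)
    have "lincomb (regular_module R) T v (\<lambda>t'. s (x t') t) = s (lincomb P T v x) t"
      by (rule lincomb_hom[OF P.right_module_axioms regular_right_module \<kappa> T vR xP, symmetric])
    also have "\<dots> = \<zero>"
      unfolding v(2) using rmod_hom_zero[OF P.right_module_axioms regular_right_module \<kappa>] by simp
    finally have k0: "lincomb (regular_module R) T v (\<lambda>t'. s (x t') t) = \<zero>" .
    have "lincomb (regular_module R) T v (\<lambda>t'. unit t' t) = lincomb (regular_module R) T v (\<lambda>t'. g t t' \<oplus> s (x t') t)"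
      by (rule P.regular.lincomb_cong)
        (use uR \<kappa>R vR gR in \<open>auto simp: g_def minus_eq a_assoc l_neg Pi_iff\<close>)
    also have "\<dots> = lincomb (regular_module R) T v (g t)"
      using P.regular.lincomb_add_right[of v T "g t" "\<lambda>t'. s (x t') t"] P.regular.lincomb_closed[of v T "g t"]
        vR gR \<kappa>R k0 by simp
    also have "lincomb (regular_module R) T v (\<lambda>t'. unit t' t) = v t"
    proof -
      have "lincomb (regular_module R) (T - {t}) v (\<lambda>t'. unit t' t) = \<zero>"
        using P.regular.lincomb_zero[of "T - {t}" v "\<lambda>t'. unit t' t"] vR by (auto simp: unit_def Pi_iff)
      then show ?thesis
        using P.regular.lincomb_remove[OF T t, of v "\<lambda>t'. unit t' t"] vR uR t coefsD[OF v(1) t]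
        by (simp add: unit_def)
    qed
    finally show "v t = lincomb (regular_module R) T v (g t)" .
  qed
  then have "projective_basis R P E T x" unfolding projective_basis_def using sp by blast
  then show ?thesis using ET by blast
qed

end

section \<open>Finite dimensional algebras have finite length\<close>

lemma module_imp_right_module:
  assumes "module K V"
  shows "right_module K V"
proof -
  interpret module K V by fact
  show ?thesis
    unfolding right_module_def right_module_axioms_def
    using R.ring_axioms M.abelian_group_axioms smult_l_distr smult_r_distr
    by (simp add: R.m_comm smult_assoc1[symmetric])
qed

text \<open>
  The role of the dimension of \<open>A\<close>: a strictly monotone function on the subspaces of \<open>A\<close> is enough,
  and it can be extended one generator at a time.
\<close>

definition has_length_function :: "('k, 'x) ring_scheme \<Rightarrow> ('k, 'm) module \<Rightarrow> 'm set \<Rightarrow> bool" where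
  "has_length_function K V A \<longleftrightarrow>
     (\<exists>len :: 'm set \<Rightarrow> nat. \<forall>U W. submodule U K V \<and> submodule W K V \<and> U \<subset> W \<and> W \<subseteq> A \<longrightarrow> len U < len W)"

text \<open>
  For a subspace \<open>W\<close> of \<open>A + K b\<close> take the length of \<open>W \<inter> A\<close> and add one if \<open>W\<close> is not contained in
  \<open>A\<close>. If \<open>U \<subset> W\<close> have the same intersection with \<open>A\<close>, then \<open>U\<close> is contained in \<open>A\<close>: an element of \<open>U\<close>
  outside \<open>A\<close> could be used to move every element of \<open>W\<close> into \<open>W \<inter> A = U \<inter> A\<close>, by dividing by its
  coefficient at \<open>b\<close>.
\<close>

lemma length_function_extend:
  assumes K: "field K" and V: "right_module K V" and A: "submodule A K V" "has_length_function K V A"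
    and b: "b \<in> carrier V"
  shows "submodule {v \<oplus>\<^bsub>V\<^esub> c \<odot>\<^bsub>V\<^esub> b |v c. v \<in> A \<and> c \<in> carrier K} K V" (is "submodule ?B K V")
    and "has_length_function K V {v \<oplus>\<^bsub>V\<^esub> c \<odot>\<^bsub>V\<^esub> b |v c. v \<in> A \<and> c \<in> carrier K}"
proof -
  interpret K: field K by fact
  interpret V: right_module K V by fact
  note A1 = A(1)[unfolded V.submodule_iff]
  have AV: "v \<in> carrier V" if "v \<in> A" for v using A1 that by blast
  show "submodule ?B K V"
    unfolding V.submodule_iff
  proof (intro conjI ballI)
    show "?B \<subseteq> carrier V" using AV b by auto
    have "\<zero>\<^bsub>V\<^esub> = \<zero>\<^bsub>V\<^esub> \<oplus>\<^bsub>V\<^esub> \<zero>\<^bsub>K\<^esub> \<odot>\<^bsub>V\<^esub> b" using b by simp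
    then show "\<zero>\<^bsub>V\<^esub> \<in> ?B" using A1 by blast
  next
    fix x y assume "x \<in> ?B" "y \<in> ?B"
    then obtain v c v' c' where *: "x = v \<oplus>\<^bsub>V\<^esub> c \<odot>\<^bsub>V\<^esub> b" "y = v' \<oplus>\<^bsub>V\<^esub> c' \<odot>\<^bsub>V\<^esub> b" "v \<in> A" "v' \<in> A"
      "c \<in> carrier K" "c' \<in> carrier K" by blast
    then have "x \<oplus>\<^bsub>V\<^esub> y = (v \<oplus>\<^bsub>V\<^esub> v') \<oplus>\<^bsub>V\<^esub> (c \<oplus>\<^bsub>K\<^esub> c') \<odot>\<^bsub>V\<^esub> b"
      using AV b by (simp add: V.smult_l_distr V.M.a_ac)
    moreover have "v \<oplus>\<^bsub>V\<^esub> v' \<in> A" "c \<oplus>\<^bsub>K\<^esub> c' \<in> carrier K" using A1 * by auto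
    ultimately show "x \<oplus>\<^bsub>V\<^esub> y \<in> ?B" by blast
  next
    fix r x assume r: "r \<in> carrier K" and "x \<in> ?B"
    then obtain v c where *: "x = v \<oplus>\<^bsub>V\<^esub> c \<odot>\<^bsub>V\<^esub> b" "v \<in> A" "c \<in> carrier K" by blast
    then have "r \<odot>\<^bsub>V\<^esub> x = r \<odot>\<^bsub>V\<^esub> v \<oplus>\<^bsub>V\<^esub> (c \<otimes>\<^bsub>K\<^esub> r) \<odot>\<^bsub>V\<^esub> b"
      using AV b r by (simp add: V.smult_r_distr V.smult_assoc)
    moreover have "r \<odot>\<^bsub>V\<^esub> v \<in> A" "c \<otimes>\<^bsub>K\<^esub> r \<in> carrier K" using A1 * r by auto
    ultimately show "r \<odot>\<^bsub>V\<^esub> x \<in> ?B" by blast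
  qed
  obtain len :: "'c set \<Rightarrow> nat" where
    len: "\<And>U W. submodule U K V \<Longrightarrow> submodule W K V \<Longrightarrow> U \<subset> W \<Longrightarrow> W \<subseteq> A \<Longrightarrow> len U < len W"
    using A(2) unfolding has_length_function_def by blast
  have sub_Int: "submodule (U \<inter> A) K V" if "submodule U K V" for U
    using that A1 unfolding V.submodule_iff by auto
  define len' where "len' W = len (W \<inter> A) + (if W \<subseteq> A then 0 else 1)" for W
  have "len' U < len' W" if U: "submodule U K V" and W: "submodule W K V" and UW: "U \<subset> W" and WB: "W \<subseteq> ?B" for U W
  proof (cases "U \<inter> A = W \<inter> A")
    case False
    then have "U \<inter> A \<subset> W \<inter> A" using UW by blast
    then have "len (U \<inter> A) < len (W \<inter> A)" using len[OF sub_Int[OF U] sub_Int[OF W]] by blast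
    moreover have "W \<subseteq> A \<Longrightarrow> U \<subseteq> A" using UW by blast
    ultimately show ?thesis by (auto simp: len'_def)
  next
    case True
    have WA: "\<not> W \<subseteq> A" using True UW by blast
    have "U \<subseteq> A"
    proof (rule ccontr)
      note U1 = U[unfolded V.submodule_iff] and W1 = W[unfolded V.submodule_iff]
      assume "\<not> U \<subseteq> A"
      then obtain u where u: "u \<in> U" "u \<notin> A" by blast
      then obtain v1 c1 where v1: "u = v1 \<oplus>\<^bsub>V\<^esub> c1 \<odot>\<^bsub>V\<^esub> b" "v1 \<in> A" "c1 \<in> carrier K" using UW WB by blast
      have c1: "c1 \<noteq> \<zero>\<^bsub>K\<^esub>"
      proof
        assume "c1 = \<zero>\<^bsub>K\<^esub>"
        then have "u = v1" using v1 AV b by simp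
        then show False using u v1 by blast
      qed
      have "W \<subseteq> U"
      proof
        fix w assume w: "w \<in> W"
        then obtain v c where v: "w = v \<oplus>\<^bsub>V\<^esub> c \<odot>\<^bsub>V\<^esub> b" "v \<in> A" "c \<in> carrier K" using WB by blast
        define q where "q = \<ominus>\<^bsub>K\<^esub> (c \<otimes>\<^bsub>K\<^esub> inv\<^bsub>K\<^esub> c1)"
        have ic: "inv\<^bsub>K\<^esub> c1 \<in> carrier K" "inv\<^bsub>K\<^esub> c1 \<otimes>\<^bsub>K\<^esub> c1 = \<one>\<^bsub>K\<^esub>"
          using c1 v1(3) K.field_Units by auto
        have q: "q \<in> carrier K" using ic v by (simp add: q_def)
        have qc: "c1 \<otimes>\<^bsub>K\<^esub> q = \<ominus>\<^bsub>K\<^esub> c"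
          using ic v v1 K.m_comm[of c1 q] q by (simp add: q_def K.l_minus K.m_assoc)
        have qu: "q \<odot>\<^bsub>V\<^esub> u = q \<odot>\<^bsub>V\<^esub> v1 \<oplus>\<^bsub>V\<^esub> \<ominus>\<^bsub>V\<^esub> (c \<odot>\<^bsub>V\<^esub> b)"
          using v1 AV b q v qc by (simp add: V.smult_r_distr V.smult_assoc[symmetric] V.smult_l_minus)
        have "w \<oplus>\<^bsub>V\<^esub> q \<odot>\<^bsub>V\<^esub> u = v \<oplus>\<^bsub>V\<^esub> q \<odot>\<^bsub>V\<^esub> v1 \<oplus>\<^bsub>V\<^esub> (c \<odot>\<^bsub>V\<^esub> b \<oplus>\<^bsub>V\<^esub> \<ominus>\<^bsub>V\<^esub> (c \<odot>\<^bsub>V\<^esub> b))"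
          unfolding qu v(1) using v v1 AV b q by (simp add: V.M.a_ac del: V.M.r_neg)
        also have "\<dots> = v \<oplus>\<^bsub>V\<^esub> q \<odot>\<^bsub>V\<^esub> v1" using v v1 AV b q by (simp add: V.M.r_neg)
        finally have "w \<oplus>\<^bsub>V\<^esub> q \<odot>\<^bsub>V\<^esub> u \<in> A" using A1 v v1 q by simp
        moreover have "w \<oplus>\<^bsub>V\<^esub> q \<odot>\<^bsub>V\<^esub> u \<in> W" using W1 w u UW q by blast
        ultimately have s: "w \<oplus>\<^bsub>V\<^esub> q \<odot>\<^bsub>V\<^esub> u \<in> U" using True by blast
        have uV: "u \<in> carrier V" "w \<in> carrier V" using u w U1 W1 by blast+
        have "(\<ominus>\<^bsub>K\<^esub> q) \<odot>\<^bsub>V\<^esub> u \<in> U" using U1 u q by blast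
        then have "(w \<oplus>\<^bsub>V\<^esub> q \<odot>\<^bsub>V\<^esub> u) \<oplus>\<^bsub>V\<^esub> (\<ominus>\<^bsub>K\<^esub> q) \<odot>\<^bsub>V\<^esub> u \<in> U" using U1 s by blast
        moreover have "(w \<oplus>\<^bsub>V\<^esub> q \<odot>\<^bsub>V\<^esub> u) \<oplus>\<^bsub>V\<^esub> (\<ominus>\<^bsub>K\<^esub> q) \<odot>\<^bsub>V\<^esub> u = w"
          using uV q by (simp add: V.smult_l_minus V.M.a_assoc V.M.r_neg)
        ultimately show "w \<in> U" by simp
      qed
      then show False using UW by blast
    qed
    then show ?thesis using True WA by (simp add: len'_def)
  qed
  then show "has_length_function K V ?B" unfolding has_length_function_def by blast
qed

lemma finite_dimensional_length_function:
  assumes K: "field K" and V: "right_module K V" and fg: "finitely_generated K V"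
  shows "has_length_function K V (carrier V)"
proof -
  interpret V: right_module K V by fact
  obtain B where B: "finite B" "B \<subseteq> carrier V" "\<And>N. submodule N K V \<Longrightarrow> B \<subseteq> N \<Longrightarrow> N = carrier V"
    using fg unfolding V.finitely_generated_iff by blast
  have "\<exists>A. submodule A K V \<and> has_length_function K V A \<and> B \<subseteq> A"
    using B(1,2)
  proof (induction B rule: finite_induct)
    case empty
    have "submodule {\<zero>\<^bsub>V\<^esub>} K V" by (simp add: V.submodule_iff)
    moreover have "has_length_function K V {\<zero>\<^bsub>V\<^esub>}"
      unfolding has_length_function_def V.submodule_iff by blast
    ultimately show ?case by blast
  next
    case (insert b B)
    then obtain A where A: "submodule A K V" "has_length_function K V A" "B \<subseteq> A" by auto
    have b: "b \<in> carrier V" using insert by simp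
    let ?A = "{v \<oplus>\<^bsub>V\<^esub> c \<odot>\<^bsub>V\<^esub> b |v c. v \<in> A \<and> c \<in> carrier K}"
    note A1 = A(1)[unfolded V.submodule_iff]
    have "v \<in> ?A" if v: "v \<in> A" for v
    proof -
      have "v = v \<oplus>\<^bsub>V\<^esub> \<zero>\<^bsub>K\<^esub> \<odot>\<^bsub>V\<^esub> b" using b A1 v by auto
      then show ?thesis using v by blast
    qed
    moreover have "b = \<zero>\<^bsub>V\<^esub> \<oplus>\<^bsub>V\<^esub> \<one>\<^bsub>K\<^esub> \<odot>\<^bsub>V\<^esub> b" using b by simp
    then have "b \<in> ?A" using A1 by blast
    ultimately have "insert b B \<subseteq> ?A" using A(3) by blast
    then show ?case using length_function_extend[OF K V A(1,2) b] by blast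
  qed
  then show ?thesis using B(3) by blast
qed

lemma fd_algebra_finite_length:
  assumes "fd_algebra K R"
  shows "finite_length_ring R"
proof -
  interpret R: ring R using assms by (simp add: fd_algebra_def)
  interpret V: module K R using assms by (simp add: fd_algebra_def)
  have K: "field K" using assms by (simp add: fd_algebra_def algebraically_closed_def)
  have comm: "c \<odot>\<^bsub>R\<^esub> (x \<otimes>\<^bsub>R\<^esub> y) = x \<otimes>\<^bsub>R\<^esub> (c \<odot>\<^bsub>R\<^esub> y)"
    if "c \<in> carrier K" "x \<in> carrier R" "y \<in> carrier R" for c x y
    using assms that unfolding fd_algebra_def by metis
  have sub: "submodule I K R" if I: "right_ideal R I" for I
  proof -
    have "c \<odot>\<^bsub>R\<^esub> x \<in> I" if "c \<in> carrier K" "x \<in> I" for c x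
    proof -
      have "x \<in> carrier R" using right_idealD(1)[OF I] that by blast
      then have "c \<odot>\<^bsub>R\<^esub> x = x \<otimes>\<^bsub>R\<^esub> (c \<odot>\<^bsub>R\<^esub> \<one>\<^bsub>R\<^esub>)" using comm[of c x "\<one>\<^bsub>R\<^esub>"] that by simp
      then show ?thesis using right_idealD(4)[OF I that(2)] that by simp
    qed
    then show ?thesis
      unfolding right_module.submodule_iff[OF module_imp_right_module[OF V.module_axioms]] using right_idealD[OF I] by auto
  qed
  have "has_length_function K R (carrier R)"
    using finite_dimensional_length_function[OF K module_imp_right_module[OF V.module_axioms]] assms by (simp add: fd_algebra_def)
  then obtain len :: "'c set \<Rightarrow> nat" where
    "\<forall>U W. submodule U K R \<and> submodule W K R \<and> U \<subset> W \<and> W \<subseteq> carrier R \<longrightarrow> len U < len W"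
    unfolding has_length_function_def by (elim exE)
  then have "len I < len J" if "right_ideal R I" "right_ideal R J" "I \<subset> J" for I J
    using sub[OF that(1)] sub[OF that(2)] right_idealD(1)[OF that(2)] that(3) by simp
  then have "\<exists>len :: 'c set \<Rightarrow> nat. \<forall>I J. right_ideal R I \<and> right_ideal R J \<and> I \<subset> J \<longrightarrow> len I < len J"
    by (intro exI[of _ len]) simp
  then show ?thesis
    using R.ring_axioms by (simp add: finite_length_ring_def finite_length_ring_axioms_def)
qed

section \<open>Injective indecomposable right ideals\<close>

text \<open>
  The homomorphism from \<open>f R\<close> to \<open>R\<close> that \<open>r\<close> defines by left multiplication is a monomorphism.
\<close>

definition monic :: "('r, 'x) ring_scheme \<Rightarrow> 'r \<Rightarrow> 'r \<Rightarrow> bool" where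
  "monic R f r \<longleftrightarrow> (\<forall>u \<in> carrier R. f \<otimes>\<^bsub>R\<^esub> u = u \<and> r \<otimes>\<^bsub>R\<^esub> u = \<zero>\<^bsub>R\<^esub> \<longrightarrow> u = \<zero>\<^bsub>R\<^esub>)"

lemma monicD:
  "\<lbrakk>monic R f r; u \<in> carrier R; f \<otimes>\<^bsub>R\<^esub> u = u; r \<otimes>\<^bsub>R\<^esub> u = \<zero>\<^bsub>R\<^esub>\<rbrakk> \<Longrightarrow> u = \<zero>\<^bsub>R\<^esub>"
  by (auto simp: monic_def)

context ring
begin

lemma monic_cancel:
  assumes "monic R f r" "r \<in> carrier R" "f \<in> carrier R" and u: "u \<in> carrier R" "f \<otimes> u = u"
    and v: "v \<in> carrier R" "f \<otimes> v = v" and eq: "r \<otimes> u = r \<otimes> v"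
  shows "u = v"
proof -
  have "f \<otimes> (u \<ominus> v) = u \<ominus> v" "r \<otimes> (u \<ominus> v) = \<zero>"
    using assms by (simp_all add: minus_eq r_distr r_minus r_neg)
  then have "u \<ominus> v = \<zero>" using monicD[OF assms(1)] u v by blast
  then show ?thesis using u v by simp
qed

text \<open>
  The ideal \<open>x R\<close> is a copy of \<open>f R\<close> because \<open>x\<close> is monic on it, so \<open>x \<mapsto> r\<close> defines a homomorphism
  from \<open>x R\<close> to \<open>e R\<close>; by Baer's form of injectivity it is left multiplication by some \<open>c\<close>.
\<close>

lemma injective_extend_principal:
  assumes e: "e \<in> carrier R" "idempotent_elt R e" and inj: "injective_module R (idempotent_module R e)"
    and f: "f \<in> carrier R" and x: "x \<in> carrier R" "x \<otimes> f = x" "monic R f x" and id: "idempotent_elt R f"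
    and r: "r \<in> carrier R" "e \<otimes> r = r" "r \<otimes> f = r"
  shows "\<exists>c \<in> carrier R. e \<otimes> c = c \<and> c \<otimes> x = r"
proof -
  let ?I = "x <# carrier R" and ?E = "idempotent_module R e"
  note I = right_ideal_principal[OF x(1)]
  note simps = idempotent_module_def sub_module_simps regular_module_simps
  have E: "right_module R ?E"
    unfolding idempotent_module_def by (rule ideal_module_right_module[OF right_ideal_principal[OF e(1)]])
  have ann: "r \<otimes> u = \<zero>" if u: "u \<in> carrier R" "x \<otimes> u = \<zero>" for u
  proof -
    have "x \<otimes> (f \<otimes> u) = \<zero>" "f \<otimes> (f \<otimes> u) = f \<otimes> u"
      using u x f id by (simp_all add: m_assoc[symmetric] idempotent_elt_def)
    then have "f \<otimes> u = \<zero>" using monicD[OF x(3)] f u by simp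
    then have "(r \<otimes> f) \<otimes> u = \<zero>" using r(1) f u by (simp add: m_assoc)
    then show ?thesis using r(3) by simp
  qed
  have "r \<in> carrier ?E" using r mem_idempotent_right_ideal_iff[OF e(2)] by (simp add: simps)
  then obtain h where h: "h \<in> rmod_hom R (ideal_module R ?I) ?E" "\<And>u. u \<in> carrier R \<Longrightarrow> h (x \<otimes> u) = r \<otimes> u"
    using cyclic_hom[OF ideal_module_right_module[OF I] E, of x r] principal_self[OF x(1)] ann
    by (auto simp: simps mem_l_coset_iff)
  obtain c where c: "c \<in> carrier ?E" "\<forall>y \<in> ?I. h y = y \<odot>\<^bsub>?E\<^esub> c"
    using injective_extension[OF inj I, of "{x}"] principal_self[OF x(1)] principal_subset_right_ideal h(1) by blast
  have "c \<otimes> x = r"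
    using bspec[OF c(2) principal_self[OF x(1)]] h(2)[OF one_closed] x(1) r(1) by (simp add: simps)
  then show ?thesis using c(1) mem_idempotent_right_ideal_iff[OF e(2)] by (auto simp: simps)
qed

end

context finite_length_ring
begin

text \<open>
  If \<open>x R\<close> and \<open>y R\<close> met trivially, the projection \<open>pr\<close> of \<open>x R + y R\<close> onto \<open>x R\<close> would extend to an
  endomorphism of \<open>e R\<close> that fixes \<open>x\<close> and kills \<open>y\<close>. It would be neither nilpotent nor invertible,
  contrary to Fitting's lemma.
\<close>

lemma injective_uniform:
  assumes e: "primitive_idempotent R e" and inj: "injective_module R (idempotent_module R e)"
    and x: "x \<in> carrier R" "e \<otimes> x = x" "x \<noteq> \<zero>" and y: "y \<in> carrier R" "e \<otimes> y = y" "y \<noteq> \<zero>"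
  shows "\<exists>z. z \<noteq> \<zero> \<and> z \<in> x <# carrier R \<and> z \<in> y <# carrier R"
proof (rule ccontr)
  assume "\<not> ?thesis"
  then have disj: "z = \<zero>" if "z \<in> x <# carrier R" "z \<in> y <# carrier R" for z using that by blast
  have id: "idempotent_elt R e" using e by (simp add: primitive_idempotent_def)
  then have eR: "e \<in> carrier R" "e \<otimes> e = e" by (auto simp: idempotent_elt_def)
  note I = right_ideal_principal[OF x(1)] and J = right_ideal_principal[OF y(1)]
  let ?I = "x <# carrier R" and ?J = "y <# carrier R"
  let ?S = "{p \<oplus> q |p q. p \<in> ?I \<and> q \<in> ?J}"
  have S: "right_ideal R ?S" by (rule right_ideal_sum[OF I J])
  note IR = subsetD[OF right_idealD(1)[OF I]] and JR = subsetD[OF right_idealD(1)[OF J]]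
  define pr where "pr z = (SOME p. p \<in> ?I \<and> (\<exists>q \<in> ?J. z = p \<oplus> q))" for z
  have pr: "pr (p \<oplus> q) = p" if pq: "p \<in> ?I" "q \<in> ?J" for p q
  proof -
    have "\<exists>p'. p' \<in> ?I \<and> (\<exists>q' \<in> ?J. p \<oplus> q = p' \<oplus> q')" using pq by blast
    then have "pr (p \<oplus> q) \<in> ?I \<and> (\<exists>q' \<in> ?J. p \<oplus> q = pr (p \<oplus> q) \<oplus> q')" unfolding pr_def by (rule someI_ex)
    then obtain p' q' where *: "pr (p \<oplus> q) = p'" "p' \<in> ?I" "q' \<in> ?J" "p \<oplus> q = p' \<oplus> q'" by blast
    have R: "p \<in> carrier R" "q \<in> carrier R" "p' \<in> carrier R" "q' \<in> carrier R" using pq * IR JR by auto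
    have "p = (p \<oplus> q) \<ominus> q" using R by (simp add: minus_eq a_assoc r_neg)
    also have "\<dots> = p' \<oplus> (q' \<ominus> q)" unfolding *(4) using R by (simp add: minus_eq a_assoc)
    finally have eq: "p \<ominus> p' = q' \<ominus> q" using add_diff_cancel[of p' "q' \<ominus> q"] R by simp
    have "p \<ominus> p' \<in> ?I" using right_idealD(3)[OF I] right_ideal_minus[OF I] pq * by (simp add: minus_eq)
    moreover have "q' \<ominus> q \<in> ?J" using right_idealD(3)[OF J] right_ideal_minus[OF J] pq * by (simp add: minus_eq)
    ultimately have "p \<ominus> p' = \<zero>" using eq disj by metis
    then show ?thesis using R * by simp
  qed
  have ex: "\<exists>p q. p \<in> ?I \<and> q \<in> ?J \<and> z = p \<oplus> q" if "z \<in> ?S" for z using that by blast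
  have hom: "pr \<in> rmod_hom R (ideal_module R ?S) (idempotent_module R e)"
  proof (rule rmod_homI)
    fix z assume "z \<in> carrier (ideal_module R ?S)"
    then have "z \<in> ?S" by (simp only: sub_module_simps)
    then obtain p q where z: "p \<in> ?I" "q \<in> ?J" "z = p \<oplus> q" using ex[of z] by blast
    have "e \<otimes> p = p" using z(1) x eR by (auto simp: mem_l_coset_iff m_assoc[symmetric])
    then show "pr z \<in> carrier (idempotent_module R e)"
      using pr[OF z(1,2)] z IR by (simp add: idempotent_module_def sub_module_simps mem_idempotent_right_ideal_iff[OF id])
    show "pr (z \<oplus>\<^bsub>ideal_module R ?S\<^esub> w) = pr z \<oplus>\<^bsub>idempotent_module R e\<^esub> pr w"
      if "w \<in> carrier (ideal_module R ?S)" for w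
    proof -
      have "w \<in> ?S" using that by (simp only: sub_module_simps)
      then obtain p' q' where w: "p' \<in> ?I" "q' \<in> ?J" "w = p' \<oplus> q'" using ex[of w] by blast
      have "z \<oplus> w = (p \<oplus> p') \<oplus> (q \<oplus> q')" using z w IR JR by (simp add: a_ac)
      then have "pr (z \<oplus> w) = p \<oplus> p'"
        using pr[of "p \<oplus> p'" "q \<oplus> q'"] right_idealD(3)[OF I z(1) w(1)] right_idealD(3)[OF J z(2) w(2)] by simp
      then show ?thesis using pr[OF z(1,2)] pr[OF w(1,2)] z w
        by (simp add: idempotent_module_def sub_module_simps regular_module_simps)
    qed
    show "pr (s \<odot>\<^bsub>ideal_module R ?S\<^esub> z) = s \<odot>\<^bsub>idempotent_module R e\<^esub> pr z" if s: "s \<in> carrier R" for s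
    proof -
      have "z \<otimes> s = p \<otimes> s \<oplus> q \<otimes> s" using z s IR JR by (simp add: l_distr)
      then have "pr (z \<otimes> s) = p \<otimes> s"
        using pr[of "p \<otimes> s" "q \<otimes> s"] right_idealD(4)[OF I z(1) s] right_idealD(4)[OF J z(2) s] by simp
      then show ?thesis using pr[OF z(1,2)] z
        by (simp add: idempotent_module_def sub_module_simps regular_module_simps)
    qed
  qed
  have xI: "x \<in> ?I" and yJ: "y \<in> ?J" using principal_self x y by auto
  have x0: "x \<oplus> \<zero> = x" and y0: "\<zero> \<oplus> y = y" using x y by auto
  have gen: "?S \<subseteq> L" if L: "right_ideal R L" "{x, y} \<subseteq> L" for L
    using principal_subset_right_ideal[OF L(1), of x] principal_subset_right_ideal[OF L(1), of y] L(2)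
      right_idealD(3)[OF L(1)] by blast
  have xS: "x \<in> ?S" using xI right_idealD(2)[OF J] x0 by (metis (mono_tags, lifting) mem_Collect_eq)
  have yS: "y \<in> ?S" using yJ right_idealD(2)[OF I] y0 by (metis (mono_tags, lifting) mem_Collect_eq)
  obtain c where c: "c \<in> carrier (idempotent_module R e)" "\<forall>z \<in> ?S. pr z = z \<odot>\<^bsub>idempotent_module R e\<^esub> c"
    using injective_extension[OF inj S, of "{x, y}" pr] xS yS gen hom by blast
  have cR: "c \<in> carrier R" "e \<otimes> c = c"
    using c(1) by (auto simp: idempotent_module_def sub_module_simps mem_idempotent_right_ideal_iff[OF id])
  have cx: "c \<otimes> x = x"
    using bspec[OF c(2) xS] pr[OF xI right_idealD(2)[OF J]] x0
    by (simp add: idempotent_module_def sub_module_simps regular_module_simps)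
  have cy: "c \<otimes> y = \<zero>"
    using bspec[OF c(2) yS] pr[OF right_idealD(2)[OF I] yJ] y0
    by (simp add: idempotent_module_def sub_module_simps regular_module_simps)
  define d where "d = c \<otimes> e"
  have d: "d \<in> corner R e e" using cR eR by (auto simp: corner_def d_def m_assoc) (simp add: m_assoc[symmetric])
  have dx: "d \<otimes> x = x" and dy: "d \<otimes> y = \<zero>" using cx cy cR eR x y by (simp_all add: d_def m_assoc)
  have dR: "d \<in> carrier R" using cornerD[OF d] by blast
  have pw: "d [^] (k :: nat) \<otimes> x = x" for k
    by (induction k) (use dx dR x in \<open>auto simp: m_assoc\<close>)
  from fitting[OF e d] show False
  proof
    assume "\<exists>k. d [^] Suc k = \<zero>"
    then obtain k where "d [^] Suc k = \<zero>" by blast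
    then show False using pw[of "Suc k"] x by simp
  next
    assume "\<exists>u \<in> corner R e e. d \<otimes> u = e \<and> u \<otimes> d = e"
    then obtain u where u: "u \<in> carrier R" "u \<otimes> d = e" by (auto simp: corner_def)
    have "y = u \<otimes> d \<otimes> y" using u y by simp
    also have "\<dots> = \<zero>" using u(1) dR y(1) dy by (simp add: m_assoc)
    finally show False using y by simp
  qed
qed

text \<open>
  The module \<open>x R\<close> is a copy of the local module \<open>f R\<close>: a proper submodule contains no \<open>x u\<close> with \<open>u\<close>
  outside the radical, so the right-hand side is the only maximal submodule.
\<close>

lemma module_radical_principal:
  assumes f: "primitive_idempotent R f" and x: "x \<in> carrier R" "x \<otimes> f = x" "monic R f x"
  shows "module_radical R (ideal_module R (x <# carrier R))
       = {x \<otimes> u |u. u \<in> ring_radical R \<and> f \<otimes> u = u}" (is "_ = ?L")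
proof -
  have id: "idempotent_elt R f" using f by (simp add: primitive_idempotent_def)
  then have fR: "f \<in> carrier R" "f \<otimes> f = f" by (auto simp: idempotent_elt_def)
  note I = right_ideal_principal[OF x(1)]
  let ?I = "x <# carrier R"
  note JR = subsetD[OF right_idealD(1)[OF right_ideal_radical]]
  have L: "right_ideal R ?L"
    unfolding right_ideal_def
  proof (intro conjI ballI)
    show "?L \<subseteq> carrier R" using x JR by auto
    have "\<zero> = x \<otimes> \<zero>" "f \<otimes> \<zero> = \<zero>" using x fR by auto
    then show "\<zero> \<in> ?L" using right_idealD(2)[OF right_ideal_radical] by blast
  next
    fix y z assume "y \<in> ?L" "z \<in> ?L"
    then obtain u v where *: "y = x \<otimes> u" "z = x \<otimes> v" "u \<in> ring_radical R" "v \<in> ring_radical R" "f \<otimes> u = u" "f \<otimes> v = v"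
      by blast
    then have "y \<oplus> z = x \<otimes> (u \<oplus> v)" "f \<otimes> (u \<oplus> v) = u \<oplus> v" using x fR JR by (auto simp: r_distr)
    then show "y \<oplus> z \<in> ?L" using * right_idealD(3)[OF right_ideal_radical] by blast
  next
    fix y r assume r: "r \<in> carrier R" and "y \<in> ?L"
    then obtain u where *: "y = x \<otimes> u" "u \<in> ring_radical R" "f \<otimes> u = u" by blast
    then have "y \<otimes> r = x \<otimes> (u \<otimes> r)" "f \<otimes> (u \<otimes> r) = u \<otimes> r" using x fR JR r by (auto simp: m_assoc[symmetric]) 
    then show "y \<otimes> r \<in> ?L" using * r right_idealD(4)[OF right_ideal_radical] by blast
  qed
  have LI: "?L \<subseteq> ?I" using JR unfolding subset_iff mem_l_coset_iff by blast
  have fJ: "f \<notin> ring_radical R" using radical_primitive_iff[OF f fR] fR by blast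
  have xL: "x \<notin> ?L"
  proof
    assume "x \<in> ?L"
    then obtain u where u: "x = x \<otimes> u" "u \<in> ring_radical R" "f \<otimes> u = u" by blast
    have "f = u" by (rule monic_cancel[OF x(3,1) fR(1) fR]) (use u x JR in auto)
    then show False using fJ u by simp
  qed
  have proper: "N \<subseteq> ?L" if N: "right_ideal R N" "N \<subseteq> ?I" "N \<noteq> ?I" for N
  proof
    fix y assume y: "y \<in> N"
    then have "y \<in> ?I" using N(2) by blast
    then obtain u0 where u0: "u0 \<in> carrier R" "y = x \<otimes> u0" by (auto simp: mem_l_coset_iff)
    define u where "u = f \<otimes> u0"
    have u: "u \<in> carrier R" "f \<otimes> u = u" "y = x \<otimes> u"
      using u0 x fR by (simp_all add: u_def m_assoc[symmetric])
    have "u \<in> ring_radical R"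
    proof (rule ccontr)
      assume "u \<notin> ring_radical R"
      then obtain v where v: "v \<in> carrier R" "u \<otimes> v = f" using radical_primitive_iff[OF f u(1,2)] by blast
      have "y \<otimes> v = x" using u v x by (simp add: m_assoc)
      then have "x \<in> N" using right_idealD(4)[OF N(1) y v(1)] by simp
      then show False using principal_subset_right_ideal[OF N(1)] N(2,3) by blast
    qed
    then show "y \<in> ?L" using u by blast
  qed
  have greatest: "maximal_submodule N R (ideal_module R ?I) \<longleftrightarrow> N = L"
    if L: "right_ideal R L" "L \<subseteq> ?I" "x \<notin> L"
      and proper: "\<And>N. right_ideal R N \<Longrightarrow> N \<subseteq> ?I \<Longrightarrow> N \<noteq> ?I \<Longrightarrow> N \<subseteq> L" for N L
  proof -
    have LI: "L \<noteq> ?I" using L(3) principal_self[OF x(1)] by blast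
    show ?thesis
      unfolding maximal_submodule_def submodule_ideal_module_iff[OF I] sub_module_simps
      using L(1,2) LI proper by (metis subset_antisym)
  qed
  have "{N. maximal_submodule N R (ideal_module R ?I)} = {?L}"
    using greatest[OF L LI xL proper] by blast
  then show ?thesis using LI by (simp add: module_radical_def sub_module_simps Int_absorb1)
qed

end

section \<open>The radical layers of the injective right ideals\<close>

locale left_harada =
  fixes K :: "('k, 'x) ring_scheme" and R :: "('k, 'r) module" (structure)
    and m :: nat and n :: "nat \<Rightarrow> nat" and e :: "nat \<Rightarrow> nat \<Rightarrow> 'r"
  assumes left_harada: "left_harada_algebra K R" and arrangement: "harada_arrangement R m n e"

sublocale left_harada \<subseteq> finite_length_ring R
  using left_harada fd_algebra_finite_length
  by (auto simp: left_harada_algebra_def basic_algebra_def)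

context left_harada
begin

definition prims :: "'r set" where
  "prims = (\<lambda>(i, j). e i j) ` harada_index m n"

lemma complete: "complete_primitive_idempotents R prims"
  using arrangement by (simp add: harada_arrangement_def prims_def)

lemma prims_iff: "f \<in> prims \<longleftrightarrow> (\<exists>i j. (i, j) \<in> harada_index m n \<and> f = e i j)"
  by (auto simp: prims_def)

lemma index_iff: "(i, j) \<in> harada_index m n \<longleftrightarrow> 1 \<le> i \<and> i \<le> m \<and> 1 \<le> j \<and> j \<le> n i"
  by (auto simp: harada_index_def)

lemma index_le: "\<lbrakk>(i, j) \<in> harada_index m n; 1 \<le> k; k \<le> j\<rbrakk> \<Longrightarrow> (i, k) \<in> harada_index m n"
  by (auto simp: index_iff)

lemma index_first: "(i, j) \<in> harada_index m n \<Longrightarrow> (i, 1) \<in> harada_index m n"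
  by (auto simp: index_iff)

lemma index_last: "(i, j) \<in> harada_index m n \<Longrightarrow> (i, n i) \<in> harada_index m n"
  by (auto simp: index_iff)

lemma e_primitive: "(i, j) \<in> harada_index m n \<Longrightarrow> primitive_idempotent R (e i j)"
  using complete by (auto simp: complete_primitive_idempotents_def prims_def)

lemma e_idempotent: "(i, j) \<in> harada_index m n \<Longrightarrow> idempotent_elt R (e i j)"
  using e_primitive by (simp add: primitive_idempotent_def)

lemma e_simps:
  assumes "(i, j) \<in> harada_index m n"
  shows "e i j \<in> carrier R" "e i j \<otimes> e i j = e i j" "e i j \<noteq> \<zero>"
  using e_primitive[OF assms] by (auto simp: primitive_idempotent_def idempotent_elt_def)

lemma e_injective: "(i, 1) \<in> harada_index m n \<Longrightarrow> injective_module R (idempotent_module R (e i 1))"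
  using arrangement by (simp add: harada_arrangement_def index_iff)

text \<open>
  The algebra is basic, and \<open>x\<close> and \<open>y\<close> give mutually inverse isomorphisms of \<open>e k l R\<close> and \<open>e i j R\<close>.
\<close>

lemma e_isomorphic_eq:
  assumes ij: "(i, j) \<in> harada_index m n" and kl: "(k, l) \<in> harada_index m n"
    and x: "x \<in> corner R (e i j) (e k l)" and y: "y \<in> corner R (e k l) (e i j)"
    and xy: "x \<otimes> y = e i j" and yx: "y \<otimes> x = e k l"
  shows "i = k \<and> j = l"
proof -
  note c = cornerD[OF x] cornerD[OF y]
  have mem: "u \<in> carrier (idempotent_module R (e i j)) \<longleftrightarrow> u \<in> carrier R \<and> e i j \<otimes> u = u"
    if "(i, j) \<in> harada_index m n" for u i j
    using mem_idempotent_right_ideal_iff[OF e_idempotent[OF that]] by (simp add: idempotent_module_def sub_module_simps)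
  have "rmod_iso R (idempotent_module R (e k l)) (idempotent_module R (e i j))"
    unfolding rmod_iso_def
  proof (intro bexI)
    show hom: "(\<lambda>u. x \<otimes> u) \<in> rmod_hom R (idempotent_module R (e k l)) (idempotent_module R (e i j))"
    proof (rule rmod_homI)
      fix u assume u: "u \<in> carrier (idempotent_module R (e k l))"
      show "x \<otimes> u \<in> carrier (idempotent_module R (e i j))"
        using u c(1,2) e_simps[OF ij] by (simp add: mem[OF ij] mem[OF kl] m_assoc[symmetric])
      show "x \<otimes> (r \<odot>\<^bsub>idempotent_module R (e k l)\<^esub> u) = r \<odot>\<^bsub>idempotent_module R (e i j)\<^esub> (x \<otimes> u)"
        if "r \<in> carrier R" for r
        using u c(1) that
        by (simp add: mem[OF kl]) (simp add: idempotent_module_def sub_module_simps regular_module_simps m_assoc)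
      show "x \<otimes> (u \<oplus>\<^bsub>idempotent_module R (e k l)\<^esub> v) = x \<otimes> u \<oplus>\<^bsub>idempotent_module R (e i j)\<^esub> x \<otimes> v"
        if "v \<in> carrier (idempotent_module R (e k l))" for v
        using u c(1) that
        by (simp add: mem[OF kl]) (simp add: idempotent_module_def sub_module_simps regular_module_simps r_distr)
    qed
    show "bij_betw (\<lambda>u. x \<otimes> u) (carrier (idempotent_module R (e k l))) (carrier (idempotent_module R (e i j)))"
    proof (rule bij_betw_byWitness[where f' = "\<lambda>u. y \<otimes> u"])
      show "\<forall>u \<in> carrier (idempotent_module R (e k l)). y \<otimes> (x \<otimes> u) = u"
        using c yx by (auto simp: mem[OF kl] m_assoc[symmetric])
      show "\<forall>u \<in> carrier (idempotent_module R (e i j)). x \<otimes> (y \<otimes> u) = u"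
        using c xy by (auto simp: mem[OF ij] m_assoc[symmetric])
      show "(\<lambda>u. x \<otimes> u) ` carrier (idempotent_module R (e k l)) \<subseteq> carrier (idempotent_module R (e i j))"
        using rmod_homD(1)[OF hom] by blast
      show "(\<lambda>u. y \<otimes> u) ` carrier (idempotent_module R (e i j)) \<subseteq> carrier (idempotent_module R (e k l))"
        using c e_simps[OF kl] by (auto simp: mem[OF ij] mem[OF kl] m_assoc[symmetric])
    qed
  qed
  moreover have "e i j \<in> prims" "e k l \<in> prims" using ij kl by (auto simp: prims_iff)
  ultimately have "e k l = e i j"
    using left_harada complete unfolding left_harada_algebra_def basic_algebra_def by metis
  moreover have "inj_on (\<lambda>(i, j). e i j) (harada_index m n)" using arrangement by (simp add: harada_arrangement_def)
  ultimately have "(k, l) = (i, j)" using inj_onD[of "\<lambda>(i, j). e i j" _ "(k, l)" "(i, j)"] ij kl by simp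
  then show ?thesis by simp
qed

text \<open>
  The element \<open>b\<close> is the image of \<open>e i (j + 1)\<close> under the isomorphism
  \<open>e i (j + 1) R \<cong> e i j J\<close> of the arrangement.
\<close>

lemma next_generator:
  assumes "(i, Suc j) \<in> harada_index m n" and j: "1 \<le> j"
  shows "\<exists>b \<in> corner R (e i j) (e i (Suc j)). monic R (e i (Suc j)) b \<and> b \<in> ring_radical R \<and>
     (\<forall>w \<in> ring_radical R. e i j \<otimes> w = w \<longrightarrow> (\<exists>u \<in> carrier R. w = b \<otimes> u))"
proof -
  let ?f = "e i (Suc j)" and ?J = "e i j <# ring_radical R"
  have ij: "(i, j) \<in> harada_index m n" by (rule index_le[OF assms(1) j]) simp
  note e = e_simps[OF ij] and f = e_simps[OF assms(1)]
  note JR = subsetD[OF right_idealD(1)[OF right_ideal_radical]]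
  have "rmod_iso R (idempotent_module R ?f) (ideal_module R (e i (Suc j - 1) <# ring_radical R))"
  proof -
    have "i \<in> {1..m}" "Suc j \<in> {2..n i}" using assms by (auto simp: index_iff)
    then show ?thesis using arrangement unfolding harada_arrangement_def by blast
  qed
  then obtain h where h: "h \<in> rmod_hom R (idempotent_module R ?f) (ideal_module R ?J)"
    and bij: "bij_betw h (carrier (idempotent_module R ?f)) (carrier (ideal_module R ?J))"
    by (auto simp: rmod_iso_def)
  have mem: "u \<in> carrier (idempotent_module R ?f) \<longleftrightarrow> u \<in> carrier R \<and> ?f \<otimes> u = u" for u
    using mem_idempotent_right_ideal_iff[OF e_idempotent[OF assms(1)]] by (simp add: idempotent_module_def sub_module_simps)
  define b where "b = h ?f"
  have hu: "h u = b \<otimes> u" if "u \<in> carrier R" "?f \<otimes> u = u" for u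
    using rmod_homD(3)[OF h, of u ?f] that f
    by (simp add: mem) (simp add: b_def idempotent_module_def sub_module_simps regular_module_simps)
  have "b \<in> ?J" using rmod_homD(1)[OF h, of ?f] f by (simp add: mem b_def) (simp add: sub_module_simps)
  then obtain w where w: "w \<in> ring_radical R" "b = e i j \<otimes> w" by (auto simp: mem_l_coset_iff)
  have bR: "b \<in> carrier R" using w JR e by simp
  have "e i j \<otimes> b = b" using w JR e by (simp add: m_assoc[symmetric])
  moreover have "b \<otimes> ?f = b" using hu[of ?f] f by (simp add: b_def)
  ultimately have "b \<in> corner R (e i j) ?f" using bR by (simp add: corner_def)
  moreover have "monic R ?f b"
    unfolding monic_def
  proof (intro ballI impI)
    fix u assume u: "u \<in> carrier R" "?f \<otimes> u = u \<and> b \<otimes> u = \<zero>"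
    then have "h u = h \<zero>" using hu f bR by simp
    then show "u = \<zero>" using bij u f by (auto simp: bij_betw_def mem dest: inj_onD)
  qed
  moreover have "b \<in> ring_radical R" unfolding w(2) using radical_left_ideal[OF w(1) e(1)] .
  moreover have "\<exists>u \<in> carrier R. v = b \<otimes> u" if v: "v \<in> ring_radical R" "e i j \<otimes> v = v" for v
  proof -
    have "v \<in> ?J" using v by (auto simp: mem_l_coset_iff intro!: bexI[of _ v])
    then have "v \<in> h ` carrier (idempotent_module R ?f)" using bij by (simp add: bij_betw_def sub_module_simps)
    then show ?thesis using hu by (auto simp: mem)
  qed
  ultimately show ?thesis by blast
qed

abbreviation P :: "nat \<Rightarrow> nat \<Rightarrow> 'r set" where "P \<equiv> harada_proj R e"

text \<open>
  Multiply the generators of the previous lemma along the chain. The radical of a copy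
  \<open>a R\<close> of \<open>e i j R\<close> is \<open>a (e i j J) = a b R\<close>, which is a copy of \<open>e i (j + 1) R\<close>.
\<close>

lemma P_generator:
  "(i, j) \<in> harada_index m n \<Longrightarrow>
     \<exists>a \<in> corner R (e i 1) (e i j). monic R (e i j) a \<and> P i j = a <# carrier R"
proof (induction j)
  case 0
  then show ?case by (simp add: index_iff)
next
  case (Suc j)
  show ?case
  proof (cases "j = 0")
    case True
    have "e i 1 \<in> corner R (e i 1) (e i 1)" "monic R (e i 1) (e i 1)"
      using Suc.prems True e_simps[of i 1] by (auto simp: corner_def monic_def)
    then show ?thesis using True
      by (auto simp: harada_proj_def idempotent_module_def sub_module_simps intro!: bexI[of _ "e i 1"])
  next
    case False
    have ij: "(i, j) \<in> harada_index m n" by (rule index_le[OF Suc.prems]) (use False in auto)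
    obtain a where a: "a \<in> corner R (e i 1) (e i j)" "monic R (e i j) a" "P i j = a <# carrier R"
      using Suc.IH[OF ij] by blast
    obtain b where b: "b \<in> corner R (e i j) (e i (Suc j))" "monic R (e i (Suc j)) b" "b \<in> ring_radical R"
      "\<And>w. w \<in> ring_radical R \<Longrightarrow> e i j \<otimes> w = w \<Longrightarrow> \<exists>u \<in> carrier R. w = b \<otimes> u"
      using next_generator[OF Suc.prems] False by auto
    note ca = cornerD[OF a(1)] and cb = cornerD[OF b(1)]
    note e = e_simps[OF ij] e_simps[OF Suc.prems] e_simps[OF index_first[OF ij]]
    have step: "P i (Suc j) = module_radical R (ideal_module R (P i j))"
    proof -
      obtain j' where j': "j = Suc j'" using False by (cases j) auto
      then show ?thesis by (simp add: harada_proj_def idempotent_module_def sub_module_def)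
    qed
    have "P i (Suc j) = {a \<otimes> u |u. u \<in> ring_radical R \<and> e i j \<otimes> u = u}"
      unfolding step a(3) by (rule module_radical_principal[OF e_primitive[OF ij] ca(1,3) a(2)])
    also have "\<dots> = (a \<otimes> b) <# carrier R"
    proof (intro equalityI subsetI)
      fix y assume "y \<in> {a \<otimes> u |u. u \<in> ring_radical R \<and> e i j \<otimes> u = u}"
      then obtain u where u: "y = a \<otimes> u" "u \<in> ring_radical R" "e i j \<otimes> u = u" by blast
      obtain v where "v \<in> carrier R" "u = b \<otimes> v" using b(4)[OF u(2,3)] by blast
      then show "y \<in> (a \<otimes> b) <# carrier R" using u ca cb by (auto simp: mem_l_coset_iff m_assoc)
    next
      fix y assume "y \<in> (a \<otimes> b) <# carrier R"
      then obtain v where v: "v \<in> carrier R" "y = a \<otimes> (b \<otimes> v)" using ca cb by (auto simp: mem_l_coset_iff m_assoc)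
      moreover have "b \<otimes> v \<in> ring_radical R" by (rule right_idealD(4)[OF right_ideal_radical b(3) v(1)])
      moreover have "e i j \<otimes> (b \<otimes> v) = b \<otimes> v" using v cb e by (simp add: m_assoc[symmetric])
      ultimately show "y \<in> {a \<otimes> u |u. u \<in> ring_radical R \<and> e i j \<otimes> u = u}" by blast
    qed
    finally have "P i (Suc j) = (a \<otimes> b) <# carrier R" .
    moreover have "a \<otimes> b \<in> corner R (e i 1) (e i (Suc j))" using corner_mult[OF a(1) b(1)] e by simp
    moreover have "monic R (e i (Suc j)) (a \<otimes> b)"
      unfolding monic_def
    proof (intro ballI impI)
      fix u assume u: "u \<in> carrier R" "e i (Suc j) \<otimes> u = u \<and> a \<otimes> b \<otimes> u = \<zero>"
      have "a \<otimes> (b \<otimes> u) = \<zero>" using u ca cb by (simp add: m_assoc)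
      moreover have "e i j \<otimes> (b \<otimes> u) = b \<otimes> u" using u cb e by (simp add: m_assoc[symmetric])
      ultimately have "b \<otimes> u = \<zero>" using monicD[OF a(2)] u cb by simp
      then show "u = \<zero>" using monicD[OF b(2)] u by blast
    qed
    ultimately show ?thesis by blast
  qed
qed

text \<open>
  A fixed generator of \<open>P i j\<close>. Left multiplication by it is an isomorphism from \<open>e i j R\<close> to \<open>P i j\<close>,
  through which matrices with entries in the \<open>e i j R e k l\<close> act on the layers.
\<close>

definition a :: "nat \<Rightarrow> nat \<Rightarrow> 'r" where
  "a i j = (SOME a. a \<in> corner R (e i 1) (e i j) \<and> monic R (e i j) a \<and> P i j = a <# carrier R)"

lemma a_props:
  assumes "(i, j) \<in> harada_index m n"
  shows "a i j \<in> corner R (e i 1) (e i j)" "monic R (e i j) (a i j)" "P i j = a i j <# carrier R"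
    "a i j \<in> carrier R" "e i 1 \<otimes> a i j = a i j" "a i j \<otimes> e i j = a i j" "a i j \<noteq> \<zero>"
proof -
  have "\<exists>x. x \<in> corner R (e i 1) (e i j) \<and> monic R (e i j) x \<and> P i j = x <# carrier R"
    using P_generator[OF assms] by blast
  then have *: "a i j \<in> corner R (e i 1) (e i j) \<and> monic R (e i j) (a i j) \<and> P i j = a i j <# carrier R"
    unfolding a_def by (rule someI_ex)
  then show "a i j \<in> corner R (e i 1) (e i j)" "monic R (e i j) (a i j)" "P i j = a i j <# carrier R" by auto
  with cornerD[OF this(1)] show "a i j \<in> carrier R" "e i 1 \<otimes> a i j = a i j" "a i j \<otimes> e i j = a i j" by auto
  show "a i j \<noteq> \<zero>"
    using * e_simps[OF assms] by (auto simp: monic_def)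
qed

lemma a_monic:
  assumes "(i, j) \<in> harada_index m n" "u \<in> carrier R" "e i j \<otimes> u = u" "v \<in> carrier R" "e i j \<otimes> v = v"
    "a i j \<otimes> u = a i j \<otimes> v"
  shows "u = v"
  using monic_cancel[OF a_props(2,4)[OF assms(1)] e_simps(1)[OF assms(1)]] assms by blast

lemma mem_P_iff:
  assumes ij: "(i, j) \<in> harada_index m n"
  shows "y \<in> P i j \<longleftrightarrow> (\<exists>u \<in> carrier R. e i j \<otimes> u = u \<and> y = a i j \<otimes> u)"
proof
  assume "y \<in> P i j"
  then obtain u where u: "u \<in> carrier R" "y = a i j \<otimes> u" using a_props(3)[OF ij] by (auto simp: mem_l_coset_iff)
  then have "y = a i j \<otimes> (e i j \<otimes> u)" "e i j \<otimes> (e i j \<otimes> u) = e i j \<otimes> u" "e i j \<otimes> u \<in> carrier R"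
    using a_props[OF ij] e_simps[OF ij] by (simp_all add: m_assoc[symmetric])
  then show "\<exists>u \<in> carrier R. e i j \<otimes> u = u \<and> y = a i j \<otimes> u" by blast
qed (use a_props(3)[OF ij] in \<open>auto simp: mem_l_coset_iff\<close>)

lemma right_ideal_P: "(i, j) \<in> harada_index m n \<Longrightarrow> right_ideal R (P i j)"
  using a_props(3,4) right_ideal_principal by simp

lemma a_in_P: "(i, j) \<in> harada_index m n \<Longrightarrow> a i j \<in> P i j"
  using a_props(3,4) principal_self by simp

text \<open>
  \<open>P i (j + 1)\<close> is the unique maximal submodule of the cyclic module \<open>P i j\<close>, so it consists of the
  elements that do not generate. This description of the layers is visibly invariant under
  automorphisms.
\<close>

lemma P_Suc_iff:
  assumes ij: "(i, Suc j) \<in> harada_index m n" and j: "1 \<le> j" and y: "y \<in> P i j"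
  shows "y \<in> P i (Suc j) \<longleftrightarrow> a i j \<notin> y <# carrier R"
proof -
  have ij': "(i, j) \<in> harada_index m n" by (rule index_le[OF ij j]) simp
  note a = a_props[OF ij'] and e = e_simps[OF ij']
  have step: "P i (Suc j) = module_radical R (ideal_module R (P i j))"
  proof -
    obtain j' where j': "j = Suc j'" using j by (cases j) auto
    then show ?thesis by (simp add: harada_proj_def idempotent_module_def sub_module_def)
  qed
  have rad: "P i (Suc j) = {a i j \<otimes> u |u. u \<in> ring_radical R \<and> e i j \<otimes> u = u}"
    unfolding step a(3) by (rule module_radical_principal[OF e_primitive[OF ij'] a(4,6,2)])
  obtain u where u: "u \<in> carrier R" "e i j \<otimes> u = u" "y = a i j \<otimes> u" using y mem_P_iff[OF ij'] by blast
  note JR = subsetD[OF right_idealD(1)[OF right_ideal_radical]]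
  have "y \<in> P i (Suc j) \<longleftrightarrow> u \<in> ring_radical R"
  proof
    assume "y \<in> P i (Suc j)"
    then obtain v where v: "y = a i j \<otimes> v" "v \<in> ring_radical R" "e i j \<otimes> v = v" unfolding rad by blast
    have "u = v" by (rule a_monic[OF ij' u(1,2)]) (use u v JR in auto)
    then show "u \<in> ring_radical R" using v by simp
  next
    assume "u \<in> ring_radical R"
    then show "y \<in> P i (Suc j)" unfolding rad using u by blast
  qed
  also have "\<dots> \<longleftrightarrow> \<not> (\<exists>v \<in> carrier R. u \<otimes> v = e i j)"
    by (rule radical_primitive_iff[OF e_primitive[OF ij'] u(1,2)])
  also have "(\<exists>v \<in> carrier R. u \<otimes> v = e i j) \<longleftrightarrow> a i j \<in> y <# carrier R"
  proof
    assume "\<exists>v \<in> carrier R. u \<otimes> v = e i j"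
    then obtain v where v: "v \<in> carrier R" "u \<otimes> v = e i j" by blast
    then have "a i j = y \<otimes> v" using u a by (simp add: m_assoc)
    then show "a i j \<in> y <# carrier R" using v by (auto simp: mem_l_coset_iff)
  next
    assume "a i j \<in> y <# carrier R"
    then obtain v where v: "v \<in> carrier R" "a i j = y \<otimes> v" by (auto simp: mem_l_coset_iff)
    have "e i j = u \<otimes> (v \<otimes> e i j)"
    proof (rule a_monic[OF ij'])
      have "a i j \<otimes> (u \<otimes> (v \<otimes> e i j)) = (y \<otimes> v) \<otimes> e i j" using u v(1) a(4) e by (simp add: m_assoc)
      then show "a i j \<otimes> e i j = a i j \<otimes> (u \<otimes> (v \<otimes> e i j))" using v(2) by simp
      have "e i j \<otimes> (u \<otimes> (v \<otimes> e i j)) = (e i j \<otimes> u) \<otimes> (v \<otimes> e i j)" using u(1) v e by (simp add: m_assoc)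
      then show "e i j \<otimes> (u \<otimes> (v \<otimes> e i j)) = u \<otimes> (v \<otimes> e i j)" using u by simp
    qed (use u v e in auto)
    then show "\<exists>v \<in> carrier R. u \<otimes> v = e i j" using v e by (metis m_closed)
  qed
  finally show ?thesis .
qed

lemma P_Suc_subset:
  assumes ij: "(i, Suc j) \<in> harada_index m n" and j: "1 \<le> j"
  shows "P i (Suc j) \<subseteq> P i j"
proof -
  obtain j' where j': "j = Suc j'" using j by (cases j) auto
  then show ?thesis by (auto simp: harada_proj_def module_radical_def sub_module_simps)
qed

lemma P_antimono:
  assumes "(i, l) \<in> harada_index m n" "1 \<le> k" "k \<le> l"
  shows "P i l \<subseteq> P i k"
  using assms(3,1)
proof (induction l rule: dec_induct)
  case (step l)
  have "(i, l) \<in> harada_index m n" by (rule index_le[OF step.prems]) (use step.hyps assms in auto)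
  then show ?case using step P_Suc_subset[OF step.prems] assms(2) by (meson le_trans subset_trans)
qed simp

lemma a_notin_P:
  assumes "(i, l) \<in> harada_index m n" "1 \<le> k" "k < l"
  shows "a i k \<notin> P i l"
proof -
  have ik: "(i, k) \<in> harada_index m n" and ik1: "(i, Suc k) \<in> harada_index m n"
    using index_le[OF assms(1)] assms by auto
  have "a i k \<notin> P i (Suc k)"
    using P_Suc_iff[OF ik1 assms(2) a_in_P[OF ik]] principal_self a_props(4)[OF ik] by blast
  then show ?thesis using P_antimono[OF assms(1), of "Suc k"] assms by auto
qed

text \<open>
  Descend through the chain: the last layer \<open>P i j\<close> that contains \<open>y\<close> is generated by \<open>y\<close>, unless
  \<open>y\<close> is contained in all of them.
\<close>

lemma P_cases:
  assumes i: "(i, 1) \<in> harada_index m n" and y: "y \<in> P i 1"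
  shows "y \<in> P i (n i) \<or> (\<exists>j. (i, j) \<in> harada_index m n \<and> a i j \<in> y <# carrier R \<and> y \<in> P i j)"
proof (rule disjCI)
  assume no: "\<not> (\<exists>j. (i, j) \<in> harada_index m n \<and> a i j \<in> y <# carrier R \<and> y \<in> P i j)"
  have "(i, Suc j) \<in> harada_index m n \<Longrightarrow> y \<in> P i (Suc j)" for j
  proof (induction j)
    case (Suc j)
    have ij: "(i, Suc j) \<in> harada_index m n" by (rule index_le[OF Suc.prems]) auto
    show ?case using P_Suc_iff[OF Suc.prems _ Suc.IH[OF ij]] no ij Suc.IH[OF ij] by auto
  qed (use y in simp)
  from this[of "n i - 1"] show "y \<in> P i (n i)" using i by (auto simp: index_iff)
qed

end

context left_harada
begin

section \<open>Homomorphisms between the layers\<close>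

lemma P1_iff: "(i, 1) \<in> harada_index m n \<Longrightarrow> y \<in> P i 1 \<longleftrightarrow> y \<in> carrier R \<and> e i 1 \<otimes> y = y"
  using mem_idempotent_right_ideal_iff[OF e_idempotent]
  by (simp add: harada_proj_def idempotent_module_def sub_module_simps)

lemma P_carrier: "(i, j) \<in> harada_index m n \<Longrightarrow> y \<in> P i j \<Longrightarrow> y \<in> carrier R"
  using right_idealD(1)[OF right_ideal_P] by blast

text \<open>
  \<open>e i j R\<close> is isomorphic to a submodule of the uniform module \<open>P i 1\<close>.
\<close>

lemma e_uniform:
  assumes ij: "(i, j) \<in> harada_index m n"
    and u: "u \<in> carrier R" "e i j \<otimes> u = u" "u \<noteq> \<zero>" and v: "v \<in> carrier R" "e i j \<otimes> v = v" "v \<noteq> \<zero>"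
  shows "\<exists>s \<in> carrier R. \<exists>t \<in> carrier R. u \<otimes> s = v \<otimes> t \<and> u \<otimes> s \<noteq> \<zero>"
proof -
  note i1 = index_first[OF ij] and a = a_props[OF ij] and eR = e_simps[OF ij]
  have nz: "a i j \<otimes> u \<noteq> \<zero>" "a i j \<otimes> v \<noteq> \<zero>" using monicD[OF a(2)] u v by blast+
  have "e i 1 \<otimes> (a i j \<otimes> u) = a i j \<otimes> u" "e i 1 \<otimes> (a i j \<otimes> v) = a i j \<otimes> v"
    using a e_simps[OF i1] u v by (simp_all add: m_assoc[symmetric])
  then obtain z where z: "z \<noteq> \<zero>" "z \<in> (a i j \<otimes> u) <# carrier R" "z \<in> (a i j \<otimes> v) <# carrier R"
    using injective_uniform[OF e_primitive[OF i1] e_injective[OF i1], of "a i j \<otimes> u" "a i j \<otimes> v"] nz a u v by auto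
  then obtain s t where st: "s \<in> carrier R" "t \<in> carrier R" "z = a i j \<otimes> u \<otimes> s" "z = a i j \<otimes> v \<otimes> t"
    by (auto simp: mem_l_coset_iff)
  have "u \<otimes> s = v \<otimes> t"
    by (rule a_monic[OF ij]) (use st u v a eR in \<open>auto simp: m_assoc[symmetric]\<close>)
  moreover have "u \<otimes> s \<noteq> \<zero>" using z(1) st(1,3) u a by (auto simp: m_assoc)
  ultimately show ?thesis using st by blast
qed

text \<open>
  In a uniform module the intersection of finitely many nonzero submodules is nonzero, in particular
  that of the kernels of the maps \<open>r t\<close>.
\<close>

lemma jointly_monic:
  assumes ij: "(i, j) \<in> harada_index m n" and T: "finite T" and r: "\<And>t. t \<in> T \<Longrightarrow> r t \<in> carrier R"
    and joint: "\<And>u. \<lbrakk>u \<in> carrier R; e i j \<otimes> u = u; \<And>t. t \<in> T \<Longrightarrow> r t \<otimes> u = \<zero>\<rbrakk> \<Longrightarrow> u = \<zero>"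
  shows "\<exists>t \<in> T. monic R (e i j) (r t)"
proof (rule ccontr)
  assume no: "\<not> ?thesis"
  note eR = e_simps[OF ij]
  have "\<exists>u \<in> carrier R. e i j \<otimes> u = u \<and> u \<noteq> \<zero> \<and> (\<forall>t \<in> T. r t \<otimes> u = \<zero>)"
    using T r no
  proof (induction T rule: finite_induct)
    case empty
    show ?case using eR by (intro bexI[of _ "e i j"]) auto
  next
    case (insert b T)
    then obtain u where u: "u \<in> carrier R" "e i j \<otimes> u = u" "u \<noteq> \<zero>" "\<forall>t \<in> T. r t \<otimes> u = \<zero>" by auto
    obtain v where v: "v \<in> carrier R" "e i j \<otimes> v = v" "v \<noteq> \<zero>" "r b \<otimes> v = \<zero>"
      using insert.prems(2) by (auto simp: monic_def)
    obtain s t where st: "s \<in> carrier R" "t \<in> carrier R" "u \<otimes> s = v \<otimes> t" "u \<otimes> s \<noteq> \<zero>"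
      using e_uniform[OF ij u(1-3) v(1-3)] by blast
    have "r c \<otimes> (u \<otimes> s) = \<zero>" if c: "c \<in> insert b T" for c
    proof (cases "c = b")
      case True
      have "r b \<otimes> (v \<otimes> t) = \<zero>" using insert.prems(1)[of b] v st by (simp add: m_assoc[symmetric])
      then show ?thesis using st True by simp
    next
      case False
      then show ?thesis using c insert.prems(1)[of c] u st(1) by (simp add: m_assoc[symmetric])
    qed
    moreover have "e i j \<otimes> (u \<otimes> s) = u \<otimes> s" using u st(1) eR by (simp add: m_assoc[symmetric])
    ultimately show ?case using st(1,4) u(1) by (intro bexI[of _ "u \<otimes> s"]) auto
  qed
  then show False using joint by blast
qed

lemma extend_to_first:
  assumes ij: "(i, j) \<in> harada_index m n" and k: "(k, 1) \<in> harada_index m n"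
    and r: "r \<in> corner R (e k 1) (e i j)"
  shows "\<exists>c \<in> corner R (e k 1) (e i 1). c \<otimes> a i j = r"
proof -
  note a = a_props[OF ij] and cr = cornerD[OF r] and e1 = e_simps[OF index_first[OF ij]] and ek = e_simps[OF k]
  obtain c where c: "c \<in> carrier R" "e k 1 \<otimes> c = c" "c \<otimes> a i j = r"
    using injective_extend_principal[OF ek(1) e_idempotent[OF k] e_injective[OF k] e_simps(1)[OF ij]
        a(4,6,2) e_idempotent[OF ij] cr] by blast
  have "c \<otimes> e i 1 \<in> corner R (e k 1) (e i 1)"
    using c e1 ek by (intro cornerI) (auto simp: m_assoc[symmetric], simp add: m_assoc)
  moreover have "c \<otimes> e i 1 \<otimes> a i j = r" using c e1 a by (simp add: m_assoc)
  ultimately show ?thesis by blast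
qed

text \<open>
  An injective map out of the injective module \<open>P i 1\<close> splits, and \<open>P k 1\<close> is indecomposable.
\<close>

lemma monic_first_invertible:
  assumes i: "(i, 1) \<in> harada_index m n" and k: "(k, 1) \<in> harada_index m n"
    and c: "c \<in> corner R (e k 1) (e i 1)" "monic R (e i 1) c"
  shows "i = k \<and> (\<exists>d \<in> corner R (e i 1) (e i 1). c \<otimes> d = e i 1 \<and> d \<otimes> c = e i 1)"
proof -
  note cc = cornerD[OF c(1)] and ei = e_simps[OF i] and ek = e_simps[OF k]
  obtain d0 where d0: "d0 \<in> carrier R" "e i 1 \<otimes> d0 = d0" "d0 \<otimes> c = e i 1"
    using injective_extend_principal[OF ei(1) e_idempotent[OF i] e_injective[OF i] ei(1)
        cc(1,3) c(2) e_idempotent[OF i] ei(1,2,2)] by blast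
  define d where "d = d0 \<otimes> e k 1"
  have d: "d \<in> corner R (e i 1) (e k 1)"
    unfolding d_def using d0 ei ek by (intro cornerI) (auto simp: m_assoc[symmetric], simp add: m_assoc)
  have dc: "d \<otimes> c = e i 1" using d0 ek cc by (simp add: d_def m_assoc)
  have cd: "c \<otimes> d = e k 1"
    by (rule retract_of_primitive[OF e_idempotent[OF i] ei(3) e_primitive[OF k] d c(1) dc])
  have "i = k" using e_isomorphic_eq[OF i k d c(1) dc cd] by simp
  then show ?thesis using d dc cd by blast
qed

text \<open>
  Here \<open>c\<close> and \<open>d\<close> are inverse automorphisms of \<open>P i 1\<close>. In the induction along the chain, if
  \<open>c y\<close> generates \<open>P i j\<close> then so does \<open>y\<close>; hence \<open>c\<close> maps the non-generators of \<open>P i j\<close> to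
  non-generators, and these form the next layer.
\<close>

lemma unit_preserves_P:
  assumes ij: "(i, j) \<in> harada_index m n"
    and c: "c \<in> corner R (e i 1) (e i 1)" and d: "d \<in> corner R (e i 1) (e i 1)"
    and cd: "c \<otimes> d = e i 1" "d \<otimes> c = e i 1" and y: "y \<in> P i j"
  shows "c \<otimes> y \<in> P i j"
proof -
  note i1 = index_first[OF ij]
  have "\<forall>c d y. c \<in> corner R (e i 1) (e i 1) \<and> d \<in> corner R (e i 1) (e i 1) \<and>
      c \<otimes> d = e i 1 \<and> d \<otimes> c = e i 1 \<and> y \<in> P i j \<longrightarrow> c \<otimes> y \<in> P i j"
    using ij
  proof (induction j)
    case 0
    then show ?case by (simp add: index_iff)
  next
    case (Suc j)
    show ?case
    proof (cases "j = 0")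
      case True
      have "c \<otimes> y \<in> P i 1" if "c \<in> corner R (e i 1) (e i 1)" "y \<in> P i 1" for c y
        using that cornerD[OF that(1)] e_simps[OF i1] unfolding P1_iff[OF i1] by (simp add: m_assoc[symmetric])
      then show ?thesis using True by simp
    next
      case False
      then have j: "1 \<le> j" by simp
      have ij: "(i, j) \<in> harada_index m n" by (rule index_le[OF Suc.prems j]) simp
      note a = a_props[OF ij]
      show ?thesis
      proof (intro allI impI, elim conjE)
        fix c d y
        assume c: "c \<in> corner R (e i 1) (e i 1)" and d: "d \<in> corner R (e i 1) (e i 1)"
          and cd: "c \<otimes> d = e i 1" "d \<otimes> c = e i 1" and y: "y \<in> P i (Suc j)"
        note cR = cornerD(1)[OF c] and dR = cornerD(1)[OF d]
        have yj: "y \<in> P i j" using P_Suc_subset[OF Suc.prems j] y by blast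
        have yR: "y \<in> carrier R" using P_carrier[OF ij yj] .
        have cy: "c \<otimes> y \<in> P i j" and ca: "c \<otimes> a i j \<in> P i j"
          using Suc.IH[OF ij] c d cd yj a_in_P[OF ij] by blast+
        have "a i j \<notin> (c \<otimes> y) <# carrier R"
        proof
          assume "a i j \<in> (c \<otimes> y) <# carrier R"
          then obtain r where r: "r \<in> carrier R" "a i j = c \<otimes> y \<otimes> r" by (auto simp: mem_l_coset_iff)
          have e1y: "e i 1 \<otimes> y = y"
            using yj mem_P_iff[OF ij] a e_simps[OF i1] by (auto simp: m_assoc[symmetric])
          have "d \<otimes> a i j = (d \<otimes> c) \<otimes> y \<otimes> r" unfolding r(2) using r(1) cR dR yR by (simp add: m_assoc)
          then have da: "d \<otimes> a i j = y \<otimes> r" using cd e1y by simp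
          obtain s where s: "s \<in> carrier R" "c \<otimes> a i j = a i j \<otimes> s" using ca mem_P_iff[OF ij] by blast
          have "a i j = d \<otimes> (c \<otimes> a i j)" using cd a cR dR by (simp add: m_assoc[symmetric])
          also have "\<dots> = y \<otimes> (r \<otimes> s)" unfolding s(2) using da s r yR a dR by (simp add: m_assoc[symmetric])
          finally have "a i j \<in> y <# carrier R" using r s by (auto simp: mem_l_coset_iff)
          then show False using P_Suc_iff[OF Suc.prems j yj] y by blast
        qed
        then show "c \<otimes> y \<in> P i (Suc j)" using P_Suc_iff[OF Suc.prems j cy] by blast
      qed
    qed
  qed
  then show ?thesis using c d cd y by blast
qed

text \<open>
  The kernel of \<open>c\<close> would meet the image \<open>P i l\<close> of \<open>a i l\<close> in the uniform module \<open>P i 1\<close>, but on this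
  image \<open>c\<close> is injective because \<open>r\<close> and \<open>a k j\<close> are.
\<close>

lemma lift_monic:
  assumes il: "(i, l) \<in> harada_index m n" and kj: "(k, j) \<in> harada_index m n"
    and r: "r \<in> corner R (e k j) (e i l)" and c: "c \<in> corner R (e k 1) (e i 1)"
    and lift: "c \<otimes> a i l = a k j \<otimes> r" and mon: "monic R (e i l) r"
  shows "monic R (e i 1) c"
  unfolding monic_def
proof (intro ballI impI, rule ccontr)
  note i1 = index_first[OF il] and a = a_props[OF il] and b = a_props[OF kj]
    and cr = cornerD[OF r] and cc = cornerD[OF c]
  fix u assume u: "u \<in> carrier R" "e i 1 \<otimes> u = u \<and> c \<otimes> u = \<zero>" and "u \<noteq> \<zero>"
  then obtain s t where st: "s \<in> carrier R" "t \<in> carrier R" "u \<otimes> s = a i l \<otimes> t" "u \<otimes> s \<noteq> \<zero>"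
    using e_uniform[OF i1, of u "a i l"] a by blast
  have at: "a i l \<otimes> (e i l \<otimes> t) = a i l \<otimes> t" using a st e_simps[OF il] by (simp add: m_assoc[symmetric])
  have "a k j \<otimes> (r \<otimes> t) = c \<otimes> (a i l \<otimes> t)" using lift st a b cr cc by (simp add: m_assoc[symmetric])
  also have "\<dots> = (c \<otimes> u) \<otimes> s" unfolding st(3)[symmetric] using u(1) cc(1) st(1) by (simp add: m_assoc)
  also have "\<dots> = \<zero>" using u st by simp
  finally have z: "a k j \<otimes> (r \<otimes> t) = \<zero>" .
  have "e k j \<otimes> (r \<otimes> t) = r \<otimes> t" using cr e_simps[OF kj] st by (simp add: m_assoc[symmetric])
  then have "r \<otimes> t = \<zero>" using monicD[OF b(2)] z cr st by simp
  moreover have "r \<otimes> (e i l \<otimes> t) = r \<otimes> t" using cr st e_simps[OF il] by (simp add: m_assoc[symmetric])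
  moreover have "e i l \<otimes> (e i l \<otimes> t) = e i l \<otimes> t" using e_simps[OF il] st by (simp add: m_assoc[symmetric])
  ultimately have "e i l \<otimes> t = \<zero>" using monicD[OF mon, of "e i l \<otimes> t"] e_simps[OF il] st by simp
  then have "u \<otimes> s = \<zero>" using at st a by simp
  then show False using st by simp
qed

text \<open>
  Otherwise \<open>c\<close> generates some layer \<open>P k q\<close>. As \<open>P k q\<close> is a copy of \<open>e k q R\<close>, hence projective, the
  epimorphism from \<open>e i 1 R\<close> onto it splits, and since \<open>e i 1 R\<close> is indecomposable it is an
  isomorphism. So \<open>c\<close> is injective, and then \<open>r\<close> is.
\<close>

lemma lift_not_monic:
  assumes il: "(i, l) \<in> harada_index m n" and kj: "(k, j) \<in> harada_index m n"
    and r: "r \<in> corner R (e k j) (e i l)" and c: "c \<in> corner R (e k 1) (e i 1)"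
    and lift: "c \<otimes> a i l = a k j \<otimes> r" and mon: "\<not> monic R (e i l) r"
  shows "c \<in> P k (n k)"
proof (rule ccontr)
  note i1 = index_first[OF il] and k1 = index_first[OF kj] and a = a_props[OF il] and b = a_props[OF kj]
    and cr = cornerD[OF r] and cc = cornerD[OF c]
  assume "c \<notin> P k (n k)"
  moreover have "c \<in> P k 1" using cc P1_iff[OF k1] by simp
  ultimately obtain q where q: "(k, q) \<in> harada_index m n" "a k q \<in> c <# carrier R" "c \<in> P k q"
    using P_cases[OF k1] by blast
  note g = a_props[OF q(1)] and eq = e_simps[OF q(1)] and ei = e_simps[OF i1]
  obtain x0 where x0: "x0 \<in> carrier R" "a k q = c \<otimes> x0" using q(2) by (auto simp: mem_l_coset_iff)
  obtain y0 where y0: "y0 \<in> carrier R" "e k q \<otimes> y0 = y0" "c = a k q \<otimes> y0" using q(3) mem_P_iff[OF q(1)] by blast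
  define x where "x = e i 1 \<otimes> x0 \<otimes> e k q"
  define y where "y = y0 \<otimes> e i 1"
  have x: "x \<in> corner R (e i 1) (e k q)"
    unfolding x_def by (rule corner_sandwich[OF x0(1) e_idempotent[OF i1] e_idempotent[OF q(1)]])
  have y: "y \<in> corner R (e k q) (e i 1)"
    unfolding y_def using y0 ei eq by (intro cornerI) (auto simp: m_assoc[symmetric], simp add: m_assoc)
  note cx = cornerD[OF x] and cy = cornerD[OF y]
  have "c \<otimes> x = (c \<otimes> e i 1) \<otimes> x0 \<otimes> e k q" using cc(1) x0(1) ei eq by (simp add: x_def m_assoc)
  then have ax: "c \<otimes> x = a k q" using cc(3) x0(2) g(6) by simp
  have "c = c \<otimes> e i 1" using cc by simp
  then have ay: "c = a k q \<otimes> y" using y0 ei g by (simp add: y_def m_assoc)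
  have "y \<otimes> x = e k q"
  proof (rule a_monic[OF q(1)])
    have "a k q \<otimes> (y \<otimes> x) = c \<otimes> x" unfolding ay using cx(1) cy(1) g(4) by (simp add: m_assoc)
    then show "a k q \<otimes> (y \<otimes> x) = a k q \<otimes> e k q" using ax g(6) by simp
  qed (use cx cy eq in \<open>auto simp: m_assoc[symmetric]\<close>)
  then have xy: "x \<otimes> y = e i 1"
    by (rule retract_of_primitive[OF e_idempotent[OF q(1)] eq(3) e_primitive[OF i1] y x])
  have "monic R (e i l) r"
    unfolding monic_def
  proof (intro ballI impI)
    fix u assume u: "u \<in> carrier R" "e i l \<otimes> u = u \<and> r \<otimes> u = \<zero>"
    have "c \<otimes> (a i l \<otimes> u) = a k j \<otimes> (r \<otimes> u)"
      using lift u(1) cc(1) a(4) b(4) cr(1) by (simp add: m_assoc[symmetric])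
    then have "a k q \<otimes> (y \<otimes> (a i l \<otimes> u)) = \<zero>" using u ay cy(1) g(4) a(4) b(4) by (simp add: m_assoc)
    then have "y \<otimes> (a i l \<otimes> u) = \<zero>"
      using monicD[OF g(2), of "y \<otimes> (a i l \<otimes> u)"] cy a(4) u eq by (simp add: m_assoc[symmetric])
    then have "(x \<otimes> y) \<otimes> (a i l \<otimes> u) = \<zero>" using cx(1) cy(1) a(4) u(1) by (simp add: m_assoc)
    then have "a i l \<otimes> u = \<zero>" using xy a(4,5) u(1) ei by (simp add: m_assoc[symmetric])
    then show "u = \<zero>" using monicD[OF a(2)] u by blast
  qed
  then show False using mon by simp
qed

lemma lift_exists:
  assumes il: "(i, l) \<in> harada_index m n" and kj: "(k, j) \<in> harada_index m n"
    and r: "r \<in> corner R (e k j) (e i l)"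
  shows "\<exists>c \<in> corner R (e k 1) (e i 1). c \<otimes> a i l = a k j \<otimes> r"
  by (rule extend_to_first[OF il index_first[OF kj]])
    (rule corner_mult[OF a_props(1)[OF kj] r e_simps(1)[OF index_first[OF kj]] e_simps(1)[OF il]])

lemma monic_lift:
  assumes il: "(i, l) \<in> harada_index m n" and kj: "(k, j) \<in> harada_index m n"
    and r: "r \<in> corner R (e k j) (e i l)" and mon: "monic R (e i l) r"
  shows "k = i \<and> (\<exists>c d. c \<in> corner R (e i 1) (e i 1) \<and> d \<in> corner R (e i 1) (e i 1) \<and>
      c \<otimes> d = e i 1 \<and> d \<otimes> c = e i 1 \<and> c \<otimes> a i l = a i j \<otimes> r)"
proof -
  note i1 = index_first[OF il] and k1 = index_first[OF kj]
  obtain c where c: "c \<in> corner R (e k 1) (e i 1)" "c \<otimes> a i l = a k j \<otimes> r" using lift_exists[OF il kj r] by blast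
  have "monic R (e i 1) c" by (rule lift_monic[OF il kj r c mon])
  with monic_first_invertible[OF i1 k1 c(1)] c show ?thesis by blast
qed

text \<open>
  The lift of a monic \<open>r\<close> is an automorphism of \<open>P i 1\<close>, so \<open>a i j r R\<close>, the image of \<open>P i l\<close>
  under it, is \<open>P i l\<close> again. Thus \<open>P i l \<subseteq> P i j\<close>, and inside \<open>e i j R\<close> the submodule that
  corresponds to \<open>P i l\<close> is \<open>r R\<close>.
\<close>

lemma monic_classification:
  assumes il: "(i, l) \<in> harada_index m n" and kj: "(k, j) \<in> harada_index m n"
    and r: "r \<in> corner R (e k j) (e i l)" and mon: "monic R (e i l) r"
  shows "k = i" "j \<le> l"
    "\<And>u. \<lbrakk>u \<in> carrier R; e i j \<otimes> u = u\<rbrakk> \<Longrightarrow> a i j \<otimes> u \<in> P i l \<longleftrightarrow> (\<exists>v \<in> carrier R. u = r \<otimes> v)"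
proof -
  show ki: "k = i" using monic_lift[OF il kj r mon] by blast
  obtain c d where c: "c \<in> corner R (e i 1) (e i 1)" and d: "d \<in> corner R (e i 1) (e i 1)"
    and cd: "c \<otimes> d = e i 1" "d \<otimes> c = e i 1" and lift: "c \<otimes> a i l = a i j \<otimes> r"
    using monic_lift[OF il kj r mon] by blast
  note ij = kj[unfolded ki] and i1 = index_first[OF il]
  note a = a_props[OF il] and b = a_props[OF ij] and cr = cornerD[OF r[unfolded ki]]
    and cR = cornerD(1)[OF c] and dR = cornerD(1)[OF d]
  have dcx: "d \<otimes> (c \<otimes> x) = x" if "x \<in> carrier R" "e i 1 \<otimes> x = x" for x
    using that cd cR dR by (simp add: m_assoc[symmetric])
  have cdx: "c \<otimes> (d \<otimes> x) = x" if "x \<in> carrier R" "e i 1 \<otimes> x = x" for x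
    using that cd cR dR by (simp add: m_assoc[symmetric])
  show "j \<le> l"
  proof (rule ccontr)
    assume "\<not> j \<le> l"
    then have lj: "l < j" by simp
    have "c \<otimes> a i l \<in> P i j" unfolding lift using right_idealD(4)[OF right_ideal_P[OF ij] a_in_P[OF ij] cr(1)] .
    then have "d \<otimes> (c \<otimes> a i l) \<in> P i j" by (rule unit_preserves_P[OF ij d c cd(2,1)])
    then have "a i l \<in> P i j" using dcx a by simp
    then show False using a_notin_P[OF ij _ lj] il by (simp add: index_iff)
  qed
  show "a i j \<otimes> u \<in> P i l \<longleftrightarrow> (\<exists>v \<in> carrier R. u = r \<otimes> v)" if u: "u \<in> carrier R" "e i j \<otimes> u = u" for u
  proof
    assume "a i j \<otimes> u \<in> P i l"
    then have "d \<otimes> (a i j \<otimes> u) \<in> P i l" by (rule unit_preserves_P[OF il d c cd(2,1)])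
    then obtain v where v: "v \<in> carrier R" "d \<otimes> (a i j \<otimes> u) = a i l \<otimes> v" using mem_P_iff[OF il] by blast
    have "a i j \<otimes> u = c \<otimes> (d \<otimes> (a i j \<otimes> u))"
      by (rule cdx[symmetric]) (use u b e_simps[OF i1] in \<open>auto simp: m_assoc[symmetric]\<close>)
    also have "\<dots> = c \<otimes> a i l \<otimes> v" unfolding v(2) using v(1) cR a by (simp add: m_assoc)
    also have "\<dots> = a i j \<otimes> (r \<otimes> v)" unfolding lift using v(1) cr b by (simp add: m_assoc)
    finally have "a i j \<otimes> u = a i j \<otimes> (r \<otimes> v)" .
    then have "u = r \<otimes> v"
      by (intro a_monic[OF ij u]) (use v cr e_simps[OF ij] in \<open>auto simp: m_assoc[symmetric]\<close>)
    then show "\<exists>v \<in> carrier R. u = r \<otimes> v" using v by blast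
  next
    assume "\<exists>v \<in> carrier R. u = r \<otimes> v"
    then obtain v where v: "v \<in> carrier R" "u = r \<otimes> v" by blast
    have "a i j \<otimes> u = c \<otimes> (a i l \<otimes> v)" unfolding v(2) using lift v(1) cR a cr b by (simp add: m_assoc[symmetric])
    moreover have "a i l \<otimes> v \<in> P i l" using right_idealD(4)[OF right_ideal_P[OF il] a_in_P[OF il] v(1)] .
    ultimately show "a i j \<otimes> u \<in> P i l" using unit_preserves_P[OF il c d cd] by simp
  qed
qed

text \<open>
  With \<open>c\<close> and \<open>c'\<close> the lifts of \<open>r\<close> and \<open>r'\<close> and \<open>d\<close> the inverse of \<open>c\<close>, the map \<open>c' d\<close> carries
  the map \<open>r\<close> to the map \<open>r'\<close>. It has to be restricted to a map from \<open>P i k\<close> to \<open>P q j\<close>: if \<open>r'\<close> is monic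
  then \<open>c' d\<close> is an automorphism and maps \<open>P i k\<close> to itself, which is contained in \<open>P q j\<close> by the
  assumption on the order; if not, its whole image lies in the smallest layer.
\<close>

lemma factor_left:
  assumes il: "(i, l) \<in> harada_index m n" and ik: "(i, k) \<in> harada_index m n" and qj: "(q, j) \<in> harada_index m n"
    and r: "r \<in> corner R (e i k) (e i l)" "monic R (e i l) r"
    and r': "r' \<in> corner R (e q j) (e i l)" and order: "monic R (e i l) r' \<Longrightarrow> j \<le> k"
  shows "\<exists>y \<in> corner R (e q j) (e i k). r' = y \<otimes> r"
proof -
  note i1 = index_first[OF il] and q1 = index_first[OF qj]
  obtain c d where c: "c \<in> corner R (e i 1) (e i 1)" and d: "d \<in> corner R (e i 1) (e i 1)"
    and cd: "c \<otimes> d = e i 1" "d \<otimes> c = e i 1" and lift: "c \<otimes> a i l = a i k \<otimes> r"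
    using monic_lift[OF il ik r] by blast
  obtain c' where c': "c' \<in> corner R (e q 1) (e i 1)" "c' \<otimes> a i l = a q j \<otimes> r'" using lift_exists[OF il qj r'] by blast
  note a = a_props[OF il] and b = a_props[OF ik] and g = a_props[OF qj] and cr = cornerD[OF r(1)] and cr' = cornerD[OF r']
    and cR = cornerD[OF c] and dR = cornerD[OF d] and c'R = cornerD[OF c'(1)]
  have da: "d \<otimes> a i k \<in> P i k" by (rule unit_preserves_P[OF ik d c cd(2,1) a_in_P[OF ik]])
  have "c' \<otimes> (d \<otimes> a i k) \<in> P q j"
  proof (cases "monic R (e i l) r'")
    case True
    have qi: "q = i" using monic_lift[OF il qj r' True] by blast
    have "monic R (e i 1) c'" by (rule lift_monic[OF il qj r' c' True])
    then obtain d' where "d' \<in> corner R (e i 1) (e i 1)" "c' \<otimes> d' = e i 1" "d' \<otimes> c' = e i 1"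
      using monic_first_invertible[OF i1 q1 c'(1)] by blast
    then have "c' \<otimes> (d \<otimes> a i k) \<in> P i k" using unit_preserves_P[OF ik _ _ _ _ da] c'(1) qi by blast
    then show ?thesis using P_antimono[OF ik, of j] order[OF True] qj qi by (auto simp: index_iff)
  next
    case False
    have "c' \<in> P q (n q)" by (rule lift_not_monic[OF il qj r' c' False])
    then have "c' \<in> P q j" using P_antimono[OF index_last[OF qj], of j] qj by (auto simp: index_iff)
    then show ?thesis using right_idealD(4)[OF right_ideal_P[OF qj]] dR b by simp
  qed
  then obtain y0 where y0: "y0 \<in> carrier R" "e q j \<otimes> y0 = y0" "c' \<otimes> (d \<otimes> a i k) = a q j \<otimes> y0"
    using mem_P_iff[OF qj] by blast
  define y where "y = y0 \<otimes> e i k"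
  have y: "y \<in> corner R (e q j) (e i k)"
    unfolding y_def using y0 e_simps[OF ik] e_simps[OF qj]
    by (intro cornerI) (auto simp: m_assoc[symmetric], simp add: m_assoc)
  have "r' = y \<otimes> r"
  proof (rule a_monic[OF qj])
    have "a q j \<otimes> (y \<otimes> r) = (a q j \<otimes> y0) \<otimes> r"
      using y0(1) g(4) cr e_simps[OF ik] by (simp add: y_def m_assoc)
    also have "\<dots> = c' \<otimes> (d \<otimes> (a i k \<otimes> r))" unfolding y0(3)[symmetric] using c'R dR b cr by (simp add: m_assoc)
    also have "\<dots> = c' \<otimes> (d \<otimes> c \<otimes> a i l)" unfolding lift[symmetric] using cR dR a c'R by (simp add: m_assoc)
    also have "\<dots> = a q j \<otimes> r'" using cd a c'(2) by simp
    finally show "a q j \<otimes> r' = a q j \<otimes> (y \<otimes> r)" ..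
  qed (use cr cr' cornerD[OF y] e_simps[OF qj] in \<open>auto simp: m_assoc[symmetric]\<close>)
  then show ?thesis using y by blast
qed

text \<open>
  By \<open>monic_classification\<close>, what has to be shown is that the image of \<open>r'\<close> lies in \<open>P i l\<close>, viewed in \<open>P i k\<close>.
  It is \<open>P i j\<close> with \<open>l \<le> j\<close> if \<open>r'\<close> is monic, and contained in the smallest layer if not.
\<close>

lemma factor_right:
  assumes il: "(i, l) \<in> harada_index m n" and ik: "(i, k) \<in> harada_index m n" and qj: "(q, j) \<in> harada_index m n"
    and r: "r \<in> corner R (e i k) (e i l)" "monic R (e i l) r"
    and r': "r' \<in> corner R (e i k) (e q j)" and order: "monic R (e q j) r' \<Longrightarrow> l \<le> j"
  shows "\<exists>v \<in> carrier R. r' = r \<otimes> v"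
proof -
  note i1 = index_first[OF il] and q1 = index_first[OF qj]
  obtain c' where c': "c' \<in> corner R (e i 1) (e q 1)" "c' \<otimes> a q j = a i k \<otimes> r'" using lift_exists[OF qj ik r'] by blast
  note b = a_props[OF ik] and g = a_props[OF qj] and cr = cornerD[OF r(1)] and cr' = cornerD[OF r'] and c'R = cornerD[OF c'(1)]
  have "a i k \<otimes> r' \<in> P i l"
  proof (cases "monic R (e q j) r'")
    case True
    obtain c d where c: "c \<in> corner R (e q 1) (e q 1)" "d \<in> corner R (e q 1) (e q 1)" "c \<otimes> d = e q 1" "d \<otimes> c = e q 1"
      and qi: "i = q" and lift: "c \<otimes> a q j = a q k \<otimes> r'"
      using monic_lift[OF qj ik r' True] by blast
    have "a i k \<otimes> r' \<in> P q j" unfolding qi lift[symmetric] by (rule unit_preserves_P[OF qj c a_in_P[OF qj]])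
    then show ?thesis using P_antimono[OF qj, of l] order[OF True] il qi by (auto simp: index_iff)
  next
    case False
    have "c' \<in> P i (n i)" by (rule lift_not_monic[OF qj ik r' c' False])
    then have "c' \<in> P i l" using P_antimono[OF index_last[OF il], of l] il by (auto simp: index_iff)
    then show ?thesis unfolding c'(2)[symmetric] by (rule right_idealD(4)[OF right_ideal_P[OF il] _ g(4)])
  qed
  then show ?thesis using monic_classification(3)[OF il ik r cr'(1,2)] by simp
qed

end

section \<open>Presentations by matrices\<close>

text \<open>
  An exact sequence \<open>0 \<rightarrow> \<Oplus> G s R \<rightarrow> \<Oplus> E t R \<rightarrow> M \<rightarrow> 0\<close> in coordinates: \<open>r\<close> is the matrix of
  the first map, and \<open>z t\<close> is the image of \<open>E t\<close> in \<open>M\<close>. The last four conditions say that the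
  entries of \<open>r\<close> have the right source and target, that its columns are relations, that they generate all
  relations, and that the map is injective.
\<close>

definition presentation ::
  "('r, 'x) ring_scheme \<Rightarrow> ('r, 'm) module \<Rightarrow> ('i \<Rightarrow> 'r) \<Rightarrow> 'i set \<Rightarrow> ('i \<Rightarrow> 'm) \<Rightarrow>
   ('j \<Rightarrow> 'r) \<Rightarrow> 'j set \<Rightarrow> ('i \<Rightarrow> 'j \<Rightarrow> 'r) \<Rightarrow> bool" where
  "presentation R M E T z G S r \<longleftrightarrow>
     spans R M E T z \<and> finite S \<and>
     (\<forall>t \<in> T. \<forall>s \<in> S. r t s \<in> corner R (E t) (G s)) \<and>
     (\<forall>s \<in> S. lincomb M T (\<lambda>t. r t s) z = \<zero>\<^bsub>M\<^esub>) \<and>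
     (\<forall>c \<in> coefs R E T. lincomb M T c z = \<zero>\<^bsub>M\<^esub> \<longrightarrow>
        (\<exists>d \<in> coefs R G S. \<forall>t \<in> T. c t = lincomb (regular_module R) S d (r t))) \<and>
     (\<forall>d \<in> coefs R G S. (\<forall>t \<in> T. lincomb (regular_module R) S d (r t) = \<zero>\<^bsub>R\<^esub>) \<longrightarrow>
        (\<forall>s \<in> S. d s = \<zero>\<^bsub>R\<^esub>))"

lemma presentationD:
  assumes "presentation R M E T z G S r"
  shows "spans R M E T z" "finite S" "\<And>t s. t \<in> T \<Longrightarrow> s \<in> S \<Longrightarrow> r t s \<in> corner R (E t) (G s)"
    "\<And>s. s \<in> S \<Longrightarrow> lincomb M T (\<lambda>t. r t s) z = \<zero>\<^bsub>M\<^esub>"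
    "\<And>c. c \<in> coefs R E T \<Longrightarrow> lincomb M T c z = \<zero>\<^bsub>M\<^esub> \<Longrightarrow>
        \<exists>d \<in> coefs R G S. \<forall>t \<in> T. c t = lincomb (regular_module R) S d (r t)"
    "\<And>d. d \<in> coefs R G S \<Longrightarrow> \<forall>t \<in> T. lincomb (regular_module R) S d (r t) = \<zero>\<^bsub>R\<^esub> \<Longrightarrow>
        \<forall>s \<in> S. d s = \<zero>\<^bsub>R\<^esub>"
  using assms unfolding presentation_def by auto

context right_module
begin

text \<open>
  The hypothesis \<open>split\<close> says that the span of \<open>z b\<close> and the span of the other \<open>z t\<close> have
  trivial intersection, so \<open>M\<close> is their direct sum and one of them is zero.
\<close>

lemma indecomposable_split:
  assumes ind: "indecomposable_module R M" and sp: "spans R M E T z"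
    and E: "\<And>t. t \<in> T \<Longrightarrow> idempotent_elt R (E t)" and b: "b \<in> T"
    and split: "\<And>c. \<lbrakk>c \<in> coefs R E T; lincomb M T c z = \<zero>\<^bsub>M\<^esub>\<rbrakk> \<Longrightarrow> c b \<odot>\<^bsub>M\<^esub> z b = \<zero>\<^bsub>M\<^esub>"
  shows "z b = \<zero>\<^bsub>M\<^esub> \<or> (\<forall>y \<in> carrier M. \<exists>u \<in> carrier R. y = u \<odot>\<^bsub>M\<^esub> z b)"
proof -
  note T = spansD(1)[OF sp] and zM = spansD(2)[OF sp] and zE = spansD(3)[OF sp]
  have zb: "z b \<in> carrier M" using zM b by blast
  have ER: "E b \<in> carrier R" using E[OF b] by (auto simp: idempotent_elt_def)
  define A where "A = {lincomb M {b} c z |c. c \<in> coefs R E {b}}"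
  define B where "B = {lincomb M (T - {b}) c z |c. c \<in> coefs R E (T - {b})}"
  have A: "submodule A R M" and zA: "z b \<in> A"
    unfolding A_def using spanned_submodule[of "{b}" E z] E b zM zE by auto
  have B: "submodule B R M" unfolding B_def by (rule spanned_submodule(1)) (use T E zM zE in auto)
  have Ab: "lincomb M {b} c z = c b \<odot>\<^bsub>M\<^esub> z b" if "c \<in> coefs R E {b}" for c
    using lincomb_remove[of "{b}" b c z] coefsD(1)[OF that] zb by simp
  have dec: "\<exists>u w. u \<in> A \<and> w \<in> B \<and> y = u \<oplus>\<^bsub>M\<^esub> w" if y: "y \<in> carrier M" for y
  proof -
    obtain c where c: "c \<in> coefs R E T" "y = lincomb M T c z" using spansD(4)[OF sp y] by blast
    have c': "c \<in> coefs R E {b}" "c \<in> coefs R E (T - {b})" using c(1) b by (auto simp: coefs_def)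
    have "y = lincomb M {b} c z \<oplus>\<^bsub>M\<^esub> lincomb M (T - {b}) c z"
      unfolding c(2) Ab[OF c'(1)] by (rule lincomb_remove[OF T b coefs_Pi[OF c(1)] zM])
    then show ?thesis unfolding A_def B_def using c' by blast
  qed
  have "A <+>\<^bsub>M\<^esub> B = carrier M"
  proof
    show "A <+>\<^bsub>M\<^esub> B \<subseteq> carrier M"
      using submoduleD(1)[OF A] submoduleD(1)[OF B] by (auto simp: set_add_def')
    show "carrier M \<subseteq> A <+>\<^bsub>M\<^esub> B" using dec by (fastforce simp: set_add_def')
  qed
  moreover have "A \<inter> B = {\<zero>\<^bsub>M\<^esub>}"
  proof
    show "{\<zero>\<^bsub>M\<^esub>} \<subseteq> A \<inter> B" using submoduleD(2)[OF A] submoduleD(2)[OF B] by blast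
    show "A \<inter> B \<subseteq> {\<zero>\<^bsub>M\<^esub>}"
    proof
      fix y assume y: "y \<in> A \<inter> B"
      then have "\<ominus>\<^bsub>M\<^esub> y \<in> A" using submoduleD(5)[OF A] by blast
      then obtain u where u: "u \<in> coefs R E {b}" "\<ominus>\<^bsub>M\<^esub> y = u b \<odot>\<^bsub>M\<^esub> z b" unfolding A_def using Ab by auto
      obtain c where c: "c \<in> coefs R E (T - {b})" "y = lincomb M (T - {b}) c z" using y unfolding B_def by blast
      have yM: "y \<in> carrier M" using y submoduleD(1)[OF B] by blast
      let ?c = "c(b := u b)"
      have co: "?c \<in> coefs R E T" using c(1) u(1) by (auto simp: coefs_def)
      have "lincomb M (T - {b}) ?c z = y"
        unfolding c(2) by (rule lincomb_cong) (use coefs_Pi[OF c(1)] zM in auto)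
      then have "lincomb M T ?c z = \<zero>\<^bsub>M\<^esub>"
        using lincomb_remove[OF T b coefs_Pi[OF co] zM] u(2)[symmetric] M.l_neg[OF yM] by simp
      then have "\<ominus>\<^bsub>M\<^esub> y = \<zero>\<^bsub>M\<^esub>" using split[OF co] u(2) by simp
      then show "y \<in> {\<zero>\<^bsub>M\<^esub>}" using yM M.r_neg[OF yM] by simp
    qed
  qed
  ultimately have "A = {\<zero>\<^bsub>M\<^esub>} \<or> B = {\<zero>\<^bsub>M\<^esub>}" using ind A B unfolding indecomposable_module_def by blast
  then show ?thesis
  proof
    assume "A = {\<zero>\<^bsub>M\<^esub>}"
    then show ?thesis using zA by simp
  next
    assume B0: "B = {\<zero>\<^bsub>M\<^esub>}"
    have "\<exists>u \<in> carrier R. y = u \<odot>\<^bsub>M\<^esub> z b" if y: "y \<in> carrier M" for y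
    proof -
      obtain p w where p: "p \<in> A" "w \<in> B" "y = p \<oplus>\<^bsub>M\<^esub> w" using dec[OF y] by blast
      have "w = \<zero>\<^bsub>M\<^esub>" using p(2) B0 by simp
      moreover have "p \<in> carrier M" using p(1) submoduleD(1)[OF A] by (rule subsetD[rotated])
      ultimately have "y \<in> A" using p(1,3) by simp
      then obtain c where c: "c \<in> coefs R E {b}" "y = c b \<odot>\<^bsub>M\<^esub> z b" unfolding A_def using Ab by blast
      show ?thesis using coefsD(1)[OF c(1), of b] c(2) by (intro bexI[of _ "c b"]) simp_all
    qed
    then show ?thesis by blast
  qed
qed

text \<open>
  An entry with a right inverse is an isomorphism between indecomposables. Its inverse \<open>y\<close> serves as a
  pivot: column operations with the coefficients \<open>q s\<close> clear row \<open>b\<close>, the relation in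
  column \<open>a\<close> makes \<open>z b\<close> superfluous, and the \<open>b\<close>-th equation determines the \<open>a\<close>-th coefficient.
\<close>

lemma presentation_cancel:
  assumes pres: "presentation R M E T z G S r"
    and E: "\<And>t. t \<in> T \<Longrightarrow> primitive_idempotent R (E t)" and G: "\<And>s. s \<in> S \<Longrightarrow> primitive_idempotent R (G s)"
    and b: "b \<in> T" and a: "a \<in> S" and x: "x \<in> carrier R" "r b a \<otimes> x = E b"
  shows "\<exists>r'. presentation R M E (T - {b}) z G (S - {a}) r'"
proof -
  note [simp] = regular_module_simps
  note sp = presentationD(1)[OF pres] and S = presentationD(2)[OF pres] and rc = presentationD(3)[OF pres]
    and col = presentationD(4)[OF pres] and rel = presentationD(5)[OF pres] and indep = presentationD(6)[OF pres]
  note T = spansD(1)[OF sp] and zM = spansD(2)[OF sp] and zE = spansD(3)[OF sp]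
  let ?sum = "lincomb (regular_module R)"
  have idE: "idempotent_elt R (E t)" "E t \<noteq> \<zero>" if "t \<in> T" for t using E[OF that] by (auto simp: primitive_idempotent_def)
  have idG: "idempotent_elt R (G s)" if "s \<in> S" for s using G[OF that] by (auto simp: primitive_idempotent_def)
  have ER: "E t \<in> carrier R" "E t \<otimes> E t = E t" if "t \<in> T" for t using idE[OF that] by (auto simp: idempotent_elt_def)
  have GR: "G s \<in> carrier R" "G s \<otimes> G s = G s" if "s \<in> S" for s using idG[OF that] by (auto simp: idempotent_elt_def)
  have rR: "r t s \<in> carrier R" "E t \<otimes> r t s = r t s" "r t s \<otimes> G s = r t s" if "t \<in> T" "s \<in> S" for t s
    using cornerD[OF rc[OF that]] by auto
  define y where "y = G a \<otimes> x \<otimes> E b"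
  have y: "y \<in> corner R (G a) (E b)" unfolding y_def by (rule R.corner_sandwich[OF x(1) idG[OF a] idE(1)[OF b]])
  note cy = cornerD[OF y]
  have "r b a \<otimes> y = (r b a \<otimes> G a) \<otimes> x \<otimes> E b"
    using rR(1)[OF b a] GR[OF a] ER[OF b] x(1) by (simp add: y_def R.m_assoc)
  then have ry: "r b a \<otimes> y = E b" using rR[OF b a] x(2) ER[OF b] by simp
  have yr: "y \<otimes> r b a = G a"
    by (rule R.retract_of_primitive[OF idE[OF b] G[OF a] rc[OF b a] y ry])
  define q where "q s = \<ominus> (y \<otimes> r b s)" for s
  have q: "q s \<in> carrier R" "G a \<otimes> q s = q s" "q s \<otimes> G s = q s" "r b a \<otimes> q s = \<ominus> r b s" if s: "s \<in> S" for s
  proof -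
    show "q s \<in> carrier R" "G a \<otimes> q s = q s" "q s \<otimes> G s = q s"
      using cy rR[OF b s] GR[OF a] GR[OF s]
      by (auto simp: q_def R.r_minus R.m_assoc[symmetric]) (simp add: R.l_minus R.m_assoc)
    have "r b a \<otimes> q s = \<ominus> ((r b a \<otimes> y) \<otimes> r b s)"
      unfolding q_def using cy(1) rR(1)[OF b s] rR(1)[OF b a] by (simp add: R.r_minus R.m_assoc)
    then show "r b a \<otimes> q s = \<ominus> r b s" using ry rR[OF b s] by simp
  qed
  define r' where "r' t s = r t s \<oplus> r t a \<otimes> q s" for t s
  have r'R: "r' t s \<in> carrier R" if "t \<in> T" "s \<in> S" for t s
    using rR(1)[OF that] rR(1)[OF that(1) a] q(1)[OF that(2)] by (simp add: r'_def)
  have r'b: "r' b s = \<zero>" if "s \<in> S" for s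
    using q(4)[OF that] rR(1)[OF b that] by (simp add: r'_def R.r_neg)
  have r'c: "r' t s \<in> corner R (E t) (G s)" if t: "t \<in> T" and s: "s \<in> S" for t s
  proof (rule cornerI)
    show "E t \<otimes> r' t s = r' t s"
      using rR[OF t s] rR[OF t a] q[OF s] ER[OF t] by (simp add: r'_def R.r_distr R.m_assoc[symmetric])
    have "r t a \<otimes> q s \<otimes> G s = r t a \<otimes> (q s \<otimes> G s)"
      using rR(1)[OF t a] q(1)[OF s] GR[OF s] by (simp add: R.m_assoc)
    then show "r' t s \<otimes> G s = r' t s"
      using rR[OF t s] rR[OF t a] q[OF s] GR[OF s] by (simp add: r'_def R.l_distr)
  qed (rule r'R[OF t s])
  have "presentation R M E (T - {b}) z G (S - {a}) r'"
    unfolding presentation_def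
  proof (intro conjI ballI impI)
    show "finite (S - {a})" using S by simp
    show "r' t s \<in> corner R (E t) (G s)" if "t \<in> T - {b}" "s \<in> S - {a}" for t s using r'c that by simp
    have "z b \<in> N" if N: "submodule N R M" "z ` (T - {b}) \<subseteq> N" for N
    proof -
      have zb: "z b \<in> carrier M" using zM b by blast
      let ?w = "lincomb M (T - {b}) (\<lambda>t. r t a) z"
      have w: "?w \<in> N" by (rule lincomb_in_submodule[OF N(1)]) (use T rR(1)[OF _ a] N(2) in auto)
      have "r b a \<odot>\<^bsub>M\<^esub> z b \<oplus>\<^bsub>M\<^esub> ?w = \<zero>\<^bsub>M\<^esub>"
        using lincomb_remove[OF T b, of "\<lambda>t. r t a" z] col[OF a] rR(1)[OF _ a] zM by simp
      then have "\<ominus>\<^bsub>M\<^esub> ?w = r b a \<odot>\<^bsub>M\<^esub> z b"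
        by (rule M.minus_equality) (use submoduleD(1)[OF N(1)] w zb rR(1)[OF b a] in auto)
      then have "r b a \<odot>\<^bsub>M\<^esub> z b \<in> N" using submoduleD(5)[OF N(1) w] by simp
      then have "y \<odot>\<^bsub>M\<^esub> (r b a \<odot>\<^bsub>M\<^esub> z b) \<in> N" by (rule submoduleD(4)[OF N(1) cy(1)])
      then show ?thesis using smult_assoc[of "r b a" y "z b"] ry zE[OF b] zb rR(1)[OF b a] cy(1) by simp
    qed
    then have "N = carrier M" if N: "submodule N R M" "z ` (T - {b}) \<subseteq> N" for N
      using sp N spans_iff[OF T idE(1) zM zE] by blast
    then show "spans R M E (T - {b}) z"
      by (subst spans_iff) (use T idE zM zE in auto)
  next
    fix s assume "s \<in> S - {a}"
    then have s: "s \<in> S" by simp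
    have "lincomb M T (\<lambda>t. r' t s) z = lincomb M T (\<lambda>t. r t s) z \<oplus>\<^bsub>M\<^esub> lincomb M T (\<lambda>t. r t a \<otimes> q s) z"
      unfolding r'_def by (rule lincomb_add) (use rR(1)[OF _ s] rR(1)[OF _ a] q(1)[OF s] zM in auto)
    also have "lincomb M T (\<lambda>t. r t a \<otimes> q s) z = q s \<odot>\<^bsub>M\<^esub> lincomb M T (\<lambda>t. r t a) z"
      by (rule smult_lincomb[symmetric]) (use T rR(1)[OF _ a] q(1)[OF s] zM in auto)
    finally have "lincomb M T (\<lambda>t. r' t s) z = \<zero>\<^bsub>M\<^esub>" using col[OF s] col[OF a] q(1)[OF s] by simp
    then show "lincomb M (T - {b}) (\<lambda>t. r' t s) z = \<zero>\<^bsub>M\<^esub>"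
      using lincomb_remove[OF T b, of "\<lambda>t. r' t s" z] r'R[OF _ s] zM r'b[OF s] b
        lincomb_closed[of "\<lambda>t. r' t s" "T - {b}" z] by (auto simp: Pi_iff)
  next
    \<comment> \<open>the \<open>b\<close>-th equation determines \<open>d a\<close> from the other unknowns\<close>
    have elim: "?sum S d (r t) = ?sum (S - {a}) d (r' t)"
      if d: "d \<in> S \<rightarrow> carrier R" and da: "d a = ?sum (S - {a}) d q" and t: "t \<in> T" for d t
    proof -
      have "?sum (S - {a}) d (r' t) = ?sum (S - {a}) d (r t) \<oplus> ?sum (S - {a}) d (\<lambda>s. r t a \<otimes> q s)"
        using regular.lincomb_add_right[of d "S - {a}" "r t" "\<lambda>s. r t a \<otimes> q s"] d rR(1)[OF t] q(1) a
        by (auto simp: r'_def[abs_def] Pi_iff)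
      also have "?sum (S - {a}) d (\<lambda>s. r t a \<otimes> q s) = r t a \<otimes> d a"
        unfolding da
        by (rule lincomb_hom[OF R.regular_right_module R.regular_right_module R.left_mult_hom, symmetric])
          (use S rR(1)[OF t a] q(1) d in auto)
      finally show ?thesis
        using regular.lincomb_remove[OF S a d, of "r t"] regular.lincomb_closed[of d "S - {a}" "r t"]
          rR(1)[OF t] d a R.a_comm[of "r t a \<otimes> d a"] by (auto simp: Pi_iff)
    qed
    show "\<exists>d \<in> coefs R G (S - {a}). \<forall>t \<in> T - {b}. c t = ?sum (S - {a}) d (r' t)"
      if c: "c \<in> coefs R E (T - {b})" "lincomb M (T - {b}) c z = \<zero>\<^bsub>M\<^esub>" for c
    proof -
      let ?c = "c(b := \<zero>)"
      have co: "?c \<in> coefs R E T" using c(1) ER[OF b] by (auto simp: coefs_def)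
      have "lincomb M (T - {b}) ?c z = lincomb M (T - {b}) c z"
        by (rule lincomb_cong) (use coefs_Pi[OF c(1)] zM in auto)
      then have "lincomb M T ?c z = \<zero>\<^bsub>M\<^esub>"
        using lincomb_remove[OF T b coefs_Pi[OF co] zM] c(2) zM b by (auto simp: Pi_iff)
      then obtain d where d: "d \<in> coefs R G S" "\<forall>t \<in> T. ?c t = ?sum S d (r t)" using rel[OF co] by blast
      note dR = coefs_Pi[OF d(1)]
      let ?w = "?sum (S - {a}) d (r b)"
      have w: "?w \<in> carrier R" using regular.lincomb_closed[of d "S - {a}" "r b"] dR rR(1)[OF b] by auto
      have da: "d a \<in> carrier R" "G a \<otimes> d a = d a" using coefsD[OF d(1) a] by auto
      have "r b a \<otimes> d a \<oplus> ?w = \<zero>"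
        using regular.lincomb_remove[OF S a dR, of "r b"] rR(1)[OF b] bspec[OF d(2) b] by auto
      then have e0: "\<ominus> ?w = r b a \<otimes> d a"
        by (rule R.minus_equality) (use w da rR(1)[OF b a] in auto)
      have "d a = y \<otimes> (r b a \<otimes> d a)" using yr da cy(1) rR(1)[OF b a] by (simp add: R.m_assoc[symmetric])
      also have "\<dots> = (\<ominus> y) \<otimes> ?w" unfolding e0[symmetric] using w cy(1) by (simp add: R.r_minus R.l_minus)
      also have "\<dots> = ?sum (S - {a}) d (\<lambda>s. (\<ominus> y) \<otimes> r b s)"
        by (rule lincomb_hom[OF R.regular_right_module R.regular_right_module R.left_mult_hom])
          (use S cy(1) rR(1)[OF b] dR in auto)
      also have "\<dots> = ?sum (S - {a}) d q"
        by (rule regular.lincomb_cong) (use cy(1) rR(1)[OF b] dR in \<open>auto simp: q_def R.l_minus Pi_iff\<close>)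
      finally have "\<forall>t \<in> T - {b}. c t = ?sum (S - {a}) d (r' t)" using elim[OF dR] d(2) by (metis DiffE fun_upd_other singletonI)
      moreover have "d \<in> coefs R G (S - {a})" using d(1) by (auto simp: coefs_def)
      ultimately show ?thesis by blast
    qed
    show "d s = \<zero>"
      if d: "d \<in> coefs R G (S - {a})" and d0: "\<forall>t \<in> T - {b}. ?sum (S - {a}) d (r' t) = \<zero>"
        and s: "s \<in> S - {a}" for d s
    proof -
      note dR = coefs_Pi[OF d]
      define w where "w = ?sum (S - {a}) d q"
      have wR: "w \<in> carrier R" unfolding w_def using regular.lincomb_closed[of d "S - {a}" q] dR q(1) by auto
      have "G a \<otimes> w = ?sum (S - {a}) d (\<lambda>s. G a \<otimes> q s)"
        unfolding w_def
        by (rule lincomb_hom[OF R.regular_right_module R.regular_right_module R.left_mult_hom])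
          (use S GR[OF a] q(1) dR in auto)
      also have "\<dots> = w" unfolding w_def by (rule regular.lincomb_cong) (use q(1,2) dR in auto)
      finally have co: "d(a := w) \<in> coefs R G S" using d wR by (auto simp: coefs_def)
      have cong: "?sum (S - {a}) (d(a := w)) v = ?sum (S - {a}) d v" if "v \<in> S - {a} \<rightarrow> carrier R" for v
        by (rule regular.lincomb_cong) (use dR that in auto)
      have "?sum S (d(a := w)) (r t) = \<zero>" if t: "t \<in> T" for t
      proof -
        have "?sum S (d(a := w)) (r t) = ?sum (S - {a}) d (r' t)"
          using elim[OF coefs_Pi[OF co] _ t] cong[of q] cong[of "r' t"] q(1) r'R[OF t] by (auto simp: w_def Pi_iff)
        also have "\<dots> = \<zero>"
        proof (cases "t = b")
          case True
          then show ?thesis using regular.lincomb_zero[of "S - {a}" d "r' t"] r'b dR by (auto simp: Pi_iff)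
        qed (use d0 t in auto)
        finally show ?thesis .
      qed
      then have "(d(a := w)) s = \<zero>" using indep[OF co] s by blast
      then show ?thesis using s by simp
    qed
  qed
  then show ?thesis by blast
qed

end

lemma a_kernel_iff: "x \<in> a_kernel G H h \<longleftrightarrow> x \<in> carrier G \<and> h x = \<zero>\<^bsub>H\<^esub>"
  by (simp add: a_kernel_def')

text \<open>
  Write both terms of the resolution in bases as direct sums of indecomposable right ideals and take
  the matrix of \<open>d 0\<close>, which is injective because the term in degree two is zero.
\<close>

lemma (in finite_length_ring) presentation_exists:
  fixes Pr :: "nat \<Rightarrow> ('a, 'a fg_universe) module"
  assumes E0: "complete_primitive_idempotents R E0" and M: "right_module R M"
    and res: "projective_resolution R M 1 Pr d \<epsilon>"
  shows "\<exists>T E z S G r. E \<in> T \<rightarrow> E0 \<and> G \<in> S \<rightarrow> E0 \<and>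
    presentation R M E (T :: nat set) z G (S :: nat set) r"
proof -
  have proj: "projective_module R (Pr i)" for i using res by (simp add: projective_resolution_def)
  have P2: "carrier (Pr 2) = {\<zero>\<^bsub>Pr 2\<^esub>}" using res by (simp add: projective_resolution_def)
  have \<epsilon>: "\<epsilon> \<in> rmod_hom R (Pr 0) M" "\<epsilon> ` carrier (Pr 0) = carrier M"
    using res by (simp_all add: projective_resolution_def)
  have dh: "d 0 \<in> rmod_hom R (Pr 1) (Pr 0)" "d 1 \<in> rmod_hom R (Pr 2) (Pr 1)"
    using res by (simp_all add: projective_resolution_def numeral_2_eq_2)
  have ker0: "d 0 ` carrier (Pr 1) = a_kernel (Pr 0) M \<epsilon>" 
    and ker1: "d 1 ` carrier (Pr 2) = a_kernel (Pr 1) (Pr 0) (d 0)"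
    using res unfolding projective_resolution_def by (simp, metis One_nat_def numeral_2_eq_2)
  have rP: "right_module R (Pr i)" for i using proj[of i] by (simp add: projective_module_def fg_module_def)
  interpret M: right_module R M by fact
  interpret P0: right_module R "Pr 0" by (rule rP)
  interpret P1: right_module R "Pr 1" by (rule rP)
  have inj: "p = \<zero>\<^bsub>Pr 1\<^esub>" if "p \<in> carrier (Pr 1)" "d 0 p = \<zero>\<^bsub>Pr 0\<^esub>" for p
  proof -
    have "p \<in> d 1 ` carrier (Pr 2)" unfolding ker1 using that by (simp add: a_kernel_iff)
    then show ?thesis using rmod_hom_zero[OF rP rP dh(2)] P2 by simp
  qed
  have idem: "idempotent_elt R f" if "f \<in> E0" for f
    using E0 that by (simp add: complete_primitive_idempotents_def primitive_idempotent_def)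
  obtain T :: "nat set" and E x where ET: "E \<in> T \<rightarrow> E0" and bx: "projective_basis R (Pr 0) E T x"
    using projective_has_basis[OF E0 proj] by blast
  obtain S :: "nat set" and G y where GS: "G \<in> S \<rightarrow> E0" and by': "projective_basis R (Pr 1) G S y"
    using projective_has_basis[OF E0 proj] by blast
  have spx: "spans R (Pr 0) E T x"
    and xind: "\<And>c. c \<in> coefs R E T \<Longrightarrow> lincomb (Pr 0) T c x = \<zero>\<^bsub>Pr 0\<^esub> \<Longrightarrow> \<forall>t \<in> T. c t = \<zero>"
    using bx unfolding projective_basis_def by (rule conjunct1) (use bx[unfolded projective_basis_def] in blast)
  have spy: "spans R (Pr 1) G S y"
    and yind: "\<And>c. c \<in> coefs R G S \<Longrightarrow> lincomb (Pr 1) S c y = \<zero>\<^bsub>Pr 1\<^esub> \<Longrightarrow> \<forall>s \<in> S. c s = \<zero>"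
    using by' unfolding projective_basis_def by (rule conjunct1) (use by'[unfolded projective_basis_def] in blast)
  note T = spansD(1)[OF spx] and x = spansD(2,3)[OF spx] and S = spansD(1)[OF spy] and y = spansD(2,3)[OF spy]
  let ?sum = "lincomb (regular_module R)"
  note [simp] = regular_module_simps
  have ER: "E t \<in> carrier R" "E t \<otimes> E t = E t" if "t \<in> T" for t
    using idem ET that by (auto simp: idempotent_elt_def Pi_iff)
  have GR: "G s \<in> carrier R" "G s \<otimes> G s = G s" if "s \<in> S" for s
    using idem GS that by (auto simp: idempotent_elt_def Pi_iff)
  have "\<forall>s \<in> S. \<exists>c. c \<in> coefs R E T \<and> d 0 (y s) = lincomb (Pr 0) T c x"
    using spansD(4)[OF spx] rmod_homD(1)[OF dh(1)] y(1) by blast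
  then obtain r0 where r0: "\<And>s. s \<in> S \<Longrightarrow> r0 s \<in> coefs R E T"
    "\<And>s. s \<in> S \<Longrightarrow> d 0 (y s) = lincomb (Pr 0) T (r0 s) x" by metis
  \<comment> \<open>the coefficients of \<open>d 0 (y s)\<close> may be multiplied by \<open>G s\<close>, which fixes \<open>y s\<close>\<close>
  define r where "r t s = r0 s t \<otimes> G s" for t s
  have rc: "r t s \<in> corner R (E t) (G s)" if t: "t \<in> T" and s: "s \<in> S" for t s
    unfolding r_def using coefsD[OF r0(1)[OF s] t] GR[OF s] ER[OF t]
    by (intro cornerI) (auto simp: m_assoc[symmetric], simp add: m_assoc)
  have rR: "r t s \<in> carrier R" "E t \<otimes> r t s = r t s" if "t \<in> T" "s \<in> S" for t s using cornerD[OF rc[OF that]] by auto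
  have dy: "d 0 (y s) = lincomb (Pr 0) T (\<lambda>t. r t s) x" if s: "s \<in> S" for s
  proof -
    have "d 0 (y s) = G s \<odot>\<^bsub>Pr 0\<^esub> d 0 (y s)"
      using rmod_homD(3)[OF dh(1) GR(1)[OF s], of "y s"] y s by auto
    then show ?thesis
      unfolding r0(2)[OF s] r_def
      using P0.smult_lincomb[OF coefs_Pi[OF r0(1)[OF s]] x(1) T GR(1)[OF s]] by simp
  qed
  have comb: "d 0 (lincomb (Pr 1) S w y) = lincomb (Pr 0) T (\<lambda>t. ?sum S w (r t)) x"
    if w: "w \<in> coefs R G S" for w
  proof -
    have "d 0 (lincomb (Pr 1) S w y) = lincomb (Pr 0) S w (\<lambda>s. d 0 (y s))"
      by (rule lincomb_hom[OF rP rP dh(1) S coefs_Pi[OF w] y(1)])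
    also have "\<dots> = lincomb (Pr 0) S w (\<lambda>s. lincomb (Pr 0) T (\<lambda>t. r t s) x)"
      by (rule P0.lincomb_cong) (use dy coefs_Pi[OF w] rR x in \<open>auto intro!: P0.lincomb_closed\<close>)
    also have "\<dots> = lincomb (Pr 0) T (\<lambda>t. ?sum S w (r t)) x"
      by (rule P0.lincomb_lincomb[OF S T coefs_Pi[OF w] _ x(1), symmetric]) (use rR in auto)
    finally show ?thesis .
  qed
  have sum_coef: "(\<lambda>t. ?sum S w (r t)) \<in> coefs R E T" if w: "w \<in> coefs R G S" for w
  proof -
    have "E t \<otimes> ?sum S w (r t) = ?sum S w (r t) \<and> ?sum S w (r t) \<in> carrier R" if t: "t \<in> T" for t
    proof
      have "E t \<otimes> ?sum S w (r t) = ?sum S w (\<lambda>s. E t \<otimes> r t s)"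
        by (rule lincomb_hom[OF regular_right_module regular_right_module left_mult_hom])
          (use S ER[OF t] rR[OF t] coefs_Pi[OF w] in auto)
      also have "\<dots> = ?sum S w (r t)" by (rule M.regular.lincomb_cong) (use rR[OF t] coefs_Pi[OF w] in auto)
      finally show "E t \<otimes> ?sum S w (r t) = ?sum S w (r t)" .
      show "?sum S w (r t) \<in> carrier R"
        using M.regular.lincomb_closed[of w S "r t"] rR[OF t] coefs_Pi[OF w] by auto
    qed
    then show ?thesis by (simp add: coefs_def)
  qed
  define z where "z t = \<epsilon> (x t)" for t
  have \<epsilon>comb: "\<epsilon> (lincomb (Pr 0) T c x) = lincomb M T c z" if "c \<in> T \<rightarrow> carrier R" for c
    unfolding z_def by (rule lincomb_hom[OF rP M \<epsilon>(1) T that x(1)])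
  have "presentation R M E T z G S r"
    unfolding presentation_def
  proof (intro conjI ballI impI S)
    show "spans R M E T z"
      unfolding spans_def
    proof (intro conjI ballI T)
      fix t assume t: "t \<in> T"
      then have xt: "x t \<in> carrier (Pr 0)" using x(1) by blast
      show "z t \<in> carrier M" using rmod_homD(1)[OF \<epsilon>(1) xt] by (simp add: z_def)
      show "E t \<odot>\<^bsub>M\<^esub> z t = z t"
        using rmod_homD(3)[OF \<epsilon>(1) ER(1)[OF t] xt] x(2)[OF t] by (simp add: z_def)
    next
      fix v assume "v \<in> carrier M"
      then obtain p where p: "p \<in> carrier (Pr 0)" "v = \<epsilon> p" using \<epsilon>(2) by blast
      then show "\<exists>c \<in> coefs R E T. v = lincomb M T c z" using spansD(4)[OF spx p(1)] \<epsilon>comb coefs_Pi by metis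
    qed
    show "r t s \<in> corner R (E t) (G s)" if "t \<in> T" "s \<in> S" for t s by (rule rc[OF that])
    show "lincomb M T (\<lambda>t. r t s) z = \<zero>\<^bsub>M\<^esub>" if s: "s \<in> S" for s
    proof -
      have "d 0 (y s) \<in> a_kernel (Pr 0) M \<epsilon>" unfolding ker0[symmetric] using y(1) s by blast
      then show ?thesis using dy[OF s] \<epsilon>comb[of "\<lambda>t. r t s"] rR(1)[OF _ s] by (simp add: a_kernel_iff)
    qed
  next
    fix c assume c: "c \<in> coefs R E T" and c0: "lincomb M T c z = \<zero>\<^bsub>M\<^esub>"
    note cR = coefs_Pi[OF c]
    let ?p = "lincomb (Pr 0) T c x"
    have p: "?p \<in> carrier (Pr 0)" by (rule P0.lincomb_closed[OF cR x(1)])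
    then have "?p \<in> d 0 ` carrier (Pr 1)" unfolding ker0 a_kernel_iff using c0 \<epsilon>comb[OF cR] by simp
    then obtain v where v: "v \<in> carrier (Pr 1)" "?p = d 0 v" by blast
    obtain w where w: "w \<in> coefs R G S" "v = lincomb (Pr 1) S w y" using spansD(4)[OF spy v(1)] by blast
    define k where "k t = ?sum S w (r t)" for t
    have k: "k \<in> coefs R E T" using sum_coef[OF w(1)] by (simp add: k_def[abs_def])
    note kR = coefs_Pi[OF k]
    have pk: "?p = lincomb (Pr 0) T k x" using v(2) comb[OF w(1)] w(2) by (simp add: k_def[abs_def])
    have df: "(\<lambda>t. c t \<oplus> k t \<otimes> (\<ominus> \<one>)) \<in> coefs R E T" using c k ER by (auto simp: coefs_def r_distr r_minus)
    have "lincomb (Pr 0) T (\<lambda>t. c t \<oplus> k t \<otimes> (\<ominus> \<one>)) x = ?p \<oplus>\<^bsub>Pr 0\<^esub> lincomb (Pr 0) T (\<lambda>t. k t \<otimes> (\<ominus> \<one>)) x"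
      by (rule P0.lincomb_add) (use cR kR x in auto)
    also have "lincomb (Pr 0) T (\<lambda>t. k t \<otimes> (\<ominus> \<one>)) x = (\<ominus> \<one>) \<odot>\<^bsub>Pr 0\<^esub> ?p"
      unfolding pk by (rule P0.smult_lincomb[symmetric]) (use T kR x in auto)
    also have "?p \<oplus>\<^bsub>Pr 0\<^esub> (\<ominus> \<one>) \<odot>\<^bsub>Pr 0\<^esub> ?p = \<zero>\<^bsub>Pr 0\<^esub>"
      using p P0.smult_l_minus[OF one_closed p] by (simp add: P0.M.r_neg)
    finally have "\<forall>t \<in> T. c t \<oplus> k t \<otimes> (\<ominus> \<one>) = \<zero>" by (rule xind[OF df])
    then have "c t = k t" if "t \<in> T" for t
      using that coefsD(1)[OF c that] coefsD(1)[OF k that] by (metis a_inv_closed minus_equality minus_minus one_closed r_minus r_one)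
    then show "\<exists>w \<in> coefs R G S. \<forall>t \<in> T. c t = ?sum S w (r t)" using w(1) by (auto simp: k_def)
  next
    fix w s assume w: "w \<in> coefs R G S" "\<forall>t \<in> T. ?sum S w (r t) = \<zero>" and s: "s \<in> S"
    have "d 0 (lincomb (Pr 1) S w y) = \<zero>\<^bsub>Pr 0\<^esub>"
      unfolding comb[OF w(1)] by (rule P0.lincomb_zero) (use w(2) x in \<open>auto simp: Pi_iff\<close>)
    then have "lincomb (Pr 1) S w y = \<zero>\<^bsub>Pr 1\<^esub>" by (rule inj[OF P1.lincomb_closed[OF coefs_Pi[OF w(1)] y(1)]])
    then show "w s = \<zero>" using yind[OF w(1)] s by blast
  qed
  then show ?thesis using ET GS by blast
qed

section \<open>Quotients and resolutions\<close>

lemma rmod_hom_inverse: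
  assumes f: "f \<in> rmod_hom R M N" and bij: "bij_betw f (carrier M) (carrier N)" and M: "right_module R M"
  shows "inv_into (carrier M) f \<in> rmod_hom R N M"
proof (rule rmod_homI)
  interpret M: right_module R M by fact
  let ?g = "inv_into (carrier M) f"
  have g: "?g y \<in> carrier M" "f (?g y) = y" if "y \<in> carrier N" for y
    using bij that by (auto simp: bij_betw_def inv_into_into f_inv_into_f)
  have gf: "?g (f x) = x" if "x \<in> carrier M" for x using bij that by (simp add: bij_betw_def inv_into_f_f)
  fix y assume y: "y \<in> carrier N"
  show "?g y \<in> carrier M" by (rule g(1)[OF y])
  show "?g (y \<oplus>\<^bsub>N\<^esub> z) = ?g y \<oplus>\<^bsub>M\<^esub> ?g z" if z: "z \<in> carrier N" for z
    using gf[of "?g y \<oplus>\<^bsub>M\<^esub> ?g z"] rmod_homD(2)[OF f g(1)[OF y] g(1)[OF z]] g[OF y] g[OF z] by simp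
  show "?g (r \<odot>\<^bsub>N\<^esub> y) = r \<odot>\<^bsub>M\<^esub> ?g y" if r: "r \<in> carrier R" for r
    using gf[of "r \<odot>\<^bsub>M\<^esub> ?g y"] rmod_homD(3)[OF f r g(1)[OF y]] g[OF y] r by simp
qed

lemma (in right_module) quotient_module_projection:
  assumes N: "submodule N R M"
  shows "(\<lambda>x. N +>\<^bsub>M\<^esub> x) \<in> rmod_hom R M (quotient_module M N)"
    "(\<lambda>x. N +>\<^bsub>M\<^esub> x) ` carrier M = carrier (quotient_module M N)"
    "right_module R (quotient_module M N)"
    "\<And>x. x \<in> carrier M \<Longrightarrow> N +>\<^bsub>M\<^esub> x = \<zero>\<^bsub>quotient_module M N\<^esub> \<longleftrightarrow> x \<in> N"
proof -
  have sub: "subgroup N (add_monoid M)" using N by (simp add: submodule_def)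
  then have "additive_subgroup N M" by (rule additive_subgroupI)
  then interpret N: abelian_subgroup N M using M.abelian_group_axioms by (intro abelian_subgroupI3)
  let ?q = "\<lambda>x. N +>\<^bsub>M\<^esub> x" and ?Q = "quotient_module M N"
  show surj: "?q ` carrier M = carrier ?Q" by (auto simp: quotient_module_def A_RCOSETS_def')
  have add: "?q (x \<oplus>\<^bsub>M\<^esub> y) = ?q x \<oplus>\<^bsub>?Q\<^esub> ?q y" if "x \<in> carrier M" "y \<in> carrier M" for x y
    using N.a_rcos_sum[OF that] by (simp add: quotient_module_def)
  have smult: "?q (r \<odot>\<^bsub>M\<^esub> x) = r \<odot>\<^bsub>?Q\<^esub> ?q x" if r: "r \<in> carrier R" and x: "x \<in> carrier M" for r x
  proof -
    have "N +>\<^bsub>M\<^esub> (r \<odot>\<^bsub>M\<^esub> y) = N +>\<^bsub>M\<^esub> (r \<odot>\<^bsub>M\<^esub> x)" if y: "y \<in> N +>\<^bsub>M\<^esub> x" for y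
    proof -
      obtain h where h: "h \<in> N" "y = h \<oplus>\<^bsub>M\<^esub> x" using y by (auto simp: a_r_coset_def')
      have "r \<odot>\<^bsub>M\<^esub> y = r \<odot>\<^bsub>M\<^esub> h \<oplus>\<^bsub>M\<^esub> r \<odot>\<^bsub>M\<^esub> x"
        using h r x submoduleD(1)[OF N] by (auto simp: smult_r_distr)
      then have "r \<odot>\<^bsub>M\<^esub> y \<in> N +>\<^bsub>M\<^esub> (r \<odot>\<^bsub>M\<^esub> x)" using submoduleD(4)[OF N r h(1)] by (auto simp: a_r_coset_def')
      then show ?thesis using M.a_repr_independence[OF _ _ sub] r x by simp
    qed
    moreover have "x \<in> N +>\<^bsub>M\<^esub> x" by (rule N.a_rcos_self[OF x])
    ultimately have "(\<Union>y \<in> N +>\<^bsub>M\<^esub> x. N +>\<^bsub>M\<^esub> (r \<odot>\<^bsub>M\<^esub> y)) = N +>\<^bsub>M\<^esub> (r \<odot>\<^bsub>M\<^esub> x)" by blast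
    then show ?thesis by (simp add: quotient_module_def)
  qed
  show "?q \<in> rmod_hom R M ?Q" by (rule rmod_homI) (use surj add smult in auto)
  have zero: "?q x = \<zero>\<^bsub>?Q\<^esub> \<longleftrightarrow> x \<in> N" if x: "x \<in> carrier M" for x
    using M.a_coset_join1[OF _ x sub] M.a_coset_join2[OF x sub] by (auto simp: quotient_module_def)
  then show "\<And>x. x \<in> carrier M \<Longrightarrow> ?q x = \<zero>\<^bsub>?Q\<^esub> \<longleftrightarrow> x \<in> N" .
  have "?q \<zero>\<^bsub>M\<^esub> = \<zero>\<^bsub>?Q\<^esub>" using zero submoduleD(2)[OF N] by simp
  then show "right_module R ?Q" by (intro right_module_image[OF right_module_axioms surj add smult])
qed

lemma first_isomorphism:
  assumes M: "right_module R M" and L: "right_module R L" and f: "f \<in> rmod_hom R M L"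
    and surj: "f ` carrier M = carrier L" and N: "submodule N R M"
    and ker: "\<And>x. x \<in> carrier M \<Longrightarrow> f x = \<zero>\<^bsub>L\<^esub> \<longleftrightarrow> x \<in> N"
  shows "rmod_iso R L (quotient_module M N)"
proof -
  interpret M: right_module R M by fact
  note q = M.quotient_module_projection[OF N]
  let ?q = "\<lambda>x. N +>\<^bsub>M\<^esub> x" and ?Q = "quotient_module M N"
  have eq: "?q x = ?q y \<longleftrightarrow> f x = f y" if "x \<in> carrier M" "y \<in> carrier M" for x y
    using rmod_hom_eq_iff[OF M q(3,1) that] rmod_hom_eq_iff[OF M L f that] ker q(4) that by simp
  define g where "g y = ?q (inv_into (carrier M) f y)" for y
  have pre: "\<exists>x \<in> carrier M. y = f x" if "y \<in> carrier L" for y using that surj by blast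
  have gf: "g (f x) = ?q x" if x: "x \<in> carrier M" for x
  proof -
    have "inv_into (carrier M) f (f x) \<in> carrier M" "f (inv_into (carrier M) f (f x)) = f x"
      using x by (auto intro: inv_into_into f_inv_into_f)
    then show ?thesis unfolding g_def using eq x by blast
  qed
  have "g \<in> rmod_hom R L ?Q"
  proof (rule rmod_homI)
    fix y assume "y \<in> carrier L"
    then obtain x where x: "x \<in> carrier M" "y = f x" using pre by blast
    show "g y \<in> carrier ?Q" using gf[OF x(1)] x rmod_homD(1)[OF q(1)] by simp
    show "g (r \<odot>\<^bsub>L\<^esub> y) = r \<odot>\<^bsub>?Q\<^esub> g y" if r: "r \<in> carrier R" for r
      using gf[of "r \<odot>\<^bsub>M\<^esub> x"] rmod_homD(3)[OF f r x(1)] rmod_homD(3)[OF q(1) r x(1)] gf[OF x(1)] x r by simp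
    show "g (y \<oplus>\<^bsub>L\<^esub> y') = g y \<oplus>\<^bsub>?Q\<^esub> g y'" if y': "y' \<in> carrier L" for y'
    proof -
      obtain x' where x': "x' \<in> carrier M" "y' = f x'" using pre[OF y'] by blast
      show ?thesis
        using gf[of "x \<oplus>\<^bsub>M\<^esub> x'"] rmod_homD(2)[OF f x(1) x'(1)] rmod_homD(2)[OF q(1) x(1) x'(1)]
          gf[OF x(1)] gf[OF x'(1)] x x' by simp
    qed
  qed
  moreover have "bij_betw g (carrier L) (carrier ?Q)"
    unfolding bij_betw_def
  proof
    show "inj_on g (carrier L)"
    proof (rule inj_onI)
      fix y y' assume "y \<in> carrier L" "y' \<in> carrier L" and eq': "g y = g y'"
      then obtain x x' where "x \<in> carrier M" "y = f x" "x' \<in> carrier M" "y' = f x'" using pre by metis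
      then show "y = y'" using eq[of x x'] eq' gf by simp
    qed
    show "g ` carrier L = carrier ?Q"
      unfolding surj[symmetric] q(2)[symmetric] image_image using gf by (intro image_cong) auto
  qed
  ultimately show ?thesis unfolding rmod_iso_def by blast
qed

lemma projective_dimension_eq_1_iff:
  "projective_dimension R M = 1 \<longleftrightarrow>
     (\<exists>Pr d \<epsilon>. projective_resolution R M 1 Pr d \<epsilon>) \<and> \<not> (\<exists>Pr d \<epsilon>. projective_resolution R M 0 Pr d \<epsilon>)"
proof -
  define A where "A = {enat n |n. \<exists>Pr d \<epsilon>. projective_resolution R M n Pr d \<epsilon>}"
  have A: "enat n \<in> A \<longleftrightarrow> (\<exists>Pr d \<epsilon>. projective_resolution R M n Pr d \<epsilon>)" for n by (auto simp: A_def)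
  have "Inf A = 1 \<longleftrightarrow> 1 \<in> A \<and> 0 \<notin> A"
  proof
    assume I: "Inf A = 1"
    have ne: "A \<noteq> {}"
    proof
      assume "A = {}"
      then show False using I by (simp add: Inf_enat_def)
    qed
    then have "Inf A \<in> A" unfolding Inf_enat_def by (auto intro: LeastI)
    moreover have "0 \<notin> A"
    proof
      assume "0 \<in> A"
      then have "Inf A \<le> 0" by (rule Inf_lower)
      then show False using I by simp
    qed
    ultimately show "1 \<in> A \<and> 0 \<notin> A" using I by simp
  next
    assume *: "1 \<in> A \<and> 0 \<notin> A"
    show "Inf A = 1"
    proof (rule antisym)
      show "Inf A \<le> 1" using * by (auto intro: Inf_lower)
      show "1 \<le> Inf A"
      proof (rule Inf_greatest)
        fix x assume "x \<in> A"
        then have "x \<noteq> 0" using * by blast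
        then show "1 \<le> x" by (simp add: ileI1 one_eSuc zero_less_iff_neq_zero)
      qed
    qed
  qed
  then show ?thesis
    using A[of 0] A[of 1] by (simp add: projective_dimension_def A_def[symmetric] zero_enat_def one_enat_def)
qed

text \<open>
  The right ideals that are isomorphic, by left multiplication with \<open>x\<close>, to a right ideal \<open>f R\<close>
  generated by an idempotent. Besides the \<open>P i j\<close> this includes the zero ideal.
\<close>

definition cyclic_projective_ideal :: "('r, 'x) ring_scheme \<Rightarrow> 'r set \<Rightarrow> bool" where
  "cyclic_projective_ideal R I \<longleftrightarrow>
     (\<exists>f x. idempotent_elt R f \<and> x \<in> carrier R \<and> x \<otimes>\<^bsub>R\<^esub> f = x \<and> monic R f x \<and> I = x <#\<^bsub>R\<^esub> carrier R)"

text \<open>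
  An injection of the ring into the type of the terms of resolutions.
\<close>

definition const_code :: "'r \<Rightarrow> 'r fg_universe" where
  "const_code x = {\<lambda>_. x}"

lemma inj_const_code: "inj_on const_code A"
  by (rule inj_onI) (simp add: const_code_def fun_eq_iff)

context ring
begin

lemma cyclic_projective_ideal_zero: "cyclic_projective_ideal R {\<zero>}"
  unfolding cyclic_projective_ideal_def
  by (intro exI[of _ \<zero>]) (auto simp: idempotent_elt_def monic_def l_coset_def)

lemma cyclic_projective_ideal_right_ideal: "cyclic_projective_ideal R I \<Longrightarrow> right_ideal R I"
  unfolding cyclic_projective_ideal_def using right_ideal_principal by blast

lemma cyclic_projective_ideal_copy:
  assumes "cyclic_projective_ideal R I"
  shows "projective_module R (copy_module const_code (ideal_module R I))"
proof -
  obtain f x where f: "idempotent_elt R f" and x: "x \<in> carrier R" "x \<otimes> f = x" "monic R f x" and I: "I = x <# carrier R"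
    using assms unfolding cyclic_projective_ideal_def by blast
  have Ir: "right_ideal R I" unfolding I by (rule right_ideal_principal[OF x(1)])
  note c = copy_module[OF ideal_module_right_module[OF Ir] inj_const_code]
  let ?C = "copy_module const_code (ideal_module R I)"
  have xI: "x \<in> I" unfolding I by (rule principal_self[OF x(1)])
  have hom: "const_code (y \<otimes> r) = r \<odot>\<^bsub>?C\<^esub> const_code y" if "r \<in> carrier R" "y \<in> I" for r y
    using rmod_homD(3)[OF c(2) that(1), of y] that by (simp add: sub_module_simps regular_module_simps)
  show ?thesis
  proof (rule cyclic_projective[OF c(1) f])
    show "const_code x \<in> carrier ?C" using c(4) xI by (simp add: sub_module_simps)
    show "f \<odot>\<^bsub>?C\<^esub> const_code x = const_code x"
      using hom[of f x] xI x f by (simp add: idempotent_elt_def)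
    show "\<exists>r \<in> carrier R. u = r \<odot>\<^bsub>?C\<^esub> const_code x" if u: "u \<in> carrier ?C" for u
    proof -
      obtain y where "y \<in> I" "u = const_code y" using u c(4) by (auto simp: sub_module_simps)
      then obtain r where "r \<in> carrier R" "u = const_code (x \<otimes> r)" by (auto simp: I mem_l_coset_iff)
      then show ?thesis using hom xI by blast
    qed
    show "u = \<zero>" if u: "u \<in> carrier R" "f \<otimes> u = u" "u \<odot>\<^bsub>?C\<^esub> const_code x = \<zero>\<^bsub>?C\<^esub>" for u
    proof -
      have "const_code (x \<otimes> u) = const_code \<zero>"
        using hom[OF u(1) xI] u(3) by (simp add: copy_module_def sub_module_simps regular_module_simps)
      then have "x \<otimes> u = \<zero>" using inj_const_code[of UNIV] by (auto dest: injD)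
      then show ?thesis using monicD[OF x(3)] u by blast
    qed
  qed
qed

text \<open>
  The resolution is \<open>0 \<rightarrow> N \<rightarrow> I \<rightarrow> M \<rightarrow> 0\<close>, copied into \<open>fg_universe\<close>. Its length is \<open>1\<close>, or any \<open>k\<close>
  when \<open>N\<close> is zero; the two cases serve the quotients \<open>P\<^sub>i\<^sub>k / P\<^sub>i\<^sub>l\<close> and the projective modules.
\<close>

lemma resolution_of_ideal_quotient:
  assumes I: "cyclic_projective_ideal R I" and N: "cyclic_projective_ideal R N" "N \<subseteq> I"
    and M: "right_module R M" and q: "q \<in> rmod_hom R (ideal_module R I) M" "q ` I = carrier M"
    and ker: "\<And>x. x \<in> I \<Longrightarrow> q x = \<zero>\<^bsub>M\<^esub> \<longleftrightarrow> x \<in> N" and k: "N = {\<zero>} \<or> k = 1"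
  shows "\<exists>Pr d \<epsilon>. projective_resolution R M k Pr d \<epsilon>"
proof -
  let ?cp = "\<lambda>A. copy_module const_code (ideal_module R A)"
  let ?dec = "\<lambda>A. inv_into (carrier (ideal_module R A)) const_code"
  have dec: "?dec A (const_code x) = x" if "x \<in> A" for A x
    by (rule inv_into_f_f[OF inj_const_code]) (use that in \<open>simp add: sub_module_simps\<close>)
  have cz: "\<zero>\<^bsub>?cp A\<^esub> = const_code \<zero>" for A by (simp add: copy_module_def sub_module_simps regular_module_simps)
  have cc: "carrier (?cp A) = const_code ` A" for A by (simp add: copy_module_def sub_module_simps)
  have rZ: "right_ideal R {\<zero>}" by (rule cyclic_projective_ideal_right_ideal[OF cyclic_projective_ideal_zero])
  note rI = cyclic_projective_ideal_right_ideal[OF I] and rN = cyclic_projective_ideal_right_ideal[OF N(1)]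
  note cI = copy_module[OF ideal_module_right_module[OF rI] inj_const_code]
    and cN = copy_module[OF ideal_module_right_module[OF rN] inj_const_code]
  define V where "V j = (if j = 0 then I else if j = 1 then N else {\<zero>})" for j :: nat
  have V: "cyclic_projective_ideal R (V j)" for j
    using I N cyclic_projective_ideal_zero by (simp add: V_def)
  note cV = copy_module[OF ideal_module_right_module[OF cyclic_projective_ideal_right_ideal[OF V]] inj_const_code]
  define d where "d j = (if j = 0 then (\<lambda>u. const_code (?dec N u)) else (\<lambda>u. const_code \<zero>))" for j :: nat
  define \<epsilon> where "\<epsilon> u = q (?dec I u)" for u
  have incl: "(\<lambda>x. x) \<in> rmod_hom R (ideal_module R N) (ideal_module R I)"
    by (rule rmod_homI) (use N(2) in \<open>auto simp: sub_module_simps\<close>)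
  have d0: "(\<lambda>u. const_code (?dec N u)) \<in> rmod_hom R (?cp N) (?cp I)"
    by (rule rmod_hom_comp[OF cN(3) rmod_hom_comp[OF incl cI(2)]])
  have zero_hom: "(\<lambda>u. const_code \<zero>) \<in> rmod_hom R (?cp A) (?cp (V j))" for A j
  proof (rule rmod_homI)
    interpret C: right_module R "?cp (V j)" by (rule cV(1))
    show "const_code \<zero> \<in> carrier (?cp (V j))" using C.M.zero_closed by (simp only: cz)
    show "const_code \<zero> = const_code \<zero> \<oplus>\<^bsub>?cp (V j)\<^esub> const_code \<zero>" using C.M.r_zero[OF C.M.zero_closed] by (simp only: cz)
    show "const_code \<zero> = r \<odot>\<^bsub>?cp (V j)\<^esub> const_code \<zero>" if "r \<in> carrier R" for r
      using C.smult_r_null[OF that] by (simp only: cz)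
  qed
  have "projective_resolution R M k (\<lambda>j. ?cp (V j)) d \<epsilon>"
    unfolding projective_resolution_def
  proof (intro conjI allI impI)
    show "projective_module R (?cp (V j))" for j by (rule cyclic_projective_ideal_copy[OF V])
    show "carrier (?cp (V j)) = {\<zero>\<^bsub>?cp (V j)\<^esub>}" if "j > k" for j
      using that k by (auto simp: V_def cc cz)
    show "\<epsilon> \<in> rmod_hom R (?cp (V 0)) M" unfolding \<epsilon>_def V_def by (simp, rule rmod_hom_comp[OF cI(3) q(1)])
    show "d j \<in> rmod_hom R (?cp (V (Suc j))) (?cp (V j))" for j
      using d0 zero_hom[of "V (Suc j)" j] by (cases "j = 0") (simp_all add: d_def V_def)
    show "\<epsilon> ` carrier (?cp (V 0)) = carrier M"
      unfolding q(2)[symmetric] by (auto simp: V_def cc \<epsilon>_def dec image_image)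
    show "d 0 ` carrier (?cp (V 1)) = a_kernel (?cp (V 0)) M \<epsilon>"
    proof -
      have "d 0 ` carrier (?cp (V 1)) = const_code ` N" by (simp add: V_def cc d_def image_image dec)
      also have "\<dots> = a_kernel (?cp (V 0)) M \<epsilon>" using ker N(2) by (auto simp: V_def cc \<epsilon>_def dec a_kernel_iff)
      finally show ?thesis .
    qed
    show "d (Suc j) ` carrier (?cp (V (Suc (Suc j)))) = a_kernel (?cp (V (Suc j))) (?cp (V j)) (d j)" for j
    proof -
      have "d (Suc j) ` carrier (?cp (V (Suc (Suc j)))) = {const_code \<zero>}" by (simp add: d_def V_def cc)
      also have "\<dots> = a_kernel (?cp (V (Suc j))) (?cp (V j)) (d j)"
      proof (cases "j = 0")
        case True
        have "x = \<zero>" if "const_code x = const_code \<zero>" for x :: 'a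
          using that by (rule inj_onD[OF inj_const_code[of UNIV]]) auto
        then show ?thesis using True right_idealD(2)[OF rN]
          by (auto simp: d_def V_def a_kernel_iff cc cz dec)
      qed (auto simp: d_def V_def a_kernel_iff cc cz)
      finally show ?thesis .
    qed
  qed
  then show ?thesis by blast
qed

end

section \<open>The quotients of two layers\<close>

lemma (in ring) ideal_module_minus:
  assumes I: "right_ideal R I" and "x \<in> I" "y \<in> I"
  shows "x \<ominus>\<^bsub>ideal_module R I\<^esub> y = x \<ominus> y"
proof -
  interpret S: right_module R "ideal_module R I" by (rule ideal_module_right_module[OF I])
  have "\<ominus>\<^bsub>ideal_module R I\<^esub> y = \<ominus> y"
  proof (rule S.M.minus_equality)
    show "\<ominus> y \<oplus>\<^bsub>ideal_module R I\<^esub> y = \<zero>\<^bsub>ideal_module R I\<^esub>"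
      using right_idealD(1)[OF I] assms(3) by (auto simp: sub_module_simps regular_module_simps l_neg)
  qed (use assms(3) right_ideal_minus[OF I assms(3)] in \<open>auto simp: sub_module_simps\<close>)
  then show ?thesis by (simp add: S.M.minus_eq minus_eq) (simp add: sub_module_simps regular_module_simps)
qed

context left_harada
begin

lemma P_cyclic_projective: "(i, j) \<in> harada_index m n \<Longrightarrow> cyclic_projective_ideal R (P i j)"
  unfolding cyclic_projective_ideal_def
  by (intro exI[of _ "e i j"] exI[of _ "a i j"] conjI e_idempotent a_props)

lemma P_module: "(i, j) \<in> harada_index m n \<Longrightarrow> right_module R (ideal_module R (P i j))"
  by (rule ideal_module_right_module[OF right_ideal_P])

lemma quotient_projection:
  assumes il: "(i, l) \<in> harada_index m n" and k: "1 \<le> k" "k \<le> l"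
  shows "\<exists>q. q \<in> rmod_hom R (ideal_module R (P i k)) (harada_quotient R e i k l) \<and>
    q ` P i k = carrier (harada_quotient R e i k l) \<and>
    right_module R (harada_quotient R e i k l) \<and>
    (\<forall>x \<in> P i k. q x = \<zero>\<^bsub>harada_quotient R e i k l\<^esub> \<longleftrightarrow> x \<in> P i l)"
proof -
  have ik: "(i, k) \<in> harada_index m n" by (rule index_le[OF il k])
  interpret X: right_module R "ideal_module R (P i k)" by (rule P_module[OF ik])
  have "submodule (P i l) R (ideal_module R (P i k))"
    using submodule_ideal_module_iff[OF right_ideal_P[OF ik]] right_ideal_P[OF il] P_antimono[OF il k] by simp
  from X.quotient_module_projection[OF this] show ?thesis
    unfolding harada_quotient_def by (intro exI conjI ballI) (simp_all add: sub_module_simps)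
qed

text \<open>
  The element \<open>t\<close> is the matrix of the inclusion of \<open>P i l\<close> in \<open>P i k\<close>.
\<close>

lemma a_multiple:
  assumes il: "(i, l) \<in> harada_index m n" and k: "1 \<le> k" "k \<le> l"
  shows "\<exists>t \<in> carrier R. e i k \<otimes> t = t \<and> a i l = a i k \<otimes> t \<and> t \<noteq> \<zero>"
proof -
  have ik: "(i, k) \<in> harada_index m n" by (rule index_le[OF il k])
  have "a i l \<in> P i k" using a_in_P[OF il] P_antimono[OF il k] by blast
  then obtain t where t: "t \<in> carrier R" "e i k \<otimes> t = t" "a i l = a i k \<otimes> t" using mem_P_iff[OF ik] by blast
  then have "t \<noteq> \<zero>" using a_props(7)[OF il] a_props(4)[OF ik] by auto
  then show ?thesis using t by blast
qed

text \<open>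
  Nakayama's lemma for the local module \<open>P i k\<close>: a lift of a generator of \<open>P\<^sub>i\<^sub>k / P\<^sub>i\<^sub>l\<close> is not in the
  unique maximal submodule \<open>P i (k + 1)\<close>, which contains \<open>P i l\<close>.
\<close>

lemma lift_generates:
  assumes il: "(i, l) \<in> harada_index m n" and k: "1 \<le> k" "k < l"
    and w: "w \<in> P i k" and r: "r \<in> carrier R" and diff: "a i k \<ominus> w \<otimes> r \<in> P i l"
  shows "a i k \<in> w <# carrier R"
proof (rule ccontr)
  assume no: "a i k \<notin> w <# carrier R"
  have ik: "(i, k) \<in> harada_index m n" and ik1: "(i, Suc k) \<in> harada_index m n"
    using index_le[OF il] k by auto
  have w1: "w \<in> P i (Suc k)" using P_Suc_iff[OF ik1 k(1) w] no by blast
  note I = right_ideal_P[OF ik1]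
  have wr: "w \<otimes> r \<in> P i (Suc k)" by (rule right_idealD(4)[OF I w1 r])
  have "a i k \<ominus> w \<otimes> r \<in> P i (Suc k)" using diff P_antimono[OF il, of "Suc k"] k by auto
  then have "(a i k \<ominus> w \<otimes> r) \<oplus> w \<otimes> r \<in> P i (Suc k)" using right_idealD(3)[OF I _ wr] by blast
  moreover have "(a i k \<ominus> w \<otimes> r) \<oplus> w \<otimes> r = a i k"
    using a_props(4)[OF ik] P_carrier[OF ik1 wr] by (simp add: minus_eq a_assoc l_neg)
  ultimately show False using a_notin_P[OF ik1 k(1)] by simp
qed

text \<open>
  A generator \<open>w\<close> of \<open>P i k\<close> fixed by \<open>f\<close> is an epimorphism from \<open>f R\<close> onto the projective module
  \<open>P i k\<close>, and \<open>v\<close> is a section of it.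
\<close>

lemma generator_coefficient:
  assumes ik: "(i, k) \<in> harada_index m n" and f: "idempotent_elt R f"
    and w: "w \<in> P i k" "w \<otimes> f = w" "a i k \<in> w <# carrier R"
  shows "\<exists>c \<in> corner R (e i k) f. \<exists>v \<in> corner R f (e i k). w = a i k \<otimes> c \<and> c \<otimes> v = e i k"
proof -
  note a = a_props[OF ik] and eR = e_simps[OF ik]
  have fR: "f \<in> carrier R" "f \<otimes> f = f" using f by (auto simp: idempotent_elt_def)
  obtain c where c: "c \<in> carrier R" "e i k \<otimes> c = c" "w = a i k \<otimes> c" using w(1) mem_P_iff[OF ik] by blast
  have cf: "c \<otimes> f = c"
    by (rule a_monic[OF ik]) (use c w(2) a(4) eR fR in \<open>auto simp: m_assoc[symmetric]\<close>)
  obtain v where v: "v \<in> carrier R" "a i k = w \<otimes> v" using w(3) by (auto simp: mem_l_coset_iff)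
  define v' where "v' = f \<otimes> v \<otimes> e i k"
  have "c \<otimes> v' = (c \<otimes> f) \<otimes> v \<otimes> e i k" using c(1) v(1) fR eR by (simp add: v'_def m_assoc)
  then have cv: "c \<otimes> v' = c \<otimes> v \<otimes> e i k" using cf by simp
  have "c \<otimes> v' = e i k"
  proof (rule a_monic[OF ik])
    have "a i k \<otimes> (c \<otimes> v') = w \<otimes> v \<otimes> e i k" unfolding cv c(3) using a(4) c(1) v(1) eR by (simp add: m_assoc)
    then show "a i k \<otimes> (c \<otimes> v') = a i k \<otimes> e i k" using v(2) by simp
    show "e i k \<otimes> (c \<otimes> v') = c \<otimes> v'" unfolding cv using c v(1) eR by (simp add: m_assoc[symmetric])
  qed (use cv c v eR in auto)
  moreover have "v' \<in> corner R f (e i k)" unfolding v'_def by (rule corner_sandwich[OF v(1) f e_idempotent[OF ik]])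
  moreover have "c \<in> corner R (e i k) f" using c cf by (simp add: corner_def)
  ultimately show ?thesis using c(3) by blast
qed

lemma quotient_fg:
  assumes il: "(i, l) \<in> harada_index m n" and k: "1 \<le> k" "k < l"
  shows "fg_module R (harada_quotient R e i k l)"
proof -
  have ik: "(i, k) \<in> harada_index m n" using index_le[OF il] k by simp
  obtain q where q: "q \<in> rmod_hom R (ideal_module R (P i k)) (harada_quotient R e i k l)"
    "q ` P i k = carrier (harada_quotient R e i k l)" "right_module R (harada_quotient R e i k l)"
    using quotient_projection[OF il k(1)] k by auto
  have "fg_module R (ideal_module R (P i k))"
    using principal_module_fg[OF a_props(4)[OF ik]] a_props(3)[OF ik] by simp
  then show ?thesis
    using finitely_generated_image[OF P_module[OF ik] q(3,1)] q(2,3)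
    by (simp add: fg_module_def sub_module_simps)
qed

text \<open>
  A submodule that contains the class of an element outside \<open>P i (k + 1)\<close> is everything. In a direct
  decomposition one of the two components of the class of the generator \<open>a i k\<close> is of this kind.
\<close>

lemma quotient_indecomposable:
  assumes il: "(i, l) \<in> harada_index m n" and k: "1 \<le> k" "k < l"
  shows "indecomposable_module R (harada_quotient R e i k l)" (is "indecomposable_module R ?Q")
proof -
  have ik: "(i, k) \<in> harada_index m n" and ik1: "(i, Suc k) \<in> harada_index m n" using index_le[OF il] k by auto
  obtain q where q: "q \<in> rmod_hom R (ideal_module R (P i k)) ?Q" "q ` P i k = carrier ?Q"
    and rQ: "right_module R ?Q" and q0: "\<And>x. x \<in> P i k \<Longrightarrow> q x = \<zero>\<^bsub>?Q\<^esub> \<longleftrightarrow> x \<in> P i l"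
    using quotient_projection[OF il k(1)] k by auto
  interpret Q: right_module R ?Q by (rule rQ)
  have rI: "right_module R (ideal_module R (P i k))" by (rule P_module[OF ik])
  have gen: "A = carrier ?Q" if A: "submodule A R ?Q" and w: "w \<in> P i k" "q w \<in> A" "w \<notin> P i (Suc k)" for A w
  proof -
    have S: "right_ideal R {x \<in> P i k. q x \<in> A}"
      using submodule_preimage[OF rI rQ q(1) A] submodule_ideal_module_iff[OF right_ideal_P[OF ik]]
      by (simp add: sub_module_simps)
    have "a i k \<in> w <# carrier R" using P_Suc_iff[OF ik1 k(1) w(1)] w(3) by blast
    then have "a i k \<in> {x \<in> P i k. q x \<in> A}" using principal_subset_right_ideal[OF S, of w] w by blast
    then have "P i k \<subseteq> {x \<in> P i k. q x \<in> A}"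
      using principal_subset_right_ideal[OF S, of "a i k"] a_props(3)[OF ik] by simp
    then have "carrier ?Q \<subseteq> A" unfolding q(2)[symmetric] by blast
    then show ?thesis using Q.submoduleD(1)[OF A] by blast
  qed
  show ?thesis
    unfolding indecomposable_module_def
  proof (intro conjI allI impI)
    have "a i k \<notin> P i l" by (rule a_notin_P[OF il k])
    then have "q (a i k) \<noteq> \<zero>\<^bsub>?Q\<^esub>" "q (a i k) \<in> carrier ?Q" using q0 a_in_P[OF ik] q(2) by auto
    then show "carrier ?Q \<noteq> {\<zero>\<^bsub>?Q\<^esub>}" by auto
  next
    fix A B
    assume AB: "submodule A R ?Q \<and> submodule B R ?Q \<and> A <+>\<^bsub>?Q\<^esub> B = carrier ?Q \<and> A \<inter> B = {\<zero>\<^bsub>?Q\<^esub>}"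
    then have A: "submodule A R ?Q" and B: "submodule B R ?Q" and sum: "A <+>\<^bsub>?Q\<^esub> B = carrier ?Q"
      and int: "A \<inter> B = {\<zero>\<^bsub>?Q\<^esub>}" by auto
    have "q (a i k) \<in> A <+>\<^bsub>?Q\<^esub> B" unfolding sum using q(2) a_in_P[OF ik] by blast
    then obtain u v where uv: "u \<in> A" "v \<in> B" "q (a i k) = u \<oplus>\<^bsub>?Q\<^esub> v" by (auto simp: set_add_def')
    then have "u \<in> q ` P i k" using Q.submoduleD(1)[OF A] q(2) by blast
    then obtain x where x: "x \<in> P i k" "u = q x" by blast
    define y where "y = a i k \<ominus> x"
    note I = right_ideal_P[OF ik]
    have aI: "a i k \<in> P i k" by (rule a_in_P[OF ik])
    have y: "y \<in> P i k" unfolding y_def minus_eq by (rule right_idealD(3)[OF I aI right_ideal_minus[OF I x(1)]])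
    have axy: "a i k = x \<oplus> y"
      using P_carrier[OF ik x(1)] a_props(4)[OF ik] by (simp add: y_def minus_eq a_ac r_neg1 r_neg2)
    have "q (a i k) = q x \<oplus>\<^bsub>?Q\<^esub> q y"
      unfolding axy using rmod_homD(2)[OF q(1), of x y] x y by (simp add: sub_module_simps regular_module_simps)
    moreover have "q y \<in> carrier ?Q" "q x \<in> carrier ?Q" using x y q(2) by auto
    ultimately have qy: "q y = v" using uv x Q.submoduleD(1)[OF B] by auto
    have "x \<notin> P i (Suc k) \<or> y \<notin> P i (Suc k)"
      using right_idealD(3)[OF right_ideal_P[OF ik1], of x y] axy a_notin_P[OF ik1 k(1)] by auto
    then have "A = carrier ?Q \<or> B = carrier ?Q"
      using gen[OF A x(1)] gen[OF B y] x(2) uv(1,2) qy by auto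
    then show "A = {\<zero>\<^bsub>?Q\<^esub>} \<or> B = {\<zero>\<^bsub>?Q\<^esub>}"
      using int Q.submoduleD(1)[OF A] Q.submoduleD(1)[OF B] by auto
  qed
qed

text \<open>
  In a resolution of length zero the augmentation \<open>\<epsilon>\<close> is an isomorphism, so the projection of \<open>P i k\<close> onto
  the quotient has a section \<open>s\<close>. Let \<open>w\<close> be the value of \<open>s\<close> at the class of \<open>a i k\<close>. It generates
  \<open>P i k\<close>, hence \<open>w = a i k c\<close> with \<open>c\<close> invertible in \<open>e i k R e i k\<close>. But the coefficient \<open>t\<close> of
  \<open>a i l = a i k t\<close> annihilates the class of \<open>a i k\<close>, so \<open>w t = 0\<close> and \<open>t = 0\<close>.
\<close>

lemma quotient_not_projective:
  assumes il: "(i, l) \<in> harada_index m n" and k: "1 \<le> k" "k < l"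
  shows "\<not> projective_resolution R (harada_quotient R e i k l) 0 Pr d \<epsilon>"
proof
  let ?Q = "harada_quotient R e i k l" and ?I = "ideal_module R (P i k)"
  assume res: "projective_resolution R ?Q 0 Pr d \<epsilon>"
  have ik: "(i, k) \<in> harada_index m n" using index_le[OF il] k by simp
  note a = a_props[OF ik] and eR = e_simps[OF ik]
  obtain q where q: "q \<in> rmod_hom R ?I ?Q" "q ` P i k = carrier ?Q"
    and rQ: "right_module R ?Q" and q0: "\<And>x. x \<in> P i k \<Longrightarrow> q x = \<zero>\<^bsub>?Q\<^esub> \<longleftrightarrow> x \<in> P i l"
    using quotient_projection[OF il k(1)] k by auto
  have rI: "right_module R ?I" by (rule P_module[OF ik])
  have proj: "projective_module R (Pr j)" for j using res by (simp add: projective_resolution_def)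
  have rP: "right_module R (Pr j)" for j using proj[of j] by (simp add: projective_module_def fg_module_def)
  have \<epsilon>: "\<epsilon> \<in> rmod_hom R (Pr 0) ?Q" "\<epsilon> ` carrier (Pr 0) = carrier ?Q"
    and P1: "carrier (Pr 1) = {\<zero>\<^bsub>Pr 1\<^esub>}" and d: "d 0 \<in> rmod_hom R (Pr 1) (Pr 0)"
    using res by (simp_all add: projective_resolution_def)
  have ker: "d 0 ` carrier (Pr 1) = a_kernel (Pr 0) ?Q \<epsilon>"
    using res unfolding projective_resolution_def by blast
  interpret Q: right_module R ?Q by (rule rQ)
  interpret P0: right_module R "Pr 0" by (rule rP)
  have \<epsilon>0: "p = \<zero>\<^bsub>Pr 0\<^esub>" if "p \<in> carrier (Pr 0)" "\<epsilon> p = \<zero>\<^bsub>?Q\<^esub>" for p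
  proof -
    have "p \<in> d 0 ` carrier (Pr 1)" unfolding ker using that by (simp add: a_kernel_iff)
    then show ?thesis unfolding P1 using rmod_hom_zero[OF rP rP d] by simp
  qed
  have \<epsilon>inj: "p = p'" if "p \<in> carrier (Pr 0)" "p' \<in> carrier (Pr 0)" "\<epsilon> p = \<epsilon> p'" for p p'
  proof -
    have "\<epsilon> (p \<ominus>\<^bsub>Pr 0\<^esub> p') = \<zero>\<^bsub>?Q\<^esub>" using rmod_hom_eq_iff[OF rP rQ \<epsilon>(1) that(1,2)] that(3) by simp
    then have "p \<ominus>\<^bsub>Pr 0\<^esub> p' = \<zero>\<^bsub>Pr 0\<^esub>" using \<epsilon>0 that(1,2) by simp
    moreover have "(\<lambda>p. p) \<in> rmod_hom R (Pr 0) (Pr 0)" by (rule rmod_homI) auto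
    ultimately show ?thesis using rmod_hom_eq_iff[OF rP rP _ that(1,2)] by blast
  qed
  have bij: "bij_betw \<epsilon> (carrier (Pr 0)) (carrier ?Q)"
    unfolding bij_betw_def inj_on_def using \<epsilon>inj \<epsilon>(2) by blast
  let ?\<eta> = "inv_into (carrier (Pr 0)) \<epsilon>"
  have \<eta>: "?\<eta> \<in> rmod_hom R ?Q (Pr 0)" by (rule rmod_hom_inverse[OF \<epsilon>(1) bij rP])
  have \<epsilon>\<eta>: "\<epsilon> (?\<eta> y) = y" if "y \<in> carrier ?Q" for y using that \<epsilon>(2) by (simp add: f_inv_into_f)
  have \<eta>\<epsilon>: "?\<eta> (\<epsilon> p) = p" if "p \<in> carrier (Pr 0)" for p using that bij by (simp add: bij_betw_def inv_into_f_f)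
  \<comment> \<open>split the projection onto the quotient\<close>
  let ?C = "copy_module const_code ?I" and ?dec = "inv_into (carrier ?I) const_code"
  note C = copy_module[OF rI inj_const_code]
  have g: "(\<lambda>u. ?\<eta> (q (?dec u))) \<in> rmod_hom R ?C (Pr 0)"
    by (rule rmod_hom_comp[OF C(3) rmod_hom_comp[OF q(1) \<eta>]])
  have dec: "?dec (const_code x) = x" if "x \<in> P i k" for x
    by (rule inv_into_f_f[OF inj_const_code]) (use that in \<open>simp add: sub_module_simps\<close>)
  have "(\<lambda>u. ?\<eta> (q (?dec u))) ` carrier ?C = carrier (Pr 0)"
  proof
    show "(\<lambda>u. ?\<eta> (q (?dec u))) ` carrier ?C \<subseteq> carrier (Pr 0)" using rmod_homD(1)[OF g] by blast
    show "carrier (Pr 0) \<subseteq> (\<lambda>u. ?\<eta> (q (?dec u))) ` carrier ?C"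
    proof
      fix p assume p: "p \<in> carrier (Pr 0)"
      then have "\<epsilon> p \<in> q ` P i k" using q(2) rmod_homD(1)[OF \<epsilon>(1)] by blast
      then obtain x where x: "x \<in> P i k" "\<epsilon> p = q x" by blast
      then have "p = ?\<eta> (q (?dec (const_code x)))" using \<eta>\<epsilon>[OF p] dec by simp
      moreover have "const_code x \<in> carrier ?C" using x by (simp add: C(4) sub_module_simps)
      ultimately show "p \<in> (\<lambda>u. ?\<eta> (q (?dec u))) ` carrier ?C" by (rule image_eqI)
    qed
  qed
  moreover have "(\<lambda>p. p) \<in> rmod_hom R (Pr 0) (Pr 0)" by (rule rmod_homI) auto
  moreover have "fg_module R ?C"
    using copy_module_fg[OF principal_module_fg[OF a(4)] inj_const_code] a(3) by simp
  moreover have "fg_module R (Pr 0)" using proj by (simp add: projective_module_def)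
  ultimately obtain h where h: "h \<in> rmod_hom R (Pr 0) ?C" "\<forall>p \<in> carrier (Pr 0). ?\<eta> (q (?dec (h p))) = p"
    using proj[of 0] g unfolding projective_module_def by meson
  define s where "s p = ?dec (h p)" for p
  have s: "s \<in> rmod_hom R (Pr 0) ?I" unfolding s_def by (rule rmod_hom_comp[OF h(1) C(3)])
  have sI: "s p \<in> P i k" if "p \<in> carrier (Pr 0)" for p using rmod_homD(1)[OF s that] by (simp add: sub_module_simps)
  have s_smult: "s (r \<odot>\<^bsub>Pr 0\<^esub> p) = s p \<otimes> r" if "r \<in> carrier R" "p \<in> carrier (Pr 0)" for r p
    using rmod_homD(3)[OF s that] by (simp add: sub_module_simps regular_module_simps)
  have q_smult: "q (x \<otimes> r) = r \<odot>\<^bsub>?Q\<^esub> q x" if "r \<in> carrier R" "x \<in> P i k" for r x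
    using rmod_homD(3)[OF q(1) that(1), of x] that by (simp add: sub_module_simps regular_module_simps)
  have qs: "q (s p) = \<epsilon> p" if p: "p \<in> carrier (Pr 0)" for p
  proof -
    have "q (s p) \<in> carrier ?Q" using sI[OF p] q(2) by blast
    then have "\<epsilon> (?\<eta> (q (s p))) = q (s p)" by (rule \<epsilon>\<eta>)
    then show ?thesis using h(2) p by (simp add: s_def)
  qed
  define y where "y = ?\<eta> (q (a i k))"
  have aI: "a i k \<in> P i k" by (rule a_in_P[OF ik])
  have qa: "q (a i k) \<in> carrier ?Q" using q(2) aI by blast
  have y: "y \<in> carrier (Pr 0)" "\<epsilon> y = q (a i k)" using rmod_homD(1)[OF \<eta> qa] \<epsilon>\<eta>[OF qa] by (simp_all add: y_def)
  have y_smult: "\<epsilon> (r \<odot>\<^bsub>Pr 0\<^esub> y) = q (a i k \<otimes> r)" if "r \<in> carrier R" for r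
    using rmod_homD(3)[OF \<epsilon>(1) that y(1)] q_smult[OF that aI] y(2) by simp
  have ye: "e i k \<odot>\<^bsub>Pr 0\<^esub> y = y"
    by (rule \<epsilon>inj) (use y y_smult[OF eR(1)] a(6) eR in auto)
  define w where "w = s y"
  have w: "w \<in> P i k" "w \<otimes> e i k = w" using sI[OF y(1)] s_smult[OF eR(1) y(1)] ye by (simp_all add: w_def)
  have "q (a i k) = q w" using qs[OF y(1)] y(2) by (simp add: w_def)
  then have "q (a i k \<ominus>\<^bsub>?I\<^esub> w) = \<zero>\<^bsub>?Q\<^esub>"
    using rmod_hom_eq_iff[OF rI rQ q(1), of "a i k" w] aI w(1) by (simp add: sub_module_simps)
  moreover have "a i k \<ominus>\<^bsub>?I\<^esub> w = a i k \<ominus> w \<otimes> \<one>" 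
    using ideal_module_minus[OF right_ideal_P[OF ik] aI w(1)] P_carrier[OF ik w(1)] by simp
  moreover have "a i k \<ominus> w \<otimes> \<one> \<in> P i k"
    using right_idealD(3)[OF right_ideal_P[OF ik] aI right_ideal_minus[OF right_ideal_P[OF ik] w(1)]] P_carrier[OF ik w(1)]
    by (simp add: minus_eq)
  ultimately have "a i k \<ominus> w \<otimes> \<one> \<in> P i l" using q0 by simp
  then have "a i k \<in> w <# carrier R" by (rule lift_generates[OF il k w(1) one_closed])
  then obtain c v where c: "c \<in> corner R (e i k) (e i k)" "v \<in> corner R (e i k) (e i k)" "w = a i k \<otimes> c" "c \<otimes> v = e i k"
    using generator_coefficient[OF ik e_idempotent[OF ik] w] by blast
  have vc: "v \<otimes> c = e i k"
    by (rule retract_of_primitive[OF e_idempotent[OF ik] eR(3) e_primitive[OF ik] c(1,2,4)])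
  obtain t where t: "t \<in> carrier R" "e i k \<otimes> t = t" "a i l = a i k \<otimes> t" "t \<noteq> \<zero>"
    using a_multiple[OF il k(1)] k by auto
  note cR = cornerD[OF c(1)] and vR = cornerD[OF c(2)]
  have "\<epsilon> (t \<odot>\<^bsub>Pr 0\<^esub> y) = \<zero>\<^bsub>?Q\<^esub>"
    unfolding y_smult[OF t(1)] t(3)[symmetric] using q0[of "a i l"] a_in_P[OF il] P_antimono[OF il k(1)] k by auto
  then have "t \<odot>\<^bsub>Pr 0\<^esub> y = \<zero>\<^bsub>Pr 0\<^esub>" using \<epsilon>0 t(1) y(1) by simp
  then have "w \<otimes> t = \<zero>"
    using s_smult[OF t(1) y(1)] rmod_hom_zero[OF rP rI s] by (simp add: w_def sub_module_simps regular_module_simps)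
  then have "a i k \<otimes> (c \<otimes> t) = \<zero>" unfolding c(3) using a(4) cR t(1) by (simp add: m_assoc)
  then have "c \<otimes> t = \<zero>"
    using monicD[OF a(2), of "c \<otimes> t"] cR t(1) eR by (simp add: m_assoc[symmetric])
  then have "(v \<otimes> c) \<otimes> t = \<zero>" using vR(1) cR(1) t(1) by (simp add: m_assoc)
  then show False using vc t by simp
qed

lemma quotient_projective_dimension:
  assumes il: "(i, l) \<in> harada_index m n" and k: "1 \<le> k" "k < l"
  shows "projective_dimension R (harada_quotient R e i k l) = 1"
proof -
  have ik: "(i, k) \<in> harada_index m n" using index_le[OF il] k by simp
  obtain q where q: "q \<in> rmod_hom R (ideal_module R (P i k)) (harada_quotient R e i k l)"
    "q ` P i k = carrier (harada_quotient R e i k l)" "right_module R (harada_quotient R e i k l)"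
    "\<And>x. x \<in> P i k \<Longrightarrow> q x = \<zero>\<^bsub>harada_quotient R e i k l\<^esub> \<longleftrightarrow> x \<in> P i l"
    using quotient_projection[OF il k(1)] k by auto
  have "\<exists>Pr d \<epsilon>. projective_resolution R (harada_quotient R e i k l) 1 Pr d \<epsilon>"
    using resolution_of_ideal_quotient[OF P_cyclic_projective[OF ik] P_cyclic_projective[OF il] _ q(3,1,2,4)]
      P_antimono[OF il k(1)] k by auto
  then show ?thesis unfolding projective_dimension_eq_1_iff using quotient_not_projective[OF il k] by blast
qed

text \<open>
  Lift the image of the class of \<open>a i k\<close> to an element \<open>w\<close> of \<open>P i' k'\<close>. It generates \<open>P i' k'\<close>, so its
  coefficient \<open>c\<close> gives an isomorphism \<open>e i k R \<cong> e i' k' R\<close>, and \<open>(i, k) = (i', k')\<close> because the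
  algebra is basic. The lift of \<open>c\<close> to an automorphism of \<open>P i 1\<close> preserves all layers; as it carries the
  kernel \<open>P i l\<close> to the kernel \<open>P i l'\<close>, these are equal.
\<close>

lemma quotient_iso_unique:
  assumes il: "(i, l) \<in> harada_index m n" and k: "1 \<le> k" "k < l"
    and il': "(i', l') \<in> harada_index m n" and k': "1 \<le> k'" "k' < l'"
    and iso: "rmod_iso R (harada_quotient R e i k l) (harada_quotient R e i' k' l')"
  shows "i = i' \<and> k = k' \<and> l = l'"
proof -
  let ?Q = "harada_quotient R e i k l" and ?Q' = "harada_quotient R e i' k' l'"
  have ik: "(i, k) \<in> harada_index m n" and ik': "(i', k') \<in> harada_index m n"
    using index_le[OF il] index_le[OF il'] k k' by auto
  note a = a_props[OF ik] and eR = e_simps[OF ik] and a' = a_props[OF ik'] and eR' = e_simps[OF ik']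
  obtain q where q: "q \<in> rmod_hom R (ideal_module R (P i k)) ?Q" "q ` P i k = carrier ?Q"
    and rQ: "right_module R ?Q" and q0: "\<And>x. x \<in> P i k \<Longrightarrow> q x = \<zero>\<^bsub>?Q\<^esub> \<longleftrightarrow> x \<in> P i l"
    using quotient_projection[OF il k(1)] k by auto
  obtain q' where q': "q' \<in> rmod_hom R (ideal_module R (P i' k')) ?Q'" "q' ` P i' k' = carrier ?Q'"
    and rQ': "right_module R ?Q'" and q0': "\<And>x. x \<in> P i' k' \<Longrightarrow> q' x = \<zero>\<^bsub>?Q'\<^esub> \<longleftrightarrow> x \<in> P i' l'"
    using quotient_projection[OF il' k'(1)] k' by auto
  obtain f where f: "f \<in> rmod_hom R ?Q ?Q'" and bij: "bij_betw f (carrier ?Q) (carrier ?Q')"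
    using iso by (auto simp: rmod_iso_def)
  have q_smult: "q (x \<otimes> r) = r \<odot>\<^bsub>?Q\<^esub> q x" if "r \<in> carrier R" "x \<in> P i k" for r x
    using rmod_homD(3)[OF q(1) that(1), of x] that by (simp add: sub_module_simps regular_module_simps)
  have q'_smult: "q' (x \<otimes> r) = r \<odot>\<^bsub>?Q'\<^esub> q' x" if "r \<in> carrier R" "x \<in> P i' k'" for r x
    using rmod_homD(3)[OF q'(1) that(1), of x] that by (simp add: sub_module_simps regular_module_simps)
  have aI: "a i k \<in> P i k" and aI': "a i' k' \<in> P i' k'" using a_in_P ik ik' by auto
  note I = right_ideal_P[OF ik] and I' = right_ideal_P[OF ik']
  define y where "y = f (q (a i k))"
  have qa: "q (a i k) \<in> carrier ?Q" using q(2) aI by blast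
  have y: "y \<in> carrier ?Q'" unfolding y_def by (rule rmod_homD(1)[OF f qa])
  have y_smult: "r \<odot>\<^bsub>?Q'\<^esub> y = f (q (a i k \<otimes> r))" if "r \<in> carrier R" for r
    using rmod_homD(3)[OF f that qa] q_smult[OF that aI] by (simp add: y_def)
  have "y \<in> q' ` P i' k'" using y q'(2) by simp
  then obtain w0 where w0: "w0 \<in> P i' k'" "y = q' w0" by blast
  define w where "w = w0 \<otimes> e i k"
  have w: "w \<in> P i' k'" unfolding w_def by (rule right_idealD(4)[OF I' w0(1) eR(1)])
  have wR: "w0 \<in> carrier R" "w \<in> carrier R" using P_carrier[OF ik'] w0 w by auto
  have qw: "q' w = y"
    using q'_smult[OF eR(1) w0(1)] y_smult[OF eR(1)] a(6) w0(2) by (simp add: w_def y_def)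
  have we: "w \<otimes> e i k = w" using wR eR by (simp add: w_def m_assoc)
  have qw_smult: "q' (w \<otimes> r) = f (q (a i k \<otimes> r))" if "r \<in> carrier R" for r
    using q'_smult[OF that w] qw y_smult[OF that] by simp
  have "q' (a i' k') \<in> f ` carrier ?Q" using bij q'(2) aI' by (auto simp: bij_betw_def)
  then obtain x where x: "x \<in> P i k" "q' (a i' k') = f (q x)" unfolding q(2)[symmetric] image_image by blast
  obtain r where r: "r \<in> carrier R" "x = a i k \<otimes> r" using x(1) mem_P_iff[OF ik] by blast
  have "q' (a i' k') = q' (w \<otimes> r)" using x(2) r qw_smult by simp
  then have "q' (a i' k' \<ominus>\<^bsub>ideal_module R (P i' k')\<^esub> w \<otimes> r) = \<zero>\<^bsub>?Q'\<^esub>"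
    using rmod_hom_eq_iff[OF P_module[OF ik'] rQ' q'(1), of "a i' k'" "w \<otimes> r"] aI' right_idealD(4)[OF I' w r(1)]
    by (simp add: sub_module_simps)
  then have "q' (a i' k' \<ominus> w \<otimes> r) = \<zero>\<^bsub>?Q'\<^esub>"
    using ideal_module_minus[OF I' aI' right_idealD(4)[OF I' w r(1)]] by simp
  moreover have "a i' k' \<ominus> w \<otimes> r \<in> P i' k'"
    using right_idealD(3)[OF I' aI' right_ideal_minus[OF I' right_idealD(4)[OF I' w r(1)]]] by (simp add: minus_eq)
  ultimately have "a i' k' \<ominus> w \<otimes> r \<in> P i' l'" using q0' by simp
  then have "a i' k' \<in> w <# carrier R" by (rule lift_generates[OF il' k' w r(1)])
  then obtain c v where c: "c \<in> corner R (e i' k') (e i k)" "v \<in> corner R (e i k) (e i' k')" "w = a i' k' \<otimes> c"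
    "c \<otimes> v = e i' k'"
    using generator_coefficient[OF ik' e_idempotent[OF ik] w we] by blast
  have vc: "v \<otimes> c = e i k"
    by (rule retract_of_primitive[OF e_idempotent[OF ik'] eR'(3) e_primitive[OF ik] c(1,2,4)])
  have eq: "i' = i \<and> k' = k" by (rule e_isomorphic_eq[OF ik' ik c(1,2,4) vc])
  then have i'[simp]: "i' = i" and k'_eq[simp]: "k' = k" by auto
  note cR = cornerD[OF c(1)[simplified]] and vR = cornerD[OF c(2)[simplified]]
  have mon: "monic R (e i k) c"
    unfolding monic_def
  proof (intro ballI impI)
    fix u assume u: "u \<in> carrier R" "e i k \<otimes> u = u \<and> c \<otimes> u = \<zero>"
    then have "(v \<otimes> c) \<otimes> u = \<zero>" using cR(1) vR(1) by (simp add: m_assoc)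
    then show "u = \<zero>" using vc u by simp
  qed
  obtain C D where C: "C \<in> corner R (e i 1) (e i 1)" and D: "D \<in> corner R (e i 1) (e i 1)"
    and CD: "C \<otimes> D = e i 1" "D \<otimes> C = e i 1" and lift: "C \<otimes> a i k = a i k \<otimes> c"
    using monic_lift[OF ik ik c(1)[simplified] mon] by blast
  note CR = cornerD(1)[OF C] and DR = cornerD(1)[OF D]
  have ill': "(i, l') \<in> harada_index m n" using il' by simp
  have key: "x \<in> P i l \<longleftrightarrow> x \<in> P i l'" if x: "x \<in> P i k" for x
  proof -
    obtain t where t: "t \<in> carrier R" "e i k \<otimes> t = t" "x = a i k \<otimes> t" using x mem_P_iff[OF ik] by blast
    have wt: "w \<otimes> t = C \<otimes> x" using c(3) lift t CR a(4) cR by (simp add: m_assoc[symmetric])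
    have "x \<in> P i l \<longleftrightarrow> q x = \<zero>\<^bsub>?Q\<^esub>" using q0[OF x] by simp
    also have "\<dots> \<longleftrightarrow> f (q x) = \<zero>\<^bsub>?Q'\<^esub>"
    proof -
      interpret Q: right_module R ?Q by (rule rQ)
      have "q x \<in> carrier ?Q" using x q(2) by blast
      then have "f (q x) = f \<zero>\<^bsub>?Q\<^esub> \<longleftrightarrow> q x = \<zero>\<^bsub>?Q\<^esub>"
        by (rule inj_on_eq_iff[OF bij_betw_imp_inj_on[OF bij] _ Q.M.zero_closed])
      then show ?thesis unfolding rmod_hom_zero[OF rQ rQ' f] by simp
    qed
    also have "\<dots> \<longleftrightarrow> q' (w \<otimes> t) = \<zero>\<^bsub>?Q'\<^esub>" using qw_smult[OF t(1)] t(3) by simp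
    also have "\<dots> \<longleftrightarrow> C \<otimes> x \<in> P i l'" using q0'[of "w \<otimes> t"] right_idealD(4)[OF I' w t(1)] wt by simp
    also have "\<dots> \<longleftrightarrow> x \<in> P i l'"
    proof
      assume "C \<otimes> x \<in> P i l'"
      then have "D \<otimes> (C \<otimes> x) \<in> P i l'" by (rule unit_preserves_P[OF ill' D C CD(2,1)])
      moreover have "D \<otimes> (C \<otimes> x) = e i 1 \<otimes> x" using CD(2) CR DR P_carrier[OF ik x] by (simp add: m_assoc[symmetric])
      moreover have "e i 1 \<otimes> x = x" using t a e_simps[OF index_first[OF ik]] by (simp add: m_assoc[symmetric])
      ultimately show "x \<in> P i l'" by simp
    qed (rule unit_preserves_P[OF ill' C D CD])
    finally show ?thesis .
  qed
  have "a i l \<in> P i l'" using key[of "a i l"] a_in_P[OF il] P_antimono[OF il k(1)] k by auto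
  then have "\<not> l < l'" using a_notin_P[OF ill', of l] il by (auto simp: index_iff)
  moreover have "a i l' \<in> P i l" using key[of "a i l'"] a_in_P[OF ill'] P_antimono[OF ill' k(1)] k' by auto
  then have "\<not> l' < l" using a_notin_P[OF il, of l'] il' by (auto simp: index_iff)
  ultimately show ?thesis using eq by simp
qed

end

context left_harada
begin

section \<open>Modules of projective dimension one\<close>

text \<open>
  Both modules are quotients of \<open>e i k R \<cong> P i k\<close> by the same submodule.
\<close>

lemma cyclic_module_iso_quotient:
  assumes M: "right_module R M" and ik: "(i, k) \<in> harada_index m n" and il: "(i, l) \<in> harada_index m n" and kl: "k \<le> l"
    and z: "z \<in> carrier M" "e i k \<odot>\<^bsub>M\<^esub> z = z" and gen: "\<And>y. y \<in> carrier M \<Longrightarrow> \<exists>u \<in> carrier R. y = u \<odot>\<^bsub>M\<^esub> z"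
    and ann: "\<And>u. \<lbrakk>u \<in> carrier R; e i k \<otimes> u = u\<rbrakk> \<Longrightarrow> u \<odot>\<^bsub>M\<^esub> z = \<zero>\<^bsub>M\<^esub> \<longleftrightarrow> a i k \<otimes> u \<in> P i l"
  shows "rmod_iso R M (harada_quotient R e i k l)"
proof -
  interpret M: right_module R M by fact
  note a = a_props[OF ik] and eR = e_simps[OF ik] and I = right_ideal_P[OF ik]
  let ?I = "ideal_module R (P i k)"
  note simps = sub_module_simps regular_module_simps
  have fix_e: "a i k \<otimes> (e i k \<otimes> u) = a i k \<otimes> u" "(e i k \<otimes> u) \<odot>\<^bsub>M\<^esub> z = u \<odot>\<^bsub>M\<^esub> z" "e i k \<otimes> (e i k \<otimes> u) = e i k \<otimes> u"
    if "u \<in> carrier R" for u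
    using that a eR z by (simp_all add: m_assoc[symmetric] M.smult_assoc)
  have ann': "u \<odot>\<^bsub>M\<^esub> z = \<zero>\<^bsub>M\<^esub> \<longleftrightarrow> a i k \<otimes> u \<in> P i l" if u: "u \<in> carrier R" for u
    using ann[of "e i k \<otimes> u"] fix_e[OF u] u eR by simp
  have "\<zero> \<in> P i l" by (rule right_idealD(2)[OF right_ideal_P[OF il]])
  then have "\<exists>h \<in> rmod_hom R ?I M. \<forall>u \<in> carrier R. h (u \<odot>\<^bsub>?I\<^esub> a i k) = u \<odot>\<^bsub>M\<^esub> z"
    using a_in_P[OF ik] mem_P_iff[OF ik] z(1) ann'
    by (intro cyclic_hom[OF P_module[OF ik] M]) (auto simp: simps)
  then obtain f where f: "f \<in> rmod_hom R ?I M" "\<And>u. u \<in> carrier R \<Longrightarrow> f (a i k \<otimes> u) = u \<odot>\<^bsub>M\<^esub> z"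
    by (auto simp: simps)
  have "f ` carrier ?I = carrier M"
  proof
    show "f ` carrier ?I \<subseteq> carrier M" using rmod_homD(1)[OF f(1)] by blast
    show "carrier M \<subseteq> f ` carrier ?I"
    proof
      fix y assume "y \<in> carrier M"
      then obtain u where u: "u \<in> carrier R" "y = f (a i k \<otimes> u)" using gen f(2) by metis
      then show "y \<in> f ` carrier ?I" using right_idealD(4)[OF I a_in_P[OF ik] u(1)] by (simp add: simps)
    qed
  qed
  moreover have "submodule (P i l) R ?I"
    using submodule_ideal_module_iff[OF I] right_ideal_P[OF il] P_antimono[OF il _ kl] ik by (simp add: index_iff)
  moreover have "f x = \<zero>\<^bsub>M\<^esub> \<longleftrightarrow> x \<in> P i l" if x: "x \<in> carrier ?I" for x
  proof -
    obtain u where "u \<in> carrier R" "x = a i k \<otimes> u" using x mem_P_iff[OF ik] by (auto simp: simps)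
    then show ?thesis using f(2) ann' by simp
  qed
  ultimately show ?thesis
    unfolding harada_quotient_def by (intro first_isomorphism[OF P_module[OF ik] M f(1)]) simp_all
qed

text \<open>
  The assumptions make \<open>u \<mapsto> z u\<close> an isomorphism from \<open>e i k R\<close> to \<open>M\<close>.
\<close>

lemma free_cyclic_module_resolution:
  assumes M: "right_module R M" and ik: "(i, k) \<in> harada_index m n"
    and z: "z \<in> carrier M" "e i k \<odot>\<^bsub>M\<^esub> z = z" and gen: "\<And>y. y \<in> carrier M \<Longrightarrow> \<exists>u \<in> carrier R. y = u \<odot>\<^bsub>M\<^esub> z"
    and free: "\<And>u. \<lbrakk>u \<in> carrier R; e i k \<otimes> u = u; u \<odot>\<^bsub>M\<^esub> z = \<zero>\<^bsub>M\<^esub>\<rbrakk> \<Longrightarrow> u = \<zero>"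
  shows "\<exists>Pr d \<epsilon>. projective_resolution R M 0 Pr d \<epsilon>"
proof -
  interpret M: right_module R M by fact
  note eR = e_simps[OF ik]
  let ?I = "e i k <# carrier R"
  have mem: "u \<in> ?I \<longleftrightarrow> u \<in> carrier R \<and> e i k \<otimes> u = u" for u
    by (rule mem_idempotent_right_ideal_iff[OF e_idempotent[OF ik]])
  have "monic R (e i k) (e i k)" by (auto simp: monic_def)
  then have I: "cyclic_projective_ideal R ?I"
    unfolding cyclic_projective_ideal_def using e_idempotent[OF ik] eR by blast
  have q: "(\<lambda>u. u \<odot>\<^bsub>M\<^esub> z) \<in> rmod_hom R (ideal_module R ?I) M"
    using M.action_hom[OF z(1)] by (auto simp: rmod_hom_def sub_module_simps regular_module_simps mem)
  have "(\<lambda>u. u \<odot>\<^bsub>M\<^esub> z) ` ?I = carrier M"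
  proof
    show "(\<lambda>u. u \<odot>\<^bsub>M\<^esub> z) ` ?I \<subseteq> carrier M" using z by (auto simp: mem)
    show "carrier M \<subseteq> (\<lambda>u. u \<odot>\<^bsub>M\<^esub> z) ` ?I"
    proof
      fix y assume "y \<in> carrier M"
      then obtain u where u: "u \<in> carrier R" "y = u \<odot>\<^bsub>M\<^esub> z" using gen by blast
      then have "y = (e i k \<otimes> u) \<odot>\<^bsub>M\<^esub> z" "e i k \<otimes> u \<in> ?I"
        using eR z by (auto simp: M.smult_assoc mem m_assoc[symmetric])
      then show "y \<in> (\<lambda>u. u \<odot>\<^bsub>M\<^esub> z) ` ?I" by blast
    qed
  qed
  moreover have "x \<odot>\<^bsub>M\<^esub> z = \<zero>\<^bsub>M\<^esub> \<longleftrightarrow> x \<in> {\<zero>}" if "x \<in> ?I" for x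
    using that free z by (auto simp: mem)
  moreover have "{\<zero>} \<subseteq> ?I" using eR by (simp add: mem)
  ultimately show ?thesis
    using resolution_of_ideal_quotient[OF I cyclic_projective_ideal_zero _ M q, of 0] by blast
qed

text \<open>
  The pivot is an injective entry \<open>r b s0\<close> from \<open>P i l\<close> to \<open>P i k\<close>, in a column with \<open>l\<close> minimal and,
  among the injective entries of this column, in a row with \<open>k\<close> maximal. The entries of column \<open>s0\<close>
  are left multiples \<open>c t (r b s0)\<close> of it. Replacing the generator \<open>z b\<close> by \<open>z b + \<Sum> z t c t\<close>
  therefore turns the relation in column \<open>s0\<close> into \<open>z' b (r b s0) = 0\<close>. All entries of row \<open>b\<close> are
  right multiples of \<open>r b s0\<close>, so the coefficient of \<open>z' b\<close> in any relation is one as well. Hence \<open>z' b R\<close> is a direct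
  summand with annihilator \<open>r b s0 R\<close>, that is, a copy of \<open>P\<^sub>i\<^sub>k / P\<^sub>i\<^sub>l\<close>.
\<close>

lemma minimal_presentation_cyclic:
  assumes M: "right_module R M" and ind: "indecomposable_module R M"
    and pres: "presentation R M E T z G S r" and ET: "E \<in> T \<rightarrow> prims" and GS: "G \<in> S \<rightarrow> prims" and ne: "S \<noteq> {}"
    and minimal: "\<And>b s x. \<lbrakk>b \<in> T; s \<in> S; x \<in> carrier R\<rbrakk> \<Longrightarrow> r b s \<otimes> x \<noteq> E b"
  shows "\<exists>i k l. 1 \<le> i \<and> i \<le> m \<and> 1 \<le> k \<and> k < l \<and> l \<le> n i \<and> rmod_iso R M (harada_quotient R e i k l)"
proof -
  interpret M: right_module R M by fact
  note [simp] = regular_module_simps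
  note sp = presentationD(1)[OF pres] and S = presentationD(2)[OF pres] and rc = presentationD(3)[OF pres]
    and col = presentationD(4)[OF pres] and rel = presentationD(5)[OF pres] and indep = presentationD(6)[OF pres]
  note T = spansD(1)[OF sp] and zM = spansD(2)[OF sp] and zE = spansD(3)[OF sp]
  have "\<forall>t \<in> T. \<exists>p. p \<in> harada_index m n \<and> E t = e (fst p) (snd p)" using ET by (fastforce simp: prims_iff)
  then obtain \<sigma> where \<sigma>: "\<And>t. t \<in> T \<Longrightarrow> \<sigma> t \<in> harada_index m n" "\<And>t. t \<in> T \<Longrightarrow> E t = e (fst (\<sigma> t)) (snd (\<sigma> t))"
    by metis
  have "\<forall>s \<in> S. \<exists>p. p \<in> harada_index m n \<and> G s = e (fst p) (snd p)" using GS by (fastforce simp: prims_iff)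
  then obtain \<tau> where \<tau>: "\<And>s. s \<in> S \<Longrightarrow> \<tau> s \<in> harada_index m n" "\<And>s. s \<in> S \<Longrightarrow> G s = e (fst (\<tau> s)) (snd (\<tau> s))"
    by metis
  have \<sigma>': "(fst (\<sigma> t), snd (\<sigma> t)) \<in> harada_index m n" if "t \<in> T" for t using \<sigma>(1)[OF that] by simp
  have \<tau>': "(fst (\<tau> s), snd (\<tau> s)) \<in> harada_index m n" if "s \<in> S" for s using \<tau>(1)[OF that] by simp
  have idE: "idempotent_elt R (E t)" if "t \<in> T" for t using e_idempotent[OF \<sigma>'[OF that]] \<sigma>(2)[OF that] by simp
  have ER: "E t \<in> carrier R" "E t \<otimes> E t = E t" if "t \<in> T" for t using idE[OF that] by (auto simp: idempotent_elt_def)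
  have GR: "G s \<in> carrier R" "G s \<otimes> G s = G s" if "s \<in> S" for s using e_simps[OF \<tau>'[OF that]] \<tau>(2)[OF that] by simp_all
  have rR: "r t s \<in> carrier R" "E t \<otimes> r t s = r t s" "r t s \<otimes> G s = r t s" if "t \<in> T" "s \<in> S" for t s
    using cornerD[OF rc[OF that]] by auto
  \<comment> \<open>\<open>l\<close> minimal means \<open>P i l\<close> maximal, so that the images of the other columns fit into it\<close>
  obtain s1 where "s1 \<in> S" using ne by blast
  then obtain s0 where s0: "s0 \<in> S" "\<And>s. s \<in> S \<Longrightarrow> snd (\<tau> s0) \<le> snd (\<tau> s)"
    using ex_has_least_nat[of "\<lambda>s. s \<in> S" s1 "\<lambda>s. snd (\<tau> s)"] by blast
  define i l where "i = fst (\<tau> s0)" and "l = snd (\<tau> s0)"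
  have il: "(i, l) \<in> harada_index m n" and G0: "G s0 = e i l" using \<tau>'[OF s0(1)] \<tau>(2)[OF s0(1)] by (simp_all add: i_def l_def)
  \<comment> \<open>the map of the presentation is injective, so the entries of column \<open>s0\<close> have no common kernel\<close>
  define B where "B = {t \<in> T. monic R (e i l) (r t s0)}"
  have "\<exists>t \<in> T. monic R (e i l) (r t s0)"
  proof (rule jointly_monic[OF il T])
    show "r t s0 \<in> carrier R" if "t \<in> T" for t using rR(1)[OF that s0(1)] .
    fix u assume u: "u \<in> carrier R" "e i l \<otimes> u = u" "\<And>t. t \<in> T \<Longrightarrow> r t s0 \<otimes> u = \<zero>"
    let ?d = "\<lambda>s. if s0 = s then u else \<zero>"
    have d: "?d \<in> coefs R G S" using u GR G0 by (auto simp: coefs_def)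
    have "lincomb (regular_module R) S ?d (r t) = \<zero>" if t: "t \<in> T" for t
      using M.regular.lincomb_single[OF S s0(1), of "r t" u] rR(1)[OF t] u(1) u(3)[OF t] by auto
    then show "u = \<zero>" using indep[OF d] s0(1) by auto
  qed
  then have B: "finite B" "B \<noteq> {}" using T by (auto simp: B_def)
  \<comment> \<open>\<open>k\<close> maximal means \<open>P i k\<close> minimal, so that the pivot factors every injective entry of the column\<close>
  have "Max ((\<lambda>t. snd (\<sigma> t)) ` B) \<in> (\<lambda>t. snd (\<sigma> t)) ` B" by (rule Max_in) (use B in auto)
  then obtain b where "b \<in> B" "Max ((\<lambda>t. snd (\<sigma> t)) ` B) = snd (\<sigma> b)" by blast
  then have b: "b \<in> B" "\<And>t. t \<in> B \<Longrightarrow> snd (\<sigma> t) \<le> snd (\<sigma> b)"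
    using Max_ge[of "(\<lambda>t. snd (\<sigma> t)) ` B"] B(1) by force+
  have bT: "b \<in> T" and mon: "monic R (e i l) (r b s0)" using b(1) by (auto simp: B_def)
  define k where "k = snd (\<sigma> b)"
  have r0: "r b s0 \<in> corner R (e (fst (\<sigma> b)) k) (e i l)"
    using rc[OF bT s0(1)] \<sigma>(2)[OF bT] G0 by (simp add: k_def)
  have ik': "(fst (\<sigma> b), k) \<in> harada_index m n" using \<sigma>'[OF bT] by (simp add: k_def)
  have \<sigma>b: "fst (\<sigma> b) = i" and kl: "k \<le> l" using monic_classification(1,2)[OF il ik' r0 mon] by auto
  have ik: "(i, k) \<in> harada_index m n" and Eb: "E b = e i k" using ik' \<sigma>b \<sigma>(2)[OF bT] by (simp_all add: k_def)
  have r0: "r b s0 \<in> corner R (e i k) (e i l)" using r0 \<sigma>b by simp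
  \<comment> \<open>the coefficients of the row operations that clear column \<open>s0\<close>\<close>
  have "\<forall>t \<in> T. \<exists>y. y \<in> corner R (E t) (e i k) \<and> r t s0 = y \<otimes> r b s0"
  proof
    fix t assume t: "t \<in> T"
    have "r t s0 \<in> corner R (e (fst (\<sigma> t)) (snd (\<sigma> t))) (e i l)"
      using rc[OF t s0(1)] \<sigma>(2)[OF t] G0 by simp
    then show "\<exists>y. y \<in> corner R (E t) (e i k) \<and> r t s0 = y \<otimes> r b s0"
      using factor_left[OF il ik \<sigma>'[OF t] r0 mon] b(2)[of t] t \<sigma>(2)[OF t] by (auto simp: B_def k_def)
  qed
  then obtain c where c: "\<And>t. t \<in> T \<Longrightarrow> c t \<in> corner R (E t) (e i k)" "\<And>t. t \<in> T \<Longrightarrow> r t s0 = c t \<otimes> r b s0"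
    by metis
  note cR = cornerD[OF c(1)]
  \<comment> \<open>divisibility of row \<open>b\<close> by the pivot takes the place of column operations\<close>
  have row: "\<exists>v \<in> carrier R. r b s = r b s0 \<otimes> v" if s: "s \<in> S" for s
  proof (rule factor_right[OF il ik \<tau>'[OF s] r0 mon])
    show "r b s \<in> corner R (e i k) (e (fst (\<tau> s)) (snd (\<tau> s)))" using rc[OF bT s] Eb \<tau>(2)[OF s] by simp
    show "l \<le> snd (\<tau> s)" using s0(2)[OF s] by (simp add: l_def)
  qed
  let ?T = "T - {b}"
  have T': "finite ?T" and zb: "z b \<in> carrier M" using T zM bT by auto
  define w where "w = lincomb M ?T c z"
  define z' where "z' = z(b := z b \<oplus>\<^bsub>M\<^esub> w)"
  have wM: "w \<in> carrier M" unfolding w_def by (rule M.lincomb_closed) (use cR(1) zM in auto)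
  have smult_w: "u \<odot>\<^bsub>M\<^esub> w = lincomb M ?T (\<lambda>t. c t \<otimes> u) z" if u: "u \<in> carrier R" for u
    unfolding w_def by (rule M.smult_lincomb) (use T' u cR(1) zM in auto)
  have "lincomb M ?T (\<lambda>t. c t \<otimes> e i k) z = w"
    unfolding w_def by (rule M.lincomb_cong) (use cR zM in auto)
  then have we: "e i k \<odot>\<^bsub>M\<^esub> w = w" using smult_w[OF e_simps(1)[OF ik]] by simp
  have z'M: "z' \<in> T \<rightarrow> carrier M" using zM zb wM by (auto simp: z'_def)
  have z'E: "E t \<odot>\<^bsub>M\<^esub> z' t = z' t" if "t \<in> T" for t
    using zE[OF that] zE[OF bT] zb wM we Eb e_simps(1)[OF ik] by (auto simp: z'_def M.smult_r_distr)
  have spans_z: "spans R M E T z \<longleftrightarrow> (\<forall>N. submodule N R M \<and> z ` T \<subseteq> N \<longrightarrow> N = carrier M)"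
    by (rule M.spans_iff) (use T idE zM zE in auto)
  have spans_z': "spans R M E T z' \<longleftrightarrow> (\<forall>N. submodule N R M \<and> z' ` T \<subseteq> N \<longrightarrow> N = carrier M)"
    by (rule M.spans_iff) (use T idE z'M z'E in auto)
  have sp': "spans R M E T z'"
    unfolding spans_z'
  proof (intro allI impI, elim conjE)
    fix N assume N: "submodule N R M" and zN: "z' ` T \<subseteq> N"
    have zt: "z t \<in> N" if "t \<in> ?T" for t using zN that by (auto simp: z'_def image_subset_iff)
    have wN: "w \<in> N" unfolding w_def
      by (rule M.lincomb_in_submodule[OF N T']) (use zt cR(1) in auto)
    have "z b \<oplus>\<^bsub>M\<^esub> w \<in> N" using zN bT by (auto simp: z'_def)
    then have "(z b \<oplus>\<^bsub>M\<^esub> w) \<oplus>\<^bsub>M\<^esub> \<ominus>\<^bsub>M\<^esub> w \<in> N" using M.submoduleD(3,5)[OF N] wN by blast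
    then have "z b \<in> N" using zb wM by (simp add: M.M.a_assoc M.M.r_neg)
    then have "z ` T \<subseteq> N" using zt by blast
    then show "N = carrier M" using sp N unfolding spans_z by blast
  qed
  have kill: "r b s0 \<odot>\<^bsub>M\<^esub> z' b = \<zero>\<^bsub>M\<^esub>"
  proof -
    have "lincomb M ?T (\<lambda>t. c t \<otimes> r b s0) z = lincomb M ?T (\<lambda>t. r t s0) z"
      by (rule M.lincomb_cong) (use c(2) rR(1)[OF _ s0(1)] zM in auto)
    then have "r b s0 \<odot>\<^bsub>M\<^esub> z' b = r b s0 \<odot>\<^bsub>M\<^esub> z b \<oplus>\<^bsub>M\<^esub> lincomb M ?T (\<lambda>t. r t s0) z"
      using rR(1)[OF bT s0(1)] zb wM by (simp add: z'_def M.smult_r_distr smult_w)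
    also have "\<dots> = lincomb M T (\<lambda>t. r t s0) z"
      by (rule M.lincomb_remove[OF T bT, symmetric]) (use rR(1)[OF _ s0(1)] zM in auto)
    finally show ?thesis using col[OF s0(1)] by simp
  qed
  have in_row: "\<exists>v \<in> carrier R. x b = r b s0 \<otimes> v"
    if x: "x \<in> coefs R E T" "lincomb M T x z' = \<zero>\<^bsub>M\<^esub>" for x
  proof -
    note xR = coefs_Pi[OF x(1)]
    have xb: "x b \<in> carrier R" using xR bT by blast
    \<comment> \<open>rewrite the relation between the \<open>z'\<close> as a relation between the \<open>z\<close>\<close>
    define y where "y t = (if t = b then x b else c t \<otimes> x b \<oplus> x t)" for t
    have y: "y \<in> coefs R E T"
      using coefsD[OF x(1)] cR bT ER by (auto simp: coefs_def y_def r_distr m_assoc[symmetric])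
    have "lincomb M ?T y z = lincomb M ?T (\<lambda>t. c t \<otimes> x b \<oplus> x t) z"
      by (rule M.lincomb_cong) (use cR(1) xR xb zM in \<open>auto simp: y_def Pi_iff\<close>)
    also have "\<dots> = lincomb M ?T (\<lambda>t. c t \<otimes> x b) z \<oplus>\<^bsub>M\<^esub> lincomb M ?T x z"
      by (rule M.lincomb_add) (use cR(1) xR xb zM in auto)
    also have "lincomb M ?T (\<lambda>t. c t \<otimes> x b) z = x b \<odot>\<^bsub>M\<^esub> w" by (rule smult_w[OF xb, symmetric])
    also have "lincomb M ?T x z = lincomb M ?T x z'"
      by (rule M.lincomb_cong) (use xR zM in \<open>auto simp: z'_def\<close>)
    finally have rest: "lincomb M ?T y z = x b \<odot>\<^bsub>M\<^esub> w \<oplus>\<^bsub>M\<^esub> lincomb M ?T x z'" .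
    have "lincomb M ?T x z' \<in> carrier M" by (rule M.lincomb_closed) (use xR z'M in auto)
    then have "lincomb M T y z = lincomb M T x z'"
      using M.lincomb_remove[OF T bT coefs_Pi[OF y] zM] M.lincomb_remove[OF T bT xR z'M] rest xb zb wM
      by (simp add: y_def z'_def M.smult_r_distr M.M.a_assoc)
    then obtain d where d: "d \<in> coefs R G S" "\<forall>t \<in> T. y t = lincomb (regular_module R) S d (r t)"
      using rel[OF y] x(2) by auto
    note I = right_ideal_principal[OF rR(1)[OF bT s0(1)]]
    have "lincomb (regular_module R) S d (r b) \<in> r b s0 <# carrier R"
      by (rule M.regular.lincomb_in_submodule[OF _ S coefs_Pi[OF d(1)]])
        (use I right_ideal_iff_submodule row in \<open>auto simp: mem_l_coset_iff\<close>)
    then show ?thesis using bspec[OF d(2) bT] by (auto simp: y_def mem_l_coset_iff)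
  qed
  have z'b: "z' b \<in> carrier M" using z'M bT by blast
  have kill_row: "u \<odot>\<^bsub>M\<^esub> z' b = \<zero>\<^bsub>M\<^esub>" if "v \<in> carrier R" "u = r b s0 \<otimes> v" for u v
    using that kill rR(1)[OF bT s0(1)] z'b by (simp add: M.smult_assoc)
  have ann: "\<exists>v \<in> carrier R. u = r b s0 \<otimes> v"
    if u: "u \<in> carrier R" "e i k \<otimes> u = u" "u \<odot>\<^bsub>M\<^esub> z' b = \<zero>\<^bsub>M\<^esub>" for u
  proof -
    let ?x = "\<lambda>t. if b = t then u else \<zero>"
    have "?x \<in> coefs R E T" using u ER Eb by (auto simp: coefs_def)
    moreover have "lincomb M T ?x z' = \<zero>\<^bsub>M\<^esub>" using M.lincomb_single[OF T bT z'M u(1)] u(3) by simp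
    ultimately show ?thesis using in_row[of ?x] by simp
  qed
  have nz: "z' b \<noteq> \<zero>\<^bsub>M\<^esub>"
  proof
    assume "z' b = \<zero>\<^bsub>M\<^esub>"
    then obtain v where "v \<in> carrier R" "e i k = r b s0 \<otimes> v" using ann[of "e i k"] e_simps[OF ik] by auto
    then show False using minimal[OF bT s0(1)] Eb by metis
  qed
  have "z' b = \<zero>\<^bsub>M\<^esub> \<or> (\<forall>y \<in> carrier M. \<exists>u \<in> carrier R. y = u \<odot>\<^bsub>M\<^esub> z' b)"
    by (rule M.indecomposable_split[OF ind sp' idE bT]) (use in_row kill_row in blast)+
  then have gen: "\<And>y. y \<in> carrier M \<Longrightarrow> \<exists>u \<in> carrier R. y = u \<odot>\<^bsub>M\<^esub> z' b" using nz by blast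
  have ann': "u \<odot>\<^bsub>M\<^esub> z' b = \<zero>\<^bsub>M\<^esub> \<longleftrightarrow> a i k \<otimes> u \<in> P i l" if u: "u \<in> carrier R" "e i k \<otimes> u = u" for u
    using monic_classification(3)[OF il ik r0 mon u] ann[OF u] kill_row by blast
  have "k \<noteq> l"
  proof
    assume "k = l"
    then have "e i k \<odot>\<^bsub>M\<^esub> z' b = \<zero>\<^bsub>M\<^esub>"
      using ann'[OF e_simps(1,2)[OF ik]] a_props(6)[OF ik] a_in_P[OF ik] by simp
    then show False using nz z'E[OF bT] Eb by simp
  qed
  then have "k < l" using kl by simp
  moreover have "rmod_iso R M (harada_quotient R e i k l)"
    by (rule cyclic_module_iso_quotient[OF M ik il kl z'b _ gen ann']) (use z'E[OF bT] Eb in auto)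
  ultimately show ?thesis using ik il unfolding index_iff by blast
qed

text \<open>
  In a presentation with the least number of generators no entry can be cancelled. If it has no
  relations then the module is projective, which is excluded by its projective dimension.
\<close>

lemma projective_dimension_1_classification:
  assumes fg: "fg_module R M" and ind: "indecomposable_module R M" and pd: "projective_dimension R M = 1"
  shows "\<exists>i k l. 1 \<le> i \<and> i \<le> m \<and> 1 \<le> k \<and> k < l \<and> l \<le> n i \<and> rmod_iso R M (harada_quotient R e i k l)"
proof -
  have M: "right_module R M" using fg by (simp add: fg_module_def)
  interpret M: right_module R M by fact
  have no0: "\<not> (\<exists>Pr d \<epsilon>. projective_resolution R M 0 Pr d \<epsilon>)"
    and ex1: "\<exists>Pr d \<epsilon>. projective_resolution R M 1 Pr d \<epsilon>"
    using pd unfolding projective_dimension_eq_1_iff by auto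
  define Q where "Q q \<longleftrightarrow> (\<exists>T E z S G r. E \<in> T \<rightarrow> prims \<and> G \<in> S \<rightarrow> prims \<and>
    presentation R M E (T :: nat set) z G (S :: nat set) r \<and> card T = q)" for q
  obtain Pr d \<epsilon> where "projective_resolution R M 1 Pr d \<epsilon>" using ex1 by blast
  from presentation_exists[OF complete M this] have "\<exists>q. Q q" unfolding Q_def by metis
  then obtain q where q: "Q q" "\<And>q'. Q q' \<Longrightarrow> q \<le> q'" using ex_least_nat_le[of Q] by (metis linorder_not_less)
  then obtain T :: "nat set" and E z and S :: "nat set" and G r where ET: "E \<in> T \<rightarrow> prims" and GS: "G \<in> S \<rightarrow> prims"
    and pres: "presentation R M E T z G S r" and card: "card T = q" unfolding Q_def by metis
  have sp: "spans R M E T z" using pres by (simp add: presentation_def)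
  note T = spansD(1)[OF sp] and zM = spansD(2)[OF sp] and zE = spansD(3)[OF sp]
  have prim: "primitive_idempotent R f" if "f \<in> prims" for f
    using that e_primitive by (auto simp: prims_iff)
  show ?thesis
  proof (cases "S = {}")
    case False
    show ?thesis
    proof (rule minimal_presentation_cyclic[OF M ind pres ET GS False])
      fix b s x assume b: "b \<in> T" and s: "s \<in> S" and x: "x \<in> carrier R"
      show "r b s \<otimes> x \<noteq> E b"
      proof
        assume rx: "r b s \<otimes> x = E b"
        obtain r' where "presentation R M E (T - {b}) z G (S - {s}) r'"
          using M.presentation_cancel[OF pres _ _ b s x rx] prim ET GS by blast
        moreover have "E \<in> T - {b} \<rightarrow> prims" "G \<in> S - {s} \<rightarrow> prims" using ET GS by auto
        ultimately have "Q (card (T - {b}))" unfolding Q_def by blast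
        then have "q \<le> card (T - {b})" by (rule q(2))
        then show False using card b T by (metis card_Diff1_less linorder_not_less)
      qed
    qed
  next
    case True
    \<comment> \<open>no relations: \<open>M\<close> is projective\<close>
    have rel: "\<forall>t \<in> T. c t = \<zero>" if "c \<in> coefs R E T" "lincomb M T c z = \<zero>\<^bsub>M\<^esub>" for c
      using presentationD[OF pres[unfolded True]] that by (simp add: regular_module_simps)
    have "T \<noteq> {}"
    proof
      assume "T = {}"
      then have "carrier M = {\<zero>\<^bsub>M\<^esub>}" using spansD(4)[OF sp] by auto
      then show False using ind by (simp add: indecomposable_module_def)
    qed
    then obtain b where b: "b \<in> T" by blast
    have zb: "z b \<in> carrier M" using zM b by blast
    have "E b \<in> prims" using ET b by blast
    then obtain i k where ik: "(i, k) \<in> harada_index m n" "E b = e i k" by (auto simp: prims_iff)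
    have idE: "idempotent_elt R (E t)" if "t \<in> T" for t
      using prim[of "E t"] ET that by (auto simp: primitive_idempotent_def)
    have free: "u = \<zero>" if u: "u \<in> carrier R" "e i k \<otimes> u = u" "u \<odot>\<^bsub>M\<^esub> z b = \<zero>\<^bsub>M\<^esub>" for u
    proof -
      let ?x = "\<lambda>t. if b = t then u else \<zero>"
      have "?x \<in> coefs R E T" using u idE ik(2) by (auto simp: coefs_def idempotent_elt_def)
      moreover have "lincomb M T ?x z = \<zero>\<^bsub>M\<^esub>" using M.lincomb_single[OF T b zM u(1)] u(3) by simp
      ultimately have "\<forall>t \<in> T. ?x t = \<zero>" by (rule rel)
      from bspec[OF this b] show ?thesis by simp
    qed
    have "z b = \<zero>\<^bsub>M\<^esub> \<or> (\<forall>y \<in> carrier M. \<exists>u \<in> carrier R. y = u \<odot>\<^bsub>M\<^esub> z b)"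
    proof (rule M.indecomposable_split[OF ind sp idE b])
      show "c b \<odot>\<^bsub>M\<^esub> z b = \<zero>\<^bsub>M\<^esub>" if "c \<in> coefs R E T" "lincomb M T c z = \<zero>\<^bsub>M\<^esub>" for c
        using bspec[OF rel[OF that] b] zb by simp
    qed
    moreover have "z b \<noteq> \<zero>\<^bsub>M\<^esub>" using free[of "e i k"] e_simps[OF ik(1)] by auto
    ultimately have gen: "\<exists>u \<in> carrier R. y = u \<odot>\<^bsub>M\<^esub> z b" if "y \<in> carrier M" for y using that by blast
    have "e i k \<odot>\<^bsub>M\<^esub> z b = z b" using zE[OF b] ik(2) by simp
    then have "\<exists>Pr d \<epsilon>. projective_resolution R M 0 Pr d \<epsilon>"
      by (rule free_cyclic_module_resolution[OF M ik(1) zb _ gen free])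
    then show ?thesis using no0 by blast
  qed
qed

end

theorem theorem1p3:
  fixes K :: "('k, 'x) ring_scheme" and R :: "('k, 'r) module"
    and m :: nat and n :: "nat \<Rightarrow> nat" and e :: "nat \<Rightarrow> nat \<Rightarrow> 'r"
  assumes "left_harada_algebra K R"
    and "harada_arrangement R m n e"
  shows
    "(\<forall>i k l. 1 \<le> i \<and> i \<le> m \<and> 1 \<le> k \<and> k < l \<and> l \<le> n i \<longrightarrow>
        fg_module R (harada_quotient R e i k l) \<and>
        indecomposable_module R (harada_quotient R e i k l) \<and>
        projective_dimension R (harada_quotient R e i k l) = 1) \<and>
     (\<forall>i k l i' k' l'.
        1 \<le> i \<and> i \<le> m \<and> 1 \<le> k \<and> k < l \<and> l \<le> n i \<and>
        1 \<le> i' \<and> i' \<le> m \<and> 1 \<le> k' \<and> k' < l' \<and> l' \<le> n i' \<and>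
        rmod_iso R (harada_quotient R e i k l) (harada_quotient R e i' k' l') \<longrightarrow>
        i = i' \<and> k = k' \<and> l = l') \<and>
     (\<forall>M :: ('r, 'm) module.
        fg_module R M \<and> indecomposable_module R M \<and> projective_dimension R M = 1 \<longrightarrow>
        (\<exists>i k l. 1 \<le> i \<and> i \<le> m \<and> 1 \<le> k \<and> k < l \<and> l \<le> n i \<and>
                 rmod_iso R M (harada_quotient R e i k l)))"
proof (intro conjI allI impI)
  interpret left_harada K R m n e using assms by (rule left_harada.intro)
  fix i k l assume "1 \<le> i \<and> i \<le> m \<and> 1 \<le> k \<and> k < l \<and> l \<le> n i"
  then have il: "(i, l) \<in> harada_index m n" and k: "1 \<le> k" "k < l" by (auto simp: index_iff)
  show "fg_module R (harada_quotient R e i k l)" by (rule quotient_fg[OF il k])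
  show "indecomposable_module R (harada_quotient R e i k l)" by (rule quotient_indecomposable[OF il k])
  show "projective_dimension R (harada_quotient R e i k l) = 1" by (rule quotient_projective_dimension[OF il k])
next
  interpret left_harada K R m n e using assms by (rule left_harada.intro)
  fix i k l i' k' l'
  assume *: "1 \<le> i \<and> i \<le> m \<and> 1 \<le> k \<and> k < l \<and> l \<le> n i \<and>
    1 \<le> i' \<and> i' \<le> m \<and> 1 \<le> k' \<and> k' < l' \<and> l' \<le> n i' \<and>
    rmod_iso R (harada_quotient R e i k l) (harada_quotient R e i' k' l')"
  then have "(i, l) \<in> harada_index m n" "(i', l') \<in> harada_index m n" by (auto simp: index_iff)
  then have "i = i' \<and> k = k' \<and> l = l'" using quotient_iso_unique * by blast
  then show "i = i'" "k = k'" "l = l'" by auto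
next
  interpret left_harada K R m n e using assms by (rule left_harada.intro)
  fix M :: "('r, 'm) module"
  assume "fg_module R M \<and> indecomposable_module R M \<and> projective_dimension R M = 1"
  then show "\<exists>i k l. 1 \<le> i \<and> i \<le> m \<and> 1 \<le> k \<and> k < l \<and> l \<le> n i \<and> rmod_iso R M (harada_quotient R e i k l)"
    using projective_dimension_1_classification by blast
qed

end
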